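(* Let $K, K_1,\ldots,K_n$ be positive kernel operators on $L^2(X,\mu)$ and let $\alpha\in[0,1]$. Then for every $\rho\in\{r, r_{ess},\gamma,\|\cdot\|,w\}$ we have $$\rho\big(S_\alpha(K_1)\cdots S_\alpha(K_n)\big)\le \rho\Big((K_1\cdots K_n)^{(\alpha)}\circ\big((K_n\cdots K_1)^*\big)^{(1-\alpha)}\Big)\le \rho(K_1\cdots K_n)^{\alpha}\,\rho(K_n\cdots K_1)^{1-\alpha},$$ $$\rho\big(S_\alpha(K_1)+\cdots+S_\alpha(K_n)\big)\le\rho\big(S_\alpha(K_1+\cdots+K_n)\big)\le\rho(K_1+\cdots+K_n),$$ and in particular $$\rho(S_\alpha(K))\le\rho(K).$$ Moreover, for $\rho\in\{r,r_{ess}\}$ and positive kernel operators $K_1,K_2$ on $L^2(X,\mu)$, $$\rho\big(S_\alpha(K_1)S_\alpha(K_2)\big)\le\rho\Big((K_1K_2)^{(\alpha)}\circ\big((K_2K_1)^*\big)^{(1-\alpha)}\Big)\le\rho(K_1K_2).$$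
   Context: $\mu$ is a $\sigma$-finite positive measure on a $\sigma$-algebra of subsets of a nonempty set $X$; $L^2(X,\mu)$ is the complex Hilbert space. A kernel operator $K$ on $L^2(X,\mu)$ is a linear operator $(Kf)(x)=\int_X k(x,y)f(y)\,d\mu(y)$ with $\mu\times\mu$-measurable kernel $k$ such that $\int_X|k(x,y)f(y)|\,d\mu(y)<\infty$ for all $f$ and almost all $x$. It is positive if it maps nonnegative functions to nonnegative functions (equivalently $k\ge 0$ a.e.); positive operators are automatically bounded. The adjoint $K^*$ has kernel $k(y,x)$ at $(x,y)$. The Hadamard product $K\circ H$ has kernel $k(x,y)h(x,y)$, and the Hadamard power $K^{(t)}$, $t\ge0$, has kernel $k(x,y)^t$ (convention $0^0=1$). For $\alpha\in[0,1]$, $S_\alpha(K)=K^{(\alpha)}\circ(K^* )^{(1-\alpha)}$ is the positive kernel operator with kernel $k(x,y)^\alpha k(y,x)^{1-\alpha}$. Juxtaposition denotes composition of operators. $r$ is the spectral radius, $\|\cdot\|$ the operator norm, $w(K)=\sup\{|\langle Kf,f\rangle|:\|f\|_2=1\}$ the numerical radius, $\gamma(K)$ the Hausdorff measure of noncompactness, i.e. the infimum of all $\delta>0$ such that $K(D)\subset M+\delta D$ for some finite set $M$, where $D$ is the closed unit ball, and $r_{ess}(K)=\lim_{j\to\infty}\gamma(K^j)^{1/j}$ the essential spectral radius (the spectral radius of the image of $K$ in the Calkin algebra). *)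

theory Defs
  imports "HOL-Analysis.Analysis"
begin

text \<open>
  Elements of the complex space \<open>L\<^sup>2(X,\<mu>)\<close> (with \<open>X = space M\<close>) are represented by square-integrable
  functions, and operators by maps on representatives. Equality of elements of \<open>L\<^sup>2\<close> is equality
  almost everywhere; values of operators outside \<open>L2 M\<close> are irrelevant.
\<close>

type_synonym 'a l2op = "('a \<Rightarrow> complex) \<Rightarrow> ('a \<Rightarrow> complex)"

definition L2 :: "'a measure \<Rightarrow> ('a \<Rightarrow> complex) set" where
  "L2 M = {f \<in> borel_measurable M. integrable M (\<lambda>x. (cmod (f x))\<^sup>2)}"

definition l2inner :: "'a measure \<Rightarrow> ('a \<Rightarrow> complex) \<Rightarrow> ('a \<Rightarrow> complex) \<Rightarrow> complex" where
  "l2inner M f g = (\<integral>x. f x * cnj (g x) \<partial>M)"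

definition l2norm :: "'a measure \<Rightarrow> ('a \<Rightarrow> complex) \<Rightarrow> real" where
  "l2norm M f = sqrt (\<integral>x. (cmod (f x))\<^sup>2 \<partial>M)"

definition l2_bounded_op :: "'a measure \<Rightarrow> 'a l2op \<Rightarrow> bool" where
  "l2_bounded_op M T \<longleftrightarrow>
     (\<forall>f\<in>L2 M. T f \<in> L2 M) \<and>
     (\<forall>f\<in>L2 M. \<forall>g\<in>L2 M. (AE x in M. f x = g x) \<longrightarrow> (AE x in M. T f x = T g x)) \<and>
     (\<forall>f\<in>L2 M. \<forall>g\<in>L2 M. AE x in M. T (\<lambda>x. f x + g x) x = T f x + T g x) \<and>
     (\<forall>c. \<forall>f\<in>L2 M. AE x in M. T (\<lambda>x. c * f x) x = c * T f x) \<and>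
     (\<exists>C. \<forall>f\<in>L2 M. l2norm M (T f) \<le> C * l2norm M f)"

definition l2_adjoint :: "'a measure \<Rightarrow> 'a l2op \<Rightarrow> 'a l2op" where
  "l2_adjoint M T =
     (SOME S. l2_bounded_op M S \<and> (\<forall>f\<in>L2 M. \<forall>g\<in>L2 M. l2inner M (T f) g = l2inner M f (S g)))"


definition is_kernel :: "'a measure \<Rightarrow> ('a \<times> 'a \<Rightarrow> complex) \<Rightarrow> 'a l2op \<Rightarrow> bool" where
  "is_kernel M k T \<longleftrightarrow>
     k \<in> borel_measurable (M \<Otimes>\<^sub>M M) \<and>
     (\<forall>f\<in>L2 M. T f \<in> L2 M \<and>
        (AE x in M. integrable M (\<lambda>y. k (x, y) * f y) \<and> T f x = (\<integral>y. k (x, y) * f y \<partial>M)))"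

definition kernel_op :: "'a measure \<Rightarrow> ('a \<times> 'a \<Rightarrow> complex) \<Rightarrow> 'a l2op" where
  "kernel_op M k f x = (\<integral>y. k (x, y) * f y \<partial>M)"

text \<open>For a kernel operator on a \<open>\<sigma>\<close>-finite space the kernel is unique up to a null set of \<open>M \<Otimes>\<^sub>M M\<close>,
  so the choice below does not affect the operators built from it.\<close>

definition kernel_of :: "'a measure \<Rightarrow> 'a l2op \<Rightarrow> ('a \<times> 'a \<Rightarrow> complex)" where
  "kernel_of M T = (SOME k. is_kernel M k T)"

definition positive_kernel_op :: "'a measure \<Rightarrow> 'a l2op \<Rightarrow> bool" where
  "positive_kernel_op M T \<longleftrightarrow>
     (\<exists>k. is_kernel M k T) \<and>
     (\<forall>f\<in>L2 M. (AE x in M. f x \<in> nonneg_Reals) \<longrightarrow> (AE x in M. T f x \<in> nonneg_Reals))"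

text \<open>Real powers with the convention \<open>0\<^sup>0 = 1\<close>; the library has \<open>0 powr 0 = 0\<close>.\<close>

definition rpow :: "real \<Rightarrow> real \<Rightarrow> real" where
  "rpow x t = (if t = 0 then 1 else x powr t)"

text \<open>Hadamard powers and products act on kernels, because a Hadamard power of a positive kernel
  operator need not be an operator on \<open>L\<^sup>2\<close>. The kernels of positive operators are nonnegative
  almost everywhere; \<open>cmod\<close> only turns them into real numbers.\<close>

definition hadamard_power :: "('a \<times> 'a \<Rightarrow> complex) \<Rightarrow> real \<Rightarrow> ('a \<times> 'a \<Rightarrow> complex)" where
  "hadamard_power k t p = complex_of_real (rpow (cmod (k p)) t)"

definition hadamard_prod ::
  "('a \<times> 'a \<Rightarrow> complex) \<Rightarrow> ('a \<times> 'a \<Rightarrow> complex) \<Rightarrow> ('a \<times> 'a \<Rightarrow> complex)" where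
  "hadamard_prod k h p = k p * h p"

text \<open>\<open>hadamard_mean M \<alpha> K H\<close> is \<open>K\<^bsup>(\<alpha>)\<^esup> \<circ> H\<^bsup>(1-\<alpha>)\<^esup>\<close>.\<close>

definition hadamard_mean :: "'a measure \<Rightarrow> real \<Rightarrow> 'a l2op \<Rightarrow> 'a l2op \<Rightarrow> 'a l2op" where
  "hadamard_mean M \<alpha> K H =
     kernel_op M (hadamard_prod (hadamard_power (kernel_of M K) \<alpha>)
                                (hadamard_power (kernel_of M H) (1 - \<alpha>)))"

definition S_op :: "'a measure \<Rightarrow> real \<Rightarrow> 'a l2op \<Rightarrow> 'a l2op" where
  "S_op M \<alpha> K = hadamard_mean M \<alpha> K (l2_adjoint M K)"

definition op_prod :: "'a l2op list \<Rightarrow> 'a l2op" where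
  "op_prod Ks = foldr (\<circ>) Ks id"

definition op_sum :: "'a l2op list \<Rightarrow> 'a l2op" where
  "op_sum Ks f x = (\<Sum>K\<leftarrow>Ks. K f x)"


definition l2_opnorm :: "'a measure \<Rightarrow> 'a l2op \<Rightarrow> real" where
  "l2_opnorm M T = (SUP f\<in>{f \<in> L2 M. l2norm M f \<le> 1}. l2norm M (T f))"

text \<open>In the next two suprema of nonnegative numbers, the element \<open>0\<close> only matters if \<open>L\<^sup>2\<close> is trivial
  (\<open>\<mu> = 0\<close>), where it fixes the supremum of the empty set to be \<open>0\<close>.\<close>

definition numerical_radius :: "'a measure \<Rightarrow> 'a l2op \<Rightarrow> real" where
  "numerical_radius M T =
     Sup (insert 0 {cmod (l2inner M (T f) f) | f. f \<in> L2 M \<and> l2norm M f = 1})"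

definition l2_spectrum :: "'a measure \<Rightarrow> 'a l2op \<Rightarrow> complex set" where
  "l2_spectrum M T =
     {c. \<not> (\<exists>R. l2_bounded_op M R \<and>
            (\<forall>f\<in>L2 M. (AE x in M. R (\<lambda>y. c * f y - T f y) x = f x) \<and>
                      (AE x in M. c * R f x - T (R f) x = f x)))}"

definition spectral_radius :: "'a measure \<Rightarrow> 'a l2op \<Rightarrow> real" where
  "spectral_radius M T = Sup (insert 0 (cmod ` l2_spectrum M T))"

definition hausdorff_mnc :: "'a measure \<Rightarrow> 'a l2op \<Rightarrow> real" where
  "hausdorff_mnc M T =
     Inf {\<delta>. \<delta> > 0 \<and> (\<exists>F. finite F \<and> F \<subseteq> L2 M \<and>
            (\<forall>f\<in>L2 M. l2norm M f \<le> 1 \<longrightarrow> (\<exists>g\<in>F. l2norm M (\<lambda>x. T f x - g x) \<le> \<delta>)))}"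

definition ess_spectral_radius :: "'a measure \<Rightarrow> 'a l2op \<Rightarrow> real" where
  "ess_spectral_radius M T = lim (\<lambda>j. root j (hausdorff_mnc M (T ^^ j)))"

end

theory Submission
  imports Defs
begin

text \<open>
  All five functionals are instances of one notion. Write \<open>k\<close> for the nonnegative kernel of a positive
  kernel operator \<open>K\<close>. A functional \<open>\<rho>\<close> is \<^emph>\<open>Hadamard log-convex\<close> if transposing the kernel does not change it
  and if \<open>t \<le> a\<^sup>\<alpha> b\<^sup>1\<^sup>-\<^sup>\<alpha>\<close> a.e. for the kernels of \<open>T\<close>, \<open>A\<close>, \<open>B\<close> implies \<open>\<rho>(T) \<le> \<rho>(A)\<^sup>\<alpha> \<rho>(B)\<^sup>1\<^sup>-\<^sup>\<alpha>\<close>; the case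
  \<open>A = B\<close> says that \<open>\<rho>\<close> is monotone. Given this, the proposition is Hoelder's inequality for kernels:
  a product of weighted geometric means is pointwise at most the mean of the products, a sum of means
  is at most the mean of the sums (\<open>kernel_comp_mean_le\<close>, \<open>kernel_mean_add_le\<close>), and \<open>S\<^sub>\<alpha>(K)\<close> is the mean
  of \<open>k\<close> and its transpose, which is the kernel of the adjoint. For two factors and \<open>\<rho>\<close> one of the two
  spectral radii, \<open>\<rho>(K\<^sub>2 K\<^sub>1) = \<rho>(K\<^sub>1 K\<^sub>2)\<close> turns the geometric mean on the right into \<open>\<rho>(K\<^sub>1 K\<^sub>2)\<close>.

  The geometric mean is accessible through linear bounds, because \<open>a\<^sup>\<alpha> b\<^sup>1\<^sup>-\<^sup>\<alpha>\<close> is the infimum over \<open>t > 0\<close> of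
  \<open>\<alpha> t\<^sup>1\<^sup>-\<^sup>\<alpha> a + (1 - \<alpha>) t\<^sup>-\<^sup>\<alpha> b\<close> (\<open>young_rpow\<close>, \<open>le_rpow_mean_if_young\<close>): whatever is monotone, subadditive and
  positively homogeneous in the kernel (\<open>dominated_seminorm\<close>) is automatically log-convex.

  The operator norm and the numerical radius are seminorms of this kind since they are suprema of the
  form \<open>\<integral>\<integral> g(x) k(x,y) f(y)\<close> over nonnegative \<open>f\<close>, \<open>g\<close> in the unit ball, with \<open>f = g\<close> for the latter; this form is
  linear and increasing in \<open>k\<close> and symmetric under transposition.

  For the measure of noncompactness, fix \<open>u > 0\<close> in \<open>L\<^sup>2\<close> and call a set \<open>E\<close> small if \<open>\<integral>\<^sub>E u\<^sup>2\<close> is small.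
  Then \<open>\<gamma>(K)\<close> is the limiting norm of the kernel restricted to strips \<open>X \<times> E\<close> with small \<open>E\<close>, and
  also to strips \<open>E \<times> X\<close>. Indeed a finite subset of \<open>L\<^sup>2\<close> has small mass on small sets, which bounds the row strips
  by \<open>\<gamma>(K)\<close> (\<open>small_rows_if_admissible\<close>). Conversely, cutting \<open>f\<close> where \<open>|f| > c u\<close> leaves a function on a
  small set and one in an order interval, and a kernel operator maps order intervals to totally
  bounded sets (\<open>order_compact_nonneg_kernel\<close>); this bounds \<open>\<gamma>(K)\<close> by the column strips
  (\<open>hausdorff_mnc_le_if_small_cols\<close>). Transposition exchanges rows and columns, so \<open>\<gamma>(K\<^sup>*) = \<gamma>(K)\<close> and all
  these numbers agree, and domination for \<open>\<gamma>\<close> is inherited from domination for norms.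

  Both spectral radii are limits of \<open>\<rho>(K\<^sup>n)\<^sup>1\<^sup>/\<^sup>n\<close> for a submultiplicative \<open>\<rho>\<close>, the norm or \<open>\<gamma>\<close>, and log-convexity
  passes to such limits because powers of means are dominated by means of powers. For the spectral
  radius this uses Gelfand's formula \<open>r(K) = L\<close> with \<open>L = lim \<parallel>K\<^sup>n\<parallel>\<^sup>1\<^sup>/\<^sup>n\<close>. One direction is the Neumann
  series. For the other, positivity gives a direct argument that \<open>L\<close> itself is in the spectrum
  (\<open>radius_in_spectrum\<close>): otherwise the partial sums of the Neumann series at \<open>l > L\<close> stay bounded as
  \<open>l\<close> decreases to \<open>L\<close>, their squares contain the term \<open>K\<^sup>n\<close> exactly \<open>n + 1\<close> times, and so
  \<open>(n + 1) \<parallel>K\<^sup>n\<parallel> \<le> C L\<^sup>n\<^sup>+\<^sup>2\<close>, contradicting \<open>\<parallel>K\<^sup>n\<parallel> \<ge> L\<^sup>n\<close>.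
\<close>

section \<open>Weighted geometric means and Fekete's lemma\<close>

lemma rpow_nonneg [simp]: "0 \<le> rpow x t"
  by (simp add: rpow_def)

lemma rpow_one [simp]: "0 \<le> x \<Longrightarrow> rpow x 1 = x"
  by (simp add: rpow_def)

lemma rpow_zero [simp]: "rpow x 0 = 1"
  by (simp add: rpow_def)

lemma rpow_mult:
  assumes "0 \<le> x" "0 \<le> y"
  shows "rpow (x * y) t = rpow x t * rpow y t"
  using assms by (simp add: rpow_def powr_mult)

lemma rpow_mono:
  assumes "0 \<le> x" "x \<le> y" "0 \<le> t"
  shows "rpow x t \<le> rpow y t"
  using assms by (auto simp: rpow_def intro: powr_mono2)

lemma rpow_self_mean:
  assumes "0 \<le> x"
  shows "rpow x \<alpha> * rpow x (1 - \<alpha>) = x"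
proof (cases "x = 0 \<or> \<alpha> = 0 \<or> \<alpha> = 1")
  case True
  then show ?thesis using assms by (auto simp: rpow_def)
next
  case False
  then show ?thesis using assms by (simp add: rpow_def powr_add[symmetric])
qed

text \<open>
  Weighted arithmetic-geometric mean inequality for \<open>t\<^sup>1\<^sup>-\<^sup>\<alpha> a\<close> and \<open>t\<^sup>-\<^sup>\<alpha> b\<close>, whose weighted geometric mean does
  not depend on \<open>t\<close>.
\<close>

lemma young_rpow:
  assumes "0 \<le> a" "0 \<le> b" "0 \<le> \<alpha>" "\<alpha> \<le> 1" "0 < t"
  shows "rpow a \<alpha> * rpow b (1 - \<alpha>)
           \<le> (\<alpha> * t powr (1 - \<alpha>)) * a + ((1 - \<alpha>) * t powr (- \<alpha>)) * b"
proof (cases "\<alpha> = 0 \<or> \<alpha> = 1 \<or> a = 0 \<or> b = 0")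
  case True
  then show ?thesis
    using assms by (auto simp: rpow_def)
next
  case False
  with assms have pos: "0 < a" "0 < b" "0 < \<alpha>" "\<alpha> < 1" by auto
  have "(t powr (1 - \<alpha>) * a) powr \<alpha> * (t powr (- \<alpha>) * b) powr (1 - \<alpha>)
          \<le> \<alpha> * (t powr (1 - \<alpha>) * a) + (1 - \<alpha>) * (t powr (- \<alpha>) * b)"
    using pos assms by (intro Youngs_inequality_0) auto
  moreover have "(t powr (1 - \<alpha>) * a) powr \<alpha> * (t powr (- \<alpha>) * b) powr (1 - \<alpha>)
      = a powr \<alpha> * b powr (1 - \<alpha>) * t powr ((1 - \<alpha>) * \<alpha> + - \<alpha> * (1 - \<alpha>))"
    using pos assms unfolding powr_add by (simp add: powr_mult powr_powr mult_ac)
  ultimately show ?thesis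
    using pos assms by (simp add: rpow_def mult_ac)
qed

text \<open>
  The family of linear bounds is sharp: for positive \<open>a\<close> and \<open>b\<close> equality is attained at \<open>t = b / a\<close>, and
  if one of them vanishes and \<open>0 < \<alpha> < 1\<close>, the bound tends to \<open>0\<close> at one end of the range of \<open>t\<close>.
\<close>

lemma le_rpow_mean_if_young:
  assumes "0 \<le> a" "0 \<le> b" "0 \<le> \<alpha>" "\<alpha> \<le> 1"
    and young: "\<And>t. 0 < t \<Longrightarrow>
      z \<le> (\<alpha> * t powr (1 - \<alpha>)) * a + ((1 - \<alpha>) * t powr (- \<alpha>)) * b"
  shows "z \<le> rpow a \<alpha> * rpow b (1 - \<alpha>)"
proof -
  consider "\<alpha> = 0" | "\<alpha> = 1" | "0 < \<alpha>" "\<alpha> < 1" "a = 0" | "0 < \<alpha>" "\<alpha> < 1" "b = 0"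
    | "0 < \<alpha>" "\<alpha> < 1" "0 < a" "0 < b"
    using assms(1-4) by fastforce
  then show ?thesis
  proof cases
    case 3
    have "((\<lambda>t. ((1 - \<alpha>) * t powr (- \<alpha>)) * b) \<longlongrightarrow> ((1 - \<alpha>) * 0) * b) at_top"
      using 3 by (intro tendsto_intros tendsto_neg_powr filterlim_ident) auto
    moreover have "eventually (\<lambda>t. z \<le> ((1 - \<alpha>) * t powr (- \<alpha>)) * b) at_top"
      using eventually_gt_at_top[of 0] by eventually_elim (use young 3 in auto)
    ultimately have "z \<le> ((1 - \<alpha>) * 0) * b"
      by (rule tendsto_lowerbound) simp
    then show ?thesis using 3 by (simp add: rpow_def)
  next
    case 4
    have "((\<lambda>s. (\<alpha> * s powr (- (1 - \<alpha>))) * a) \<longlongrightarrow> (\<alpha> * 0) * a) at_top"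
      using 4 by (intro tendsto_intros tendsto_neg_powr filterlim_ident) auto
    moreover have "eventually (\<lambda>s. z \<le> (\<alpha> * s powr (- (1 - \<alpha>))) * a) at_top"
      using eventually_gt_at_top[of 0]
    proof eventually_elim
      case (elim s)
      then have "(1 / s) powr (1 - \<alpha>) = s powr (- (1 - \<alpha>))"
        by (simp add: powr_divide powr_minus_divide del: minus_diff_eq)
      then show ?case
        using young[of "1 / s"] elim 4 by simp
    qed
    ultimately have "z \<le> (\<alpha> * 0) * a"
      by (rule tendsto_lowerbound) simp
    then show ?thesis using 4 by (simp add: rpow_def)
  next
    case 5
    have "(b / a) powr (1 - \<alpha>) * a = a powr \<alpha> * b powr (1 - \<alpha>)"
      using 5 by (simp add: powr_divide powr_diff divide_simps)
    moreover have "(b / a) powr (- \<alpha>) * b = a powr \<alpha> * b powr (1 - \<alpha>)"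
      using 5 by (simp add: powr_divide powr_diff powr_minus divide_simps)
    ultimately have "(\<alpha> * (b / a) powr (1 - \<alpha>)) * a + ((1 - \<alpha>) * (b / a) powr (- \<alpha>)) * b
        = \<alpha> * (a powr \<alpha> * b powr (1 - \<alpha>)) + (1 - \<alpha>) * (a powr \<alpha> * b powr (1 - \<alpha>))"
      by (simp add: mult.assoc)
    also have "\<dots> = a powr \<alpha> * b powr (1 - \<alpha>)"
      by (simp add: algebra_simps)
    finally show ?thesis
      using young[of "b / a"] 5 by (simp add: rpow_def)
  qed (use young[of 1] assms in \<open>auto simp: rpow_def\<close>)
qed

lemma root_rpow:
  assumes "0 \<le> x" "0 < n"
  shows "root n (rpow x t) = rpow (root n x) t"
proof (cases "x = 0 \<or> t = 0")
  case False
  then show ?thesis using assms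
    by (simp add: rpow_def root_powr_inverse powr_powr mult.commute)
qed (use assms in \<open>auto simp: rpow_def\<close>)

lemma tendsto_rpow:
  assumes "X \<longlonglongrightarrow> L" "\<And>n. 0 \<le> X n" "0 \<le> t"
  shows "(\<lambda>n. rpow (X n) t) \<longlonglongrightarrow> rpow L t"
proof (cases "t = 0")
  case False
  then show ?thesis
    using assms by (simp add: rpow_def tendsto_powr')
qed simp

text \<open>
  Fekete's lemma in multiplicative form, by division of the index by an \<open>m\<close> for which the root is nearly
  minimal. The inequality is asked for positive indices because in the applications index \<open>0\<close>
  belongs to the identity, which has no kernel.
\<close>

lemma fekete_root:
  fixes a :: "nat \<Rightarrow> real"
  assumes nonneg: "\<And>n. 0 \<le> a n"
    and submult: "\<And>m n. 0 < m \<Longrightarrow> 0 < n \<Longrightarrow> a (m + n) \<le> a m * a n"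
  obtains L where "(\<lambda>n. root n (a n)) \<longlonglongrightarrow> L" "0 \<le> L" "\<And>n. 0 < n \<Longrightarrow> L ^ n \<le> a n"
proof -
  define L where "L = Inf ((\<lambda>n. root n (a n)) ` {0<..})"
  have bdd: "bdd_below ((\<lambda>n. root n (a n)) ` {0<..})"
    by (rule bdd_belowI[of _ 0]) (use nonneg in auto)
  have L0: "0 \<le> L"
    unfolding L_def by (intro cINF_greatest) (use nonneg in auto)
  have L_le: "L \<le> root n (a n)" if "0 < n" for n
    unfolding L_def by (intro cINF_lower bdd) (use that in auto)
  have pow: "L ^ n \<le> a n" if "0 < n" for n
  proof -
    have "L ^ n \<le> root n (a n) ^ n"
      using L_le[OF that] L0 by (rule power_mono)
    then show ?thesis using that nonneg by simp
  qed
  have iter: "a (q * m + r) \<le> a m ^ q * a r" if "0 < m" "0 < r" for q m r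
  proof (induction q)
    case (Suc q)
    have "a (m + (q * m + r)) \<le> a m * a (q * m + r)"
      using that by (intro submult) auto
    also have "\<dots> \<le> a m * (a m ^ q * a r)"
      using Suc nonneg by (intro mult_left_mono) auto
    finally show ?case by (simp add: algebra_simps)
  qed simp
  have "(\<lambda>n. root n (a n)) \<longlonglongrightarrow> L"
  proof (rule order_tendstoI)
    fix c assume "c < L"
    then show "eventually (\<lambda>n. c < root n (a n)) sequentially"
      using L_le by (intro eventually_sequentiallyI[of 1]) (metis less_le_trans less_eq_Suc_le One_nat_def)
  next
    fix c assume "L < c"
    then obtain b where b: "L < b" "b < c" using dense by blast
    then have b0: "0 < b" using L0 by linarith
    have "\<exists>m. 0 < m \<and> root m (a m) < b"
      using b(1) unfolding L_def using cINF_less_iff[OF _ bdd] by auto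
    then obtain m where m: "0 < m" "root m (a m) < b" by blast
    have "a m = root m (a m) ^ m" using m nonneg by simp
    also have "\<dots> \<le> b ^ m" using m nonneg by (intro power_mono) auto
    finally have am: "a m \<le> b ^ m" .
    define C where "C = 1 + (\<Sum>r\<le>m. a r / b ^ r)"
    have C1: "1 \<le> C" unfolding C_def using nonneg b0 by (simp add: sum_nonneg)
    have bound: "a n \<le> b ^ n * C" if "0 < n" for n
    proof -
      \<comment> \<open>The remainder is taken in \<open>{1..m}\<close>, since the index \<open>0\<close> is excluded.\<close>
      define q where "q = (n - 1) div m"
      define r where "r = (n - 1) mod m + 1"
      have n: "n = q * m + r" using that unfolding q_def r_def by simp
      have r: "0 < r" "r \<le> m" using m unfolding r_def by (auto simp: Suc_leI)
      have "a r / b ^ r \<le> (\<Sum>r\<le>m. a r / b ^ r)"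
        using r nonneg b0 by (intro member_le_sum) auto
      then have "a r / b ^ r \<le> C"
        unfolding C_def by simp
      then have "a r \<le> C * b ^ r"
        using b0 by (simp add: divide_le_eq)
      have "a n \<le> a m ^ q * a r" unfolding n using m r by (intro iter)
      also have "\<dots> \<le> (b ^ m) ^ q * (C * b ^ r)"
        using am \<open>a r \<le> C * b ^ r\<close> nonneg b0 C1 by (intro mult_mono power_mono) auto
      also have "\<dots> = b ^ n * C" unfolding n by (simp add: power_add power_mult[symmetric] mult_ac)
      finally show ?thesis .
    qed
    have "(\<lambda>n. b * root n C) \<longlonglongrightarrow> b * 1"
      using C1 by (intro tendsto_intros LIMSEQ_root_const) auto
    then have "eventually (\<lambda>n. b * root n C < c) sequentially"
      using b by (intro order_tendstoD(2)) auto
    then show "eventually (\<lambda>n. root n (a n) < c) sequentially"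
      using eventually_gt_at_top[of 0]
    proof eventually_elim
      case (elim n)
      have "root n (a n) \<le> root n (b ^ n * C)"
        using bound elim by simp
      also have "\<dots> = b * root n C"
        using elim b0 by (simp add: real_root_mult real_root_power_cancel)
      finally show ?case using elim by simp
    qed
  qed
  then show thesis using that L0 pow by blast
qed

section \<open>Square-integrable functions\<close>

lemma borel_measurable_cnj [measurable (raw)]:
  "f \<in> borel_measurable M \<Longrightarrow> (\<lambda>x. cnj (f x)) \<in> borel_measurable M"
  by (rule borel_measurable_continuous_on[OF linear_continuous_on[OF bounded_linear_cnj]])

lemma ennreal_power2_le_imp_le:
  fixes x y :: ennreal
  assumes "x\<^sup>2 \<le> y\<^sup>2"
  shows "x \<le> y"
  using assms
  by (cases x; cases y) (auto simp: ennreal_power top_unique abs_le_square_iff[symmetric])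

lemma L2_iff:
  "f \<in> L2 M \<longleftrightarrow> f \<in> borel_measurable M \<and> (\<integral>\<^sup>+x. ennreal ((cmod (f x))\<^sup>2) \<partial>M) < \<infinity>"
  by (auto simp: L2_def integrable_iff_bounded)

lemma L2_measurable [measurable_dest]: "f \<in> L2 M \<Longrightarrow> f \<in> borel_measurable M"
  by (simp add: L2_def)

lemma l2norm_nonneg [simp]: "0 \<le> l2norm M f"
  by (simp add: l2norm_def)

lemma l2norm_sq:
  assumes "f \<in> L2 M"
  shows "(\<integral>\<^sup>+x. ennreal ((cmod (f x))\<^sup>2) \<partial>M) = ennreal ((l2norm M f)\<^sup>2)"
  using assms by (simp add: L2_def l2norm_def nn_integral_eq_integral)

lemma l2norm_le_iff:
  assumes "f \<in> L2 M" "0 \<le> C"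
  shows "l2norm M f \<le> C \<longleftrightarrow> (\<integral>\<^sup>+x. ennreal ((cmod (f x))\<^sup>2) \<partial>M) \<le> ennreal (C\<^sup>2)"
  using assms by (simp add: l2norm_sq power2_le_iff_abs_le)

lemma L2_dominated:
  assumes "g \<in> L2 M" "f \<in> borel_measurable M" "AE x in M. cmod (f x) \<le> cmod (g x)"
  shows "f \<in> L2 M" "l2norm M f \<le> l2norm M g"
proof -
  have le: "(\<integral>\<^sup>+x. ennreal ((cmod (f x))\<^sup>2) \<partial>M) \<le> (\<integral>\<^sup>+x. ennreal ((cmod (g x))\<^sup>2) \<partial>M)"
    using assms(3) by (intro nn_integral_mono_AE) (auto intro!: ennreal_leI power_mono)
  then show f: "f \<in> L2 M"
    using assms(1,2) by (auto simp: L2_iff)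
  show "l2norm M f \<le> l2norm M g"
    using le unfolding l2norm_sq[OF assms(1)] l2norm_le_iff[OF f l2norm_nonneg[of M g]] .
qed

lemma l2norm_cong_AE:
  assumes "f \<in> borel_measurable M" "g \<in> borel_measurable M" "AE x in M. f x = g x"
  shows "l2norm M f = l2norm M g"
proof -
  have "(\<integral>x. (cmod (f x))\<^sup>2 \<partial>M) = (\<integral>x. (cmod (g x))\<^sup>2 \<partial>M)"
    using assms by (intro integral_cong_AE) auto
  then show ?thesis by (simp add: l2norm_def)
qed

lemma L2_zero [simp]: "(\<lambda>x. 0) \<in> L2 M" "l2norm M (\<lambda>x. 0) = 0"
  by (auto simp: L2_def l2norm_def)

lemma L2_cmult:
  assumes "f \<in> L2 M"
  shows "(\<lambda>x. c * f x) \<in> L2 M" "l2norm M (\<lambda>x. c * f x) = cmod c * l2norm M f"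
  using assms by (auto simp: L2_def l2norm_def norm_mult power_mult_distrib real_sqrt_mult)

lemma L2_of_real_cmod:
  assumes "f \<in> L2 M"
  shows "(\<lambda>x. complex_of_real (cmod (f x))) \<in> L2 M"
    "l2norm M (\<lambda>x. complex_of_real (cmod (f x))) = l2norm M f"
  using assms by (auto simp: L2_def l2norm_def)

lemma l2_nn_Cauchy_Schwarz:
  assumes "f \<in> L2 M" "g \<in> L2 M"
  shows "(\<integral>\<^sup>+x. ennreal (cmod (f x) * cmod (g x)) \<partial>M) \<le> ennreal (l2norm M f * l2norm M g)"
proof -
  note [measurable] = L2_measurable[OF assms(1)] L2_measurable[OF assms(2)]
  have "(\<integral>\<^sup>+x. ennreal (cmod (f x)) * ennreal (cmod (g x)) \<partial>M)\<^sup>2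
      \<le> (\<integral>\<^sup>+x. (ennreal (cmod (f x)))\<^sup>2 \<partial>M) * (\<integral>\<^sup>+x. (ennreal (cmod (g x)))\<^sup>2 \<partial>M)"
    by (rule Cauchy_Schwarz_nn_integral) measurable
  also have "\<dots> = (ennreal (l2norm M f * l2norm M g))\<^sup>2"
    using l2norm_sq[OF assms(1)] l2norm_sq[OF assms(2)]
    by (simp add: ennreal_power ennreal_mult[symmetric] power_mult_distrib)
  finally show ?thesis
    by (simp add: ennreal_mult ennreal_power2_le_imp_le)
qed

lemma L2_mult_integrable:
  assumes "f \<in> L2 M" "g \<in> L2 M"
  shows "integrable M (\<lambda>x. f x * g x)" "integrable M (\<lambda>x. cmod (f x) * cmod (g x))"
    "integrable M (\<lambda>x. f x * cnj (g x))"
proof -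
  note [measurable] = L2_measurable[OF assms(1)] L2_measurable[OF assms(2)]
  have "(\<integral>\<^sup>+x. ennreal (cmod (f x) * cmod (g x)) \<partial>M) < \<infinity>"
    using l2_nn_Cauchy_Schwarz[OF assms] by (rule le_less_trans) simp
  then show "integrable M (\<lambda>x. f x * g x)" "integrable M (\<lambda>x. cmod (f x) * cmod (g x))"
    "integrable M (\<lambda>x. f x * cnj (g x))"
    by (auto simp: integrable_iff_bounded norm_mult abs_mult)
qed

lemma l2_Cauchy_Schwarz_abs:
  assumes "f \<in> L2 M" "g \<in> L2 M"
  shows "(\<integral>x. cmod (f x) * cmod (g x) \<partial>M) \<le> l2norm M f * l2norm M g"
proof -
  have "ennreal (\<integral>x. cmod (f x) * cmod (g x) \<partial>M) \<le> ennreal (l2norm M f * l2norm M g)"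
    using l2_nn_Cauchy_Schwarz[OF assms] L2_mult_integrable(2)[OF assms]
    by (simp add: nn_integral_eq_integral)
  then show ?thesis by simp
qed

lemma l2_Cauchy_Schwarz:
  assumes "f \<in> L2 M" "g \<in> L2 M"
  shows "cmod (l2inner M f g) \<le> l2norm M f * l2norm M g"
proof -
  have "cmod (l2inner M f g) \<le> (\<integral>x. cmod (f x) * cmod (g x) \<partial>M)"
    unfolding l2inner_def
    by (rule order_trans[OF integral_norm_bound]) (simp add: norm_mult)
  also note l2_Cauchy_Schwarz_abs[OF assms]
  finally show ?thesis .
qed

lemma L2_add:
  assumes "f \<in> L2 M" "g \<in> L2 M"
  shows "(\<lambda>x. f x + g x) \<in> L2 M" "l2norm M (\<lambda>x. f x + g x) \<le> l2norm M f + l2norm M g"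
proof -
  note [measurable] = L2_measurable[OF assms(1)] L2_measurable[OF assms(2)]
  have int: "integrable M (\<lambda>x. (cmod (f x))\<^sup>2 + 2 * (cmod (f x) * cmod (g x)) + (cmod (g x))\<^sup>2)"
    using assms L2_mult_integrable(2)[OF assms] by (auto simp: L2_def)
  have le: "(cmod (f x + g x))\<^sup>2
      \<le> (cmod (f x))\<^sup>2 + 2 * (cmod (f x) * cmod (g x)) + (cmod (g x))\<^sup>2" for x
    using power_mono[OF norm_triangle_ineq[of "f x" "g x"], of 2]
    by (simp add: power2_sum algebra_simps)
  then have int': "integrable M (\<lambda>x. (cmod (f x + g x))\<^sup>2)"
    by (intro Bochner_Integration.integrable_bound[OF int]) (auto intro!: AE_I2 order_trans[OF le])
  then show "(\<lambda>x. f x + g x) \<in> L2 M" by (simp add: L2_def)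
  have "(\<integral>x. (cmod (f x + g x))\<^sup>2 \<partial>M)
      \<le> (\<integral>x. (cmod (f x))\<^sup>2 + 2 * (cmod (f x) * cmod (g x)) + (cmod (g x))\<^sup>2 \<partial>M)"
    using le by (intro integral_mono int int')
  also have "\<dots> = (l2norm M f)\<^sup>2 + 2 * (\<integral>x. cmod (f x) * cmod (g x) \<partial>M) + (l2norm M g)\<^sup>2"
    using assms L2_mult_integrable(2)[OF assms] by (simp add: L2_def l2norm_def)
  also have "\<dots> \<le> (l2norm M f)\<^sup>2 + 2 * (l2norm M f * l2norm M g) + (l2norm M g)\<^sup>2"
    using l2_Cauchy_Schwarz_abs[OF assms] by simp
  also have "\<dots> = (l2norm M f + l2norm M g)\<^sup>2" by (simp add: power2_sum algebra_simps)
  finally show "l2norm M (\<lambda>x. f x + g x) \<le> l2norm M f + l2norm M g"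
    unfolding l2norm_def[of M "\<lambda>x. f x + g x"]
    by (rule real_le_lsqrt[rotated]) simp
qed

lemma L2_diff:
  assumes "f \<in> L2 M" "g \<in> L2 M"
  shows "(\<lambda>x. f x - g x) \<in> L2 M" "l2norm M (\<lambda>x. f x - g x) \<le> l2norm M f + l2norm M g"
  using L2_add[OF assms(1) L2_cmult(1)[OF assms(2), of "-1"]] L2_cmult(2)[OF assms(2), of "-1"]
  by simp_all

lemma L2_sum:
  assumes "\<And>i. i \<in> I \<Longrightarrow> f i \<in> L2 M"
  shows "(\<lambda>x. \<Sum>i\<in>I. f i x) \<in> L2 M \<and> l2norm M (\<lambda>x. \<Sum>i\<in>I. f i x) \<le> (\<Sum>i\<in>I. l2norm M (f i))"
  using assms
proof (induction I rule: infinite_finite_induct)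
  case (insert i I)
  then show ?case
    using L2_add[of "f i" M "\<lambda>x. \<Sum>i\<in>I. f i x"] by (auto intro: order_trans)
qed auto

lemma l2norm_diff_triangle:
  assumes "f \<in> L2 M" "g \<in> L2 M" "h \<in> L2 M"
  shows "l2norm M (\<lambda>x. f x - h x) \<le> l2norm M (\<lambda>x. f x - g x) + l2norm M (\<lambda>x. g x - h x)"
  using L2_add(2)[OF L2_diff(1)[OF assms(1,2)] L2_diff(1)[OF assms(2,3)]] by simp

lemma l2norm_eq_0_AE:
  assumes "f \<in> L2 M"
  shows "l2norm M f = 0 \<longleftrightarrow> (AE x in M. f x = 0)"
proof -
  have "integrable M (\<lambda>x. (cmod (f x))\<^sup>2)" using assms by (simp add: L2_def)
  then show ?thesis
    by (simp add: l2norm_def integral_nonneg_eq_0_iff_AE)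
qed

lemma l2inner_cong_AE:
  assumes "f \<in> borel_measurable M" "g \<in> borel_measurable M" "f' \<in> borel_measurable M"
    "g' \<in> borel_measurable M" "AE x in M. f x = f' x" "AE x in M. g x = g' x"
  shows "l2inner M f g = l2inner M f' g'"
  unfolding l2inner_def using assms by (intro integral_cong_AE) auto

lemma SUP_square_ennreal:
  fixes F :: "nat \<Rightarrow> ennreal"
  assumes "incseq F"
  shows "(SUP n. F n)\<^sup>2 = (SUP n. (F n)\<^sup>2)"
proof (rule antisym)
  show "(SUP n. (F n)\<^sup>2) \<le> (SUP n. F n)\<^sup>2"
    by (intro SUP_least power_mono SUP_upper) auto
  have "(SUP n. F n)\<^sup>2 = (SUP n. SUP m. F n * F m)"
    unfolding power2_eq_square SUP_mult_left_ennreal SUP_mult_right_ennreal by (simp add: mult.commute)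
  also have "\<dots> \<le> (SUP n. (F n)\<^sup>2)"
  proof (intro SUP_least)
    fix n m
    have "F n * F m \<le> F (max n m) * F (max n m)"
      using assms by (intro mult_mono) (auto simp: incseq_def)
    also have "\<dots> \<le> (SUP n. (F n)\<^sup>2)"
      unfolding power2_eq_square[symmetric] by (rule SUP_upper) simp
    finally show "F n * F m \<le> (SUP n. (F n)\<^sup>2)" .
  qed
  finally show "(SUP n. F n)\<^sup>2 \<le> (SUP n. (F n)\<^sup>2)" .
qed

text \<open>
  The norm estimate for the partial sums of \<open>\<Sum>|f\<^sub>n|\<close> passes to the limit by monotone convergence.
  This is completeness of \<open>L\<^sup>2\<close> in a form that produces the limit pointwise.
\<close>

lemma L2_series_bound:
  fixes f :: "nat \<Rightarrow> 'a \<Rightarrow> complex"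
  assumes f: "\<And>n. f n \<in> L2 M" and sum: "summable (\<lambda>n. l2norm M (f n))"
  shows "AE x in M. summable (\<lambda>n. cmod (f n x))"
    and "(\<lambda>x. complex_of_real (\<Sum>n. cmod (f n x))) \<in> L2 M"
    and "(\<lambda>x. \<Sum>n. f n x) \<in> L2 M"
    and "l2norm M (\<lambda>x. \<Sum>n. f n x) \<le> (\<Sum>n. l2norm M (f n))"
proof -
  note [measurable] = L2_measurable[OF f]
  define S where "S = (\<Sum>n. l2norm M (f n))"
  have S0: "0 \<le> S" unfolding S_def using sum by (intro suminf_nonneg) auto
  define G where "G N x = (\<Sum>n<N. ennreal (cmod (f n x)))" for N x
  have [measurable]: "G N \<in> borel_measurable M" for N unfolding G_def by measurable
  have G_le: "(\<integral>\<^sup>+x. (G N x)\<^sup>2 \<partial>M) \<le> ennreal (S\<^sup>2)" for N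
  proof -
    have L: "(\<lambda>x. \<Sum>n<N. complex_of_real (cmod (f n x))) \<in> L2 M \<and>
      l2norm M (\<lambda>x. \<Sum>n<N. complex_of_real (cmod (f n x)))
        \<le> (\<Sum>n<N. l2norm M (\<lambda>x. complex_of_real (cmod (f n x))))"
      using L2_of_real_cmod[OF f] by (intro L2_sum) auto
    have "l2norm M (\<lambda>x. \<Sum>n<N. complex_of_real (cmod (f n x))) \<le> (\<Sum>n<N. l2norm M (f n))"
      using L L2_of_real_cmod(2)[OF f] by simp
    also have "\<dots> \<le> S" unfolding S_def using sum by (intro sum_le_suminf) auto
    finally have "(\<integral>\<^sup>+x. ennreal ((cmod (\<Sum>n<N. complex_of_real (cmod (f n x))))\<^sup>2) \<partial>M) \<le> ennreal (S\<^sup>2)"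
      using L l2norm_le_iff[OF _ S0] by blast
    moreover have "(G N x)\<^sup>2 = ennreal ((cmod (\<Sum>n<N. complex_of_real (cmod (f n x))))\<^sup>2)" for x
      unfolding G_def of_real_sum[symmetric] norm_of_real
      by (simp add: sum_nonneg ennreal_power sum_ennreal)
    ultimately show ?thesis by simp
  qed
  define H where "H x = (SUP N. G N x)" for x
  have [measurable]: "H \<in> borel_measurable M" unfolding H_def by measurable
  have G_mono: "incseq (\<lambda>N. G N x)" for x
    unfolding G_def by (intro incseq_SucI) simp
  have H2: "(H x)\<^sup>2 = (SUP N. (G N x)\<^sup>2)" for x
    unfolding H_def by (rule SUP_square_ennreal[OF G_mono])
  have H_le: "(\<integral>\<^sup>+x. (H x)\<^sup>2 \<partial>M) \<le> ennreal (S\<^sup>2)"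
  proof -
    have "(\<integral>\<^sup>+x. (H x)\<^sup>2 \<partial>M) = (SUP N. \<integral>\<^sup>+x. (G N x)\<^sup>2 \<partial>M)"
      unfolding H2
      by (intro nn_integral_monotone_convergence_SUP)
         (use G_mono in \<open>auto simp: incseq_def le_fun_def intro!: power_mono\<close>)
    also have "\<dots> \<le> ennreal (S\<^sup>2)" using G_le by (intro SUP_least)
    finally show ?thesis .
  qed
  have "AE x in M. (H x)\<^sup>2 \<noteq> \<infinity>"
    using H_le by (intro nn_integral_PInf_AE) (auto simp: top_unique)
  then have fin: "AE x in M. H x < \<infinity>"
    by eventually_elim (auto simp: power_eq_top_ennreal_iff less_top)
  have summ: "summable (\<lambda>n. cmod (f n x))" and suminf: "ennreal (\<Sum>n. cmod (f n x)) = H x" if "H x < \<infinity>" for x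
  proof -
    have "(\<Sum>n. ennreal (cmod (f n x))) = H x"
      unfolding H_def G_def by (rule suminf_eq_SUP)
    then show "summable (\<lambda>n. cmod (f n x))"
      using that by (intro summable_suminf_not_top) auto
    then show "ennreal (\<Sum>n. cmod (f n x)) = H x"
      unfolding \<open>(\<Sum>n. ennreal (cmod (f n x))) = H x\<close>[symmetric]
      by (intro suminf_ennreal2[symmetric]) auto
  qed
  show AE_sum: "AE x in M. summable (\<lambda>n. cmod (f n x))"
    using fin by eventually_elim (rule summ)
  have "(\<integral>\<^sup>+x. ennreal ((cmod (complex_of_real (\<Sum>n. cmod (f n x))))\<^sup>2) \<partial>M) = (\<integral>\<^sup>+x. (H x)\<^sup>2 \<partial>M)"
  proof (rule nn_integral_cong_AE, use fin in eventually_elim)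
    case (elim x)
    have "(H x)\<^sup>2 = ennreal ((\<Sum>n. cmod (f n x))\<^sup>2)"
      unfolding suminf[OF elim, symmetric] using summ[OF elim] by (simp add: ennreal_power suminf_nonneg)
    then show ?case by simp
  qed
  also note H_le
  finally have *: "(\<integral>\<^sup>+x. ennreal ((cmod (complex_of_real (\<Sum>n. cmod (f n x))))\<^sup>2) \<partial>M) \<le> ennreal (S\<^sup>2)" .
  show abs: "(\<lambda>x. complex_of_real (\<Sum>n. cmod (f n x))) \<in> L2 M"
    unfolding L2_iff using le_less_trans[OF *] by auto
  have dom: "AE x in M. cmod (\<Sum>n. f n x) \<le> cmod (complex_of_real (\<Sum>n. cmod (f n x)))"
    using AE_sum by eventually_elim (auto intro: order_trans[OF summable_norm] abs_ge_self)
  show "(\<lambda>x. \<Sum>n. f n x) \<in> L2 M"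
    by (rule L2_dominated(1)[OF abs _ dom]) measurable
  have "l2norm M (\<lambda>x. \<Sum>n. f n x) \<le> l2norm M (\<lambda>x. complex_of_real (\<Sum>n. cmod (f n x)))"
    by (rule L2_dominated(2)[OF abs _ dom]) measurable
  also have "\<dots> \<le> S" using * by (simp add: l2norm_le_iff[OF abs S0])
  finally show "l2norm M (\<lambda>x. \<Sum>n. f n x) \<le> (\<Sum>n. l2norm M (f n))" unfolding S_def .
qed

lemma L2_series_tail:
  fixes f :: "nat \<Rightarrow> 'a \<Rightarrow> complex"
  assumes f: "\<And>n. f n \<in> L2 M" and sum: "summable (\<lambda>n. l2norm M (f n))"
  shows "l2norm M (\<lambda>x. (\<Sum>n. f n x) - (\<Sum>n<N. f n x)) \<le> (\<Sum>n. l2norm M (f (n + N)))"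
proof -
  note [measurable] = L2_measurable[OF f]
  have "AE x in M. (\<Sum>n. f n x) - (\<Sum>n<N. f n x) = (\<Sum>n. f (n + N) x)"
    using L2_series_bound(1)[OF assms]
    by eventually_elim (auto intro!: suminf_minus_initial_segment[symmetric] summable_norm_cancel)
  then have "l2norm M (\<lambda>x. (\<Sum>n. f n x) - (\<Sum>n<N. f n x)) = l2norm M (\<lambda>x. \<Sum>n. f (n + N) x)"
    by (intro l2norm_cong_AE) auto
  also have "\<dots> \<le> (\<Sum>n. l2norm M (f (n + N)))"
    using f sum summable_iff_shift[of "\<lambda>n. l2norm M (f n)" N] by (intro L2_series_bound(4)) simp_all
  finally show ?thesis .
qed

lemma L2_series_tendsto:
  fixes f :: "nat \<Rightarrow> 'a \<Rightarrow> complex"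
  assumes f: "\<And>n. f n \<in> L2 M" and sum: "summable (\<lambda>n. l2norm M (f n))"
  shows "(\<lambda>N. l2norm M (\<lambda>x. (\<Sum>n. f n x) - (\<Sum>n<N. f n x))) \<longlonglongrightarrow> 0"
proof (rule tendsto_sandwich[OF _ _ tendsto_const])
  show "(\<lambda>N. \<Sum>n. l2norm M (f (n + N))) \<longlonglongrightarrow> 0"
    using suminf_exist_split2[OF sum] by simp
qed (use L2_series_tail[OF assms] in auto)

lemma nn_integral_unit_normalize:
  assumes [measurable]: "f \<in> borel_measurable M" and "(\<integral>\<^sup>+x. (f x)\<^sup>2 \<partial>M) = ennreal (s\<^sup>2)" "0 < s"
  shows "(\<integral>\<^sup>+x. (ennreal (1 / s) * f x)\<^sup>2 \<partial>M) = 1"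
proof -
  have "(\<integral>\<^sup>+x. (ennreal (1 / s) * f x)\<^sup>2 \<partial>M) = ennreal ((1 / s)\<^sup>2) * (\<integral>\<^sup>+x. (f x)\<^sup>2 \<partial>M)"
    using assms(3) by (simp add: power_mult_distrib nn_integral_cmult ennreal_power)
  also have "\<dots> = 1"
    using assms(3) unfolding assms(2)
    by (simp add: ennreal_mult[symmetric] power_divide)
  finally show ?thesis .
qed

text \<open>
  Test the assumption with normalized truncations of \<open>G\<close> itself, which are square-integrable by
  \<open>\<sigma>\<close>-finiteness, and let the truncation level grow.
\<close>

lemma (in sigma_finite_measure) nn_integral_sq_le_by_duality:
  assumes [measurable]: "G \<in> borel_measurable M" and "0 \<le> C"
    and dual: "\<And>f. f \<in> borel_measurable M \<Longrightarrow> (\<integral>\<^sup>+x. (f x)\<^sup>2 \<partial>M) \<le> 1 \<Longrightarrow> (\<integral>\<^sup>+x. G x * f x \<partial>M) \<le> ennreal C"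
  shows "(\<integral>\<^sup>+x. (G x)\<^sup>2 \<partial>M) \<le> ennreal (C\<^sup>2)"
proof -
  obtain A :: "nat \<Rightarrow> 'a set" where A: "range A \<subseteq> sets M" "(\<Union>i. A i) = space M"
    "\<And>i. emeasure M (A i) \<noteq> \<infinity>" "incseq A"
    using sigma_finite_incseq by metis
  have [measurable]: "A i \<in> sets M" for i using A(1) by auto
  define F where "F n x = min (G x) (of_nat n) * indicator (A n) x" for n x
  have [measurable]: "F n \<in> borel_measurable M" for n unfolding F_def by measurable
  have F_le: "(\<integral>\<^sup>+x. (F n x)\<^sup>2 \<partial>M) \<le> ennreal (C\<^sup>2)" for n
  proof -
    have "(\<integral>\<^sup>+x. (F n x)\<^sup>2 \<partial>M) \<le> (\<integral>\<^sup>+x. (of_nat n)\<^sup>2 * indicator (A n) x \<partial>M)"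
      unfolding F_def by (intro nn_integral_mono) (auto simp: indicator_def power_mono)
    also have "\<dots> = (of_nat n)\<^sup>2 * emeasure M (A n)" by (simp add: nn_integral_cmult)
    also have "\<dots> < \<infinity>"
      using A(3)[of n] by (auto simp: ennreal_mult_less_top less_top of_nat_less_top power_less_top_ennreal)
    finally have fin: "(\<integral>\<^sup>+x. (F n x)\<^sup>2 \<partial>M) < \<infinity>" .
    define s where "s = sqrt (enn2real (\<integral>\<^sup>+x. (F n x)\<^sup>2 \<partial>M))"
    have s: "(\<integral>\<^sup>+x. (F n x)\<^sup>2 \<partial>M) = ennreal (s\<^sup>2)" "0 \<le> s"
      using fin unfolding s_def by simp_all
    show ?thesis
    proof (cases "s = 0")
      case False
      with s have s0: "0 < s" by simp
      have "(\<integral>\<^sup>+x. G x * (ennreal (1 / s) * F n x) \<partial>M) \<le> ennreal C"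
        using nn_integral_unit_normalize[OF _ s(1) s0] by (intro dual) auto
      moreover have "ennreal (1 / s) * (\<integral>\<^sup>+x. (F n x)\<^sup>2 \<partial>M) \<le> (\<integral>\<^sup>+x. G x * (ennreal (1 / s) * F n x) \<partial>M)"
      proof -
        have "ennreal (1 / s) * (F n x)\<^sup>2 \<le> G x * (ennreal (1 / s) * F n x)" for x
        proof -
          have "F n x \<le> G x" unfolding F_def by (auto simp: indicator_def)
          then have "ennreal (1 / s) * F n x * F n x \<le> ennreal (1 / s) * F n x * G x"
            by (intro mult_left_mono) auto
          then show ?thesis by (simp add: power2_eq_square mult_ac)
        qed
        then show ?thesis
          by (subst nn_integral_cmult[symmetric]) (auto intro!: nn_integral_mono)
      qed
      ultimately have "ennreal (1 / s) * ennreal (s\<^sup>2) \<le> ennreal C"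
        unfolding s(1) by (rule order_trans[rotated])
      then have "s \<le> C"
        using s0 assms(2) by (simp add: ennreal_mult[symmetric] power2_eq_square)
      then show ?thesis unfolding s(1) using s0 by (intro ennreal_leI power_mono) auto
    qed (simp add: s)
  qed
  have F_mono: "incseq (\<lambda>n. F n x)" for x
    unfolding F_def incseq_def using A(4)
    by (auto simp: indicator_def incseq_def intro!: mult_mono intro: min.coboundedI2)
  have "(G x)\<^sup>2 = (SUP n. (F n x)\<^sup>2)" if x: "x \<in> space M" for x
  proof -
    obtain i where i: "x \<in> A i" using A(2) x by blast
    have "(SUP n. F n x) = G x"
    proof (rule antisym)
      show "(SUP n. F n x) \<le> G x" unfolding F_def by (intro SUP_least) (auto simp: indicator_def)
      have "min (G x) (of_nat n) \<le> (SUP n. F n x)" for n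
      proof -
        have "x \<in> A (max i n)" using i A(4) max.cobounded1[of i n] unfolding incseq_def by blast
        then have "min (G x) (of_nat n) \<le> F (max i n) x"
          unfolding F_def by (auto simp: min_le_iff_disj)
        also have "\<dots> \<le> (SUP n. F n x)" by (rule SUP_upper) simp
        finally show ?thesis .
      qed
      then have "(SUP n. min (G x) (of_nat n)) \<le> (SUP n. F n x)" by (intro SUP_least)
      moreover have "(SUP n. min (G x) (of_nat n)) = G x"
        using inf_SUP[of "G x" "\<lambda>n. of_nat n :: ennreal" UNIV] by (simp add: inf_min ennreal_SUP_of_nat_eq_top)
      ultimately show "G x \<le> (SUP n. F n x)" by simp
    qed
    then show ?thesis using SUP_square_ennreal[OF F_mono[of x]] by simp
  qed
  then have "(\<integral>\<^sup>+x. (G x)\<^sup>2 \<partial>M) = (\<integral>\<^sup>+x. (SUP n. (F n x)\<^sup>2) \<partial>M)"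
    by (intro nn_integral_cong)
  also have "\<dots> = (SUP n. \<integral>\<^sup>+x. (F n x)\<^sup>2 \<partial>M)"
    by (intro nn_integral_monotone_convergence_SUP)
       (use F_mono in \<open>auto simp: incseq_def le_fun_def intro!: power_mono\<close>)
  also have "\<dots> \<le> ennreal (C\<^sup>2)" using F_le by (intro SUP_least)
  finally show ?thesis .
qed

section \<open>Nonnegativity and uniqueness of kernels\<close>

locale l2_space = sigma_finite_measure M for M :: "'a measure"

sublocale l2_space \<subseteq> product: pair_sigma_finite M M
  by unfold_locales

text \<open>
  The kernel is required to be nonnegative everywhere and not only almost everywhere, which makes it
  real-valued and allows its products with functions to be integrated in the extended half-line.
\<close>

definition nonneg_kernel :: "'a measure \<Rightarrow> ('a \<times> 'a \<Rightarrow> real) \<Rightarrow> 'a l2op \<Rightarrow> bool" where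
  "nonneg_kernel M k T \<longleftrightarrow>
     k \<in> borel_measurable (M \<Otimes>\<^sub>M M) \<and> (\<forall>p. 0 \<le> k p) \<and> is_kernel M (\<lambda>p. complex_of_real (k p)) T"

lemma finite_sections_Un:
  assumes "finite ((\<lambda>x. Pair x -` R) ` X)" "finite ((\<lambda>x. Pair x -` S) ` X)"
  shows "finite ((\<lambda>x. Pair x -` (R \<union> S)) ` X)"
proof (rule finite_subset)
  show "(\<lambda>x. Pair x -` (R \<union> S)) ` X
      \<subseteq> (\<lambda>(A, B). A \<union> B) ` (((\<lambda>x. Pair x -` R) ` X) \<times> ((\<lambda>x. Pair x -` S) ` X))"
    by (force simp: vimage_Un)
qed (use assms in auto)

lemma finite_sections_UN:
  assumes "\<And>i. i < (n::nat) \<Longrightarrow> finite ((\<lambda>x. Pair x -` R i) ` X)"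
  shows "finite ((\<lambda>x. Pair x -` (\<Union>i<n. R i)) ` X)"
  using assms
proof (induction n)
  case 0
  have "(\<lambda>x. Pair x -` (\<Union>i<0::nat. R i)) ` X \<subseteq> {{}}" by auto
  then show ?case by (rule finite_subset) simp
next
  case (Suc n)
  have "(\<Union>i<Suc n. R i) = (\<Union>i<n. R i) \<union> R n" by (auto simp: less_Suc_eq)
  then show ?case using Suc finite_sections_Un[of "\<Union>i<n. R i" X "R n"] by simp
qed

text \<open>
  Sets with finitely many distinct sections form an algebra containing the rectangles, so they are
  dense in the product \<open>\<sigma>\<close>-algebra for every finite measure. Describing this
  algebra by its sections makes stability under complements and unions immediate.
\<close>

lemma approx_by_finite_sections:
  fixes M1 :: "'a measure" and M2 :: "'b measure"
  assumes "finite_measure N" and N: "sets N = sets (M1 \<Otimes>\<^sub>M M2)"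
    and S: "S \<in> sets (M1 \<Otimes>\<^sub>M M2)" and e: "0 < e"
  shows "\<exists>R\<in>sets (M1 \<Otimes>\<^sub>M M2). finite ((\<lambda>x. Pair x -` R) ` space M1) \<and>
    measure N ((S - R) \<union> (R - S)) < e"
proof -
  interpret N: finite_measure N by fact
  define E where "E = {a \<times> b | a b. a \<in> sets M1 \<and> b \<in> sets M2}"
  have E: "Int_stable E" "E \<subseteq> Pow (space M1 \<times> space M2)"
    unfolding E_def by (auto simp: Int_stable_pair_measure_generator pair_measure_closed)
  have sig: "sigma_sets (space M1 \<times> space M2) E = sets (M1 \<Otimes>\<^sub>M M2)"
    unfolding E_def by (rule sets_pair_measure[symmetric])
  have "S \<in> sigma_sets (space M1 \<times> space M2) E" using S sig by simp
  with E have "\<forall>e>0. \<exists>R\<in>sets (M1 \<Otimes>\<^sub>M M2). finite ((\<lambda>x. Pair x -` R) ` space M1) \<and>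
    measure N ((S - R) \<union> (R - S)) < e"
  proof (induction rule: sigma_sets_induct_disjoint)
    case (basic A)
    then obtain a b where ab: "A = a \<times> b" "a \<in> sets M1" "b \<in> sets M2" unfolding E_def by auto
    have "(\<lambda>x. Pair x -` A) ` space M1 \<subseteq> {{}, b}" unfolding ab by auto
    then have "finite ((\<lambda>x. Pair x -` A) ` space M1)" by (rule finite_subset) simp
    then show ?case using ab by (intro allI impI bexI[of _ A]) auto
  next
    case empty
    have "(\<lambda>x. Pair x -` {}) ` space M1 \<subseteq> {{}}" by auto
    then have "finite ((\<lambda>x::'a. Pair x -` ({} :: ('a \<times> 'b) set)) ` space M1)" by (rule finite_subset) simp
    then show ?case by (intro allI impI bexI[of _ "{}"]) auto
  next
    case (compl A)
    show ?case
    proof (intro allI impI)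
      fix e :: real assume "0 < e"
      then obtain R where R: "R \<in> sets (M1 \<Otimes>\<^sub>M M2)" "finite ((\<lambda>x. Pair x -` R) ` space M1)"
        "measure N ((A - R) \<union> (R - A)) < e" using compl by blast
      have sub: "A \<subseteq> space M1 \<times> space M2" "R \<subseteq> space M1 \<times> space M2"
        using sets.sets_into_space[of A "M1 \<Otimes>\<^sub>M M2"] sets.sets_into_space[OF R(1)] compl(1)
        unfolding sig by (simp_all add: space_pair_measure)
      let ?R = "space M1 \<times> space M2 - R"
      have "(\<lambda>x. Pair x -` ?R) ` space M1 \<subseteq> (\<lambda>B. space M2 - B) ` ((\<lambda>x. Pair x -` R) ` space M1)"
        by auto
      then have "finite ((\<lambda>x. Pair x -` ?R) ` space M1)"
        by (rule finite_subset) (use R(2) in auto)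
      moreover have "((space M1 \<times> space M2 - A) - ?R) \<union> (?R - (space M1 \<times> space M2 - A)) = (A - R) \<union> (R - A)"
        using sub by blast
      moreover have "?R \<in> sets (M1 \<Otimes>\<^sub>M M2)"
        using R(1) sets.compl_sets[of R "M1 \<Otimes>\<^sub>M M2"] by (simp add: space_pair_measure)
      ultimately show "\<exists>R\<in>sets (M1 \<Otimes>\<^sub>M M2). finite ((\<lambda>x. Pair x -` R) ` space M1) \<and>
          measure N (((space M1 \<times> space M2 - A) - R) \<union> (R - (space M1 \<times> space M2 - A))) < e"
        using R(3) by (intro bexI[of _ ?R]) auto
    qed
  next
    case (union A)
    have A[measurable]: "A i \<in> sets N" for i using union(2) unfolding sig N by auto
    show ?case
    proof (intro allI impI)
      fix e :: real assume e: "0 < e"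
      let ?U = "\<Union>i. A i"
      have "(\<lambda>n. measure N (\<Union>i<n. A i)) \<longlonglongrightarrow> measure N (\<Union>n. \<Union>i<n. A i)"
        by (intro N.finite_Lim_measure_incseq) (auto simp: incseq_def intro: less_le_trans)
      moreover have "(\<Union>n. \<Union>i<n. A i) = ?U" by auto
      ultimately have "(\<lambda>n. measure N (\<Union>i<n. A i)) \<longlonglongrightarrow> measure N ?U" by simp
      then have "eventually (\<lambda>n. measure N ?U - e / 2 < measure N (\<Union>i<n. A i)) sequentially"
        by (rule order_tendstoD) (use e in simp)
      then obtain n where n: "measure N ?U - e / 2 < measure N (\<Union>i<n. A i)"
        by (auto simp: eventually_sequentially)
      have tail: "measure N (?U - (\<Union>i<n. A i)) < e / 2"
        using n N.finite_measure_Diff[of ?U "\<Union>i<n. A i"] A by (simp add: UN_mono)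
      define d where "d = e / (2 * (real n + 1))"
      have "0 < d" unfolding d_def using e by simp
      then have "\<forall>i. \<exists>R. R \<in> sets (M1 \<Otimes>\<^sub>M M2) \<and> finite ((\<lambda>x. Pair x -` R) ` space M1) \<and>
          measure N ((A i - R) \<union> (R - A i)) < d"
        using union(3) by blast
      from choice[OF this] obtain R where R: "\<And>i. R i \<in> sets (M1 \<Otimes>\<^sub>M M2)"
        "\<And>i. finite ((\<lambda>x. Pair x -` R i) ` space M1)"
        "\<And>i. measure N ((A i - R i) \<union> (R i - A i)) < d"
        by blast
      have R'[measurable]: "R i \<in> sets N" for i using R(1) N by simp
      let ?R = "\<Union>i<n. R i"
      have "measure N (\<Union>i<n. (A i - R i) \<union> (R i - A i)) \<le> (\<Sum>i<n. measure N ((A i - R i) \<union> (R i - A i)))"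
        by (rule N.finite_measure_subadditive_finite) auto
      also have "\<dots> \<le> (\<Sum>i<n. d)" using R(3) by (intro sum_mono less_imp_le)
      also have "\<dots> \<le> e / 2" unfolding d_def using e by (simp add: field_simps)
      finally have main: "measure N (\<Union>i<n. (A i - R i) \<union> (R i - A i)) \<le> e / 2" .
      have "measure N ((?U - ?R) \<union> (?R - ?U))
          \<le> measure N ((?U - (\<Union>i<n. A i)) \<union> (\<Union>i<n. (A i - R i) \<union> (R i - A i)))"
        by (rule N.finite_measure_mono) auto
      also have "\<dots> \<le> measure N (?U - (\<Union>i<n. A i)) + measure N (\<Union>i<n. (A i - R i) \<union> (R i - A i))"
        by (rule measure_Un_le) auto
      also have "\<dots> < e" using tail main by simp
      finally show "\<exists>R\<in>sets (M1 \<Otimes>\<^sub>M M2). finite ((\<lambda>x. Pair x -` R) ` space M1) \<and>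
          measure N ((?U - R) \<union> (R - ?U)) < e"
        using R(1,2) by (intro bexI[of _ ?R] conjI finite_sections_UN) auto
    qed
  qed
  then show ?thesis using e by blast
qed

context l2_space
begin

text \<open>
  A strictly positive square-integrable weight. It makes statements about all of \<open>X\<close> accessible to a
  single element of \<open>L\<^sup>2\<close>.
\<close>

lemma obtain_positive_L2:
  obtains u :: "'a \<Rightarrow> real" where "u \<in> borel_measurable M" "\<And>x. x \<in> space M \<Longrightarrow> 0 < u x" "\<And>x. 0 \<le> u x"
    "(\<lambda>x. complex_of_real (u x)) \<in> L2 M"
proof -
  obtain h where h: "h \<in> borel_measurable M" "integral\<^sup>N M h \<noteq> \<infinity>"
    "\<And>x. x \<in> space M \<Longrightarrow> 0 < h x \<and> h x < \<infinity>"
    using Ex_finite_integrable_function by blast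
  note [measurable] = h(1)
  define u where "u x = sqrt (enn2real (h x))" for x
  have pos: "0 < u x" if "x \<in> space M" for x
    using h(3)[OF that] unfolding u_def by (simp add: enn2real_positive_iff)
  have "(\<integral>\<^sup>+x. ennreal ((cmod (complex_of_real (u x)))\<^sup>2) \<partial>M) = (\<integral>\<^sup>+x. h x \<partial>M)"
    unfolding u_def by (intro nn_integral_cong) (use h(3) in auto)
  then have "(\<lambda>x. complex_of_real (u x)) \<in> L2 M"
    unfolding L2_iff using h(2) by (auto simp: u_def less_top)
  moreover have "u \<in> borel_measurable M" unfolding u_def by measurable
  ultimately show thesis using that pos by (auto simp: u_def)
qed

text \<open>
  The exceptional null set in the hypothesis depends on \<open>B\<close>. A set with finitely many sections involves
  only finitely many \<open>B\<close>, so the integral of \<open>h\<close>, made integrable by weights, is nonnegative over all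
  such sets. Approximating \<open>{h < 0}\<close> by them shows that this set is null.
\<close>

lemma AE_nonneg_if_section_integrals_nonneg:
  fixes h :: "'a \<times> 'a \<Rightarrow> real" and u :: "'a \<Rightarrow> real"
  assumes [measurable]: "h \<in> borel_measurable (M \<Otimes>\<^sub>M M)" "u \<in> borel_measurable M"
    and u: "\<And>x. x \<in> space M \<Longrightarrow> 0 < u x"
    and int: "AE x in M. integrable M (\<lambda>y. h (x, y) * u y)"
    and nonneg: "\<And>B. B \<in> sets M \<Longrightarrow> AE x in M. 0 \<le> (\<integral>y. h (x, y) * (u y * indicator B y) \<partial>M)"
  shows "AE p in M \<Otimes>\<^sub>M M. 0 \<le> h p"
proof -
  obtain h0 where h0[measurable]: "h0 \<in> borel_measurable M" and h0': "integral\<^sup>N M h0 \<noteq> \<infinity>"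
    "\<And>x. x \<in> space M \<Longrightarrow> 0 < h0 x \<and> h0 x < \<infinity>"
    using Ex_finite_integrable_function by blast
  define I where "I x = (\<integral>\<^sup>+y. ennreal \<bar>h (x, y) * u y\<bar> \<partial>M)" for x
  \<comment> \<open>This weight makes \<open>w(x) h(x,y) u(y)\<close> integrable: its integral over \<open>y\<close> is at most \<open>h\<^sub>0(x)\<close>.\<close>
  define w where "w x = enn2real (h0 x) / (1 + enn2real (I x))" for x
  have [measurable]: "I \<in> borel_measurable M" unfolding I_def by measurable
  have [measurable]: "w \<in> borel_measurable M" unfolding w_def by measurable
  have w_pos: "0 < w x" if "x \<in> space M" for x
    using h0'(2)[OF that] unfolding w_def by (simp add: enn2real_positive_iff add_pos_nonneg)
  have w_nonneg: "0 \<le> w x" for x unfolding w_def by simp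
  have I_fin: "AE x in M. I x < \<infinity>"
    using int unfolding I_def by eventually_elim (simp add: integrable_iff_bounded)
  define g where "g p = w (fst p) * (h p * u (snd p))" for p
  have [measurable]: "g \<in> borel_measurable (M \<Otimes>\<^sub>M M)" unfolding g_def by measurable
  have g_int: "integrable (M \<Otimes>\<^sub>M M) g"
    unfolding integrable_iff_bounded
  proof
    have "(\<integral>\<^sup>+p. ennreal (norm (g p)) \<partial>(M \<Otimes>\<^sub>M M)) = (\<integral>\<^sup>+x. \<integral>\<^sup>+y. ennreal (norm (g (x, y))) \<partial>M \<partial>M)"
      by (rule nn_integral_fst[symmetric]) measurable
    also have "\<dots> = (\<integral>\<^sup>+x. ennreal (w x) * I x \<partial>M)"
    proof (rule nn_integral_cong)
      fix x assume x: "x \<in> space M"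
      have "(\<integral>\<^sup>+y. ennreal (norm (g (x, y))) \<partial>M) = (\<integral>\<^sup>+y. ennreal (w x) * ennreal \<bar>h (x, y) * u y\<bar> \<partial>M)"
        unfolding g_def using w_nonneg by (simp add: abs_mult ennreal_mult[symmetric])
      also have "\<dots> = ennreal (w x) * I x"
        unfolding I_def using x by (intro nn_integral_cmult) measurable
      finally show "(\<integral>\<^sup>+y. ennreal (norm (g (x, y))) \<partial>M) = ennreal (w x) * I x" .
    qed
    also have "\<dots> \<le> (\<integral>\<^sup>+x. h0 x \<partial>M)"
    proof (intro nn_integral_mono_AE, use I_fin AE_space in eventually_elim)
      case (elim x)
      then obtain r where r: "I x = ennreal r" "0 \<le> r" by (cases "I x") auto
      obtain s where s: "h0 x = ennreal s" "0 \<le> s" using h0'(2)[OF elim(2)] by (cases "h0 x") auto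
      have "w x * r \<le> s" unfolding w_def r s using r(2) s(2) by (simp add: field_simps)
      then show ?case using r s w_nonneg by (simp add: ennreal_mult[symmetric])
    qed
    also have "\<dots> < \<infinity>" using h0'(1) by (simp add: less_top)
    finally show "(\<integral>\<^sup>+p. ennreal (norm (g p)) \<partial>(M \<Otimes>\<^sub>M M)) < \<infinity>" .
  qed measurable
  define N where "N = density (M \<Otimes>\<^sub>M M) (\<lambda>p. ennreal \<bar>g p\<bar>)"
  have sets_N: "sets N = sets (M \<Otimes>\<^sub>M M)" unfolding N_def by simp
  have emeasure_N: "emeasure N A = ennreal (\<integral>p. indicator A p * \<bar>g p\<bar> \<partial>(M \<Otimes>\<^sub>M M))"
    if [measurable]: "A \<in> sets (M \<Otimes>\<^sub>M M)" for A
  proof -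
    have "emeasure N A = (\<integral>\<^sup>+p. ennreal (indicator A p * \<bar>g p\<bar>) \<partial>(M \<Otimes>\<^sub>M M))"
      unfolding N_def by (subst emeasure_density) (auto intro!: nn_integral_cong simp: indicator_def)
    also have "\<dots> = ennreal (\<integral>p. indicator A p * \<bar>g p\<bar> \<partial>(M \<Otimes>\<^sub>M M))"
      by (intro nn_integral_eq_integral integrable_real_mult_indicator[of A, unfolded mult.commute[of _ "indicator A _"]]
        integrable_abs g_int) (auto simp: mult.commute)
    finally show ?thesis .
  qed
  have finN: "finite_measure N"
    by (rule finite_measureI) (use emeasure_N[of "space (M \<Otimes>\<^sub>M M)"] in \<open>simp add: N_def\<close>)
  interpret N: finite_measure N by fact
  have measure_N: "measure N A = (\<integral>p. indicator A p * \<bar>g p\<bar> \<partial>(M \<Otimes>\<^sub>M M))"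
    if "A \<in> sets (M \<Otimes>\<^sub>M M)" for A
    using emeasure_N[OF that] by (simp add: measure_def)
  have int_ind: "integrable (M \<Otimes>\<^sub>M M) (\<lambda>p. indicator A p * f p)"
    if "A \<in> sets (M \<Otimes>\<^sub>M M)" "integrable (M \<Otimes>\<^sub>M M) f" for A and f :: "'a \<times> 'a \<Rightarrow> real"
    using integrable_real_mult_indicator[OF that] by (simp add: mult.commute)
  define S where "S = {p \<in> space (M \<Otimes>\<^sub>M M). g p < 0}"
  have S[measurable]: "S \<in> sets (M \<Otimes>\<^sub>M M)" unfolding S_def by measurable
  have "measure N S \<le> e" if e: "0 < e" for e
  proof -
    obtain R where R[measurable]: "R \<in> sets (M \<Otimes>\<^sub>M M)" and R_fin: "finite ((\<lambda>x. Pair x -` R) ` space M)"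
      and R_close: "measure N ((S - R) \<union> (R - S)) < e"
      using approx_by_finite_sections[OF finN sets_N S e] by blast
    have "0 \<le> (\<integral>p. indicator R p * g p \<partial>(M \<Otimes>\<^sub>M M))"
    proof -
      have sec: "Pair x -` R \<in> sets M" for x by (rule sets_Pair1) fact
      have "AE x in M. \<forall>B\<in>(\<lambda>x. Pair x -` R) ` space M. 0 \<le> (\<integral>y. h (x, y) * (u y * indicator B y) \<partial>M)"
        using R_fin nonneg sec by (intro AE_finite_allI) auto
      then have "AE x in M. 0 \<le> (\<integral>y. indicator R (x, y) * g (x, y) \<partial>M)"
        using AE_space
      proof eventually_elim
        case (elim x)
        have "(\<integral>y. indicator R (x, y) * g (x, y) \<partial>M) = (\<integral>y. w x * (h (x, y) * (u y * indicator (Pair x -` R) y)) \<partial>M)"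
          unfolding g_def by (intro Bochner_Integration.integral_cong) (auto simp: indicator_def)
        also have "\<dots> = w x * (\<integral>y. h (x, y) * (u y * indicator (Pair x -` R) y) \<partial>M)" by simp
        finally show ?case using elim w_nonneg by auto
      qed
      then have "0 \<le> (\<integral>x. \<integral>y. indicator R (x, y) * g (x, y) \<partial>M \<partial>M)" by (rule integral_nonneg_AE)
      also have "\<dots> = (\<integral>p. indicator R p * g p \<partial>(M \<Otimes>\<^sub>M M))"
        using int_ind[OF R g_int] by (rule product.integral_fst')
      finally show ?thesis .
    qed
    also have "(\<integral>p. indicator R p * g p \<partial>(M \<Otimes>\<^sub>M M))
        \<le> (\<integral>p. indicator ((S - R) \<union> (R - S)) p * \<bar>g p\<bar> - indicator S p * \<bar>g p\<bar> \<partial>(M \<Otimes>\<^sub>M M))"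
      by (intro integral_mono Bochner_Integration.integrable_diff int_ind integrable_abs g_int)
         (auto simp: S_def indicator_def)
    also have "\<dots> = measure N ((S - R) \<union> (R - S)) - measure N S"
      by (subst Bochner_Integration.integral_diff) (auto simp: measure_N intro!: int_ind g_int)
    finally show ?thesis using R_close by simp
  qed
  then have "measure N S \<le> 0" by (rule field_le_epsilon[of _ 0, simplified])
  then have "(\<integral>p. indicator S p * \<bar>g p\<bar> \<partial>(M \<Otimes>\<^sub>M M)) = 0"
    using measure_nonneg[of N S] measure_N[OF S] by linarith
  then have "AE p in M \<Otimes>\<^sub>M M. indicator S p * \<bar>g p\<bar> = 0"
    using int_ind[OF S integrable_abs[OF g_int]] by (subst (asm) integral_nonneg_eq_0_iff_AE) auto
  then show ?thesis
    using AE_space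
  proof eventually_elim
    case (elim p)
    then have "0 \<le> g p" by (auto simp: S_def indicator_def split: if_splits)
    moreover have "0 < w (fst p)" "0 < u (snd p)"
      using elim(2) w_pos u by (auto simp: space_pair_measure)
    ultimately show ?case unfolding g_def by (simp add: zero_le_mult_iff)
  qed
qed

lemma AE_zero_if_section_integrals_zero:
  fixes d :: "'a \<times> 'a \<Rightarrow> real" and u :: "'a \<Rightarrow> real"
  assumes "d \<in> borel_measurable (M \<Otimes>\<^sub>M M)" "u \<in> borel_measurable M"
    and u: "\<And>x. x \<in> space M \<Longrightarrow> 0 < u x"
    and int: "AE x in M. integrable M (\<lambda>y. d (x, y) * u y)"
    and zero: "\<And>B. B \<in> sets M \<Longrightarrow> AE x in M. (\<integral>y. d (x, y) * (u y * indicator B y) \<partial>M) = 0"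
  shows "AE p in M \<Otimes>\<^sub>M M. d p = 0"
proof -
  have "AE p in M \<Otimes>\<^sub>M M. 0 \<le> d p"
    using assms(1,2) u int
  proof (rule AE_nonneg_if_section_integrals_nonneg)
    fix B assume "B \<in> sets M"
    from zero[OF this] show "AE x in M. 0 \<le> (\<integral>y. d (x, y) * (u y * indicator B y) \<partial>M)"
      by eventually_elim simp
  qed
  moreover have "AE p in M \<Otimes>\<^sub>M M. 0 \<le> - d p"
  proof (rule AE_nonneg_if_section_integrals_nonneg[OF _ assms(2) u])
    show "(\<lambda>p. - d p) \<in> borel_measurable (M \<Otimes>\<^sub>M M)" using assms(1) by simp
    show "AE x in M. integrable M (\<lambda>y. - d (x, y) * u y)"
      using int by eventually_elim (simp flip: minus_mult_left)
    fix B assume "B \<in> sets M"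
    from zero[OF this] show "AE x in M. 0 \<le> (\<integral>y. - d (x, y) * (u y * indicator B y) \<partial>M)"
      by eventually_elim (simp flip: minus_mult_left)
  qed
  ultimately show ?thesis by eventually_elim simp
qed

lemma L2_weight_indicator:
  assumes "(\<lambda>x. complex_of_real (u x)) \<in> L2 M" "B \<in> sets M"
  shows "(\<lambda>x. complex_of_real (u x * indicator B x)) \<in> L2 M"
proof (rule L2_dominated(1)[OF assms(1)])
  have "(\<lambda>x. complex_of_real (u x)) \<in> borel_measurable M" using assms(1) by (rule L2_measurable)
  then have [measurable]: "(\<lambda>x. Re (complex_of_real (u x))) \<in> borel_measurable M" by measurable
  have "(\<lambda>x. complex_of_real (Re (complex_of_real (u x)) * indicator B x)) \<in> borel_measurable M"
    using assms(2) by measurable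
  then show "(\<lambda>x. complex_of_real (u x * indicator B x)) \<in> borel_measurable M" by simp
  show "AE x in M. cmod (complex_of_real (u x * indicator B x)) \<le> cmod (complex_of_real (u x))"
    by (auto simp: indicator_def)
qed

lemma is_kernel_cong_AE:
  assumes k: "is_kernel M k T" and [measurable]: "k' \<in> borel_measurable (M \<Otimes>\<^sub>M M)"
    and eq: "AE p in M \<Otimes>\<^sub>M M. k p = k' p"
  shows "is_kernel M k' T"
  unfolding is_kernel_def
proof (intro conjI ballI)
  fix f assume f: "f \<in> L2 M"
  note [measurable] = L2_measurable[OF f]
  have [measurable]: "k \<in> borel_measurable (M \<Otimes>\<^sub>M M)" using k by (simp add: is_kernel_def)
  show "T f \<in> L2 M" using k f by (simp add: is_kernel_def)
  have "AE x in M. integrable M (\<lambda>y. k (x, y) * f y) \<and> T f x = (\<integral>y. k (x, y) * f y \<partial>M)"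
    using k f by (simp add: is_kernel_def)
  moreover have "AE x in M. AE y in M. k (x, y) = k' (x, y)" using eq by (rule product.AE_pair)
  ultimately show "AE x in M. integrable M (\<lambda>y. k' (x, y) * f y) \<and> T f x = (\<integral>y. k' (x, y) * f y \<partial>M)"
    using AE_space
  proof eventually_elim
    case (elim x)
    then have ae: "AE y in M. k (x, y) * f y = k' (x, y) * f y" by auto
    have "integrable M (\<lambda>y. k (x, y) * f y) \<longleftrightarrow> integrable M (\<lambda>y. k' (x, y) * f y)"
      using ae elim(3) by (intro integrable_cong_AE) auto
    moreover have "(\<integral>y. k (x, y) * f y \<partial>M) = (\<integral>y. k' (x, y) * f y \<partial>M)"
      using ae elim(3) by (intro integral_cong_AE) auto
    ultimately show ?case using elim by auto
  qed
qed fact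

lemma is_kernel_weight:
  assumes k: "is_kernel M k T" and u: "(\<lambda>x. complex_of_real (u x)) \<in> L2 M"
  shows "AE x in M. integrable M (\<lambda>y. Re (k (x, y)) * u y)"
    "AE x in M. integrable M (\<lambda>y. Im (k (x, y)) * u y)"
    "B \<in> sets M \<Longrightarrow> AE x in M. (\<integral>y. Re (k (x, y)) * (u y * indicator B y) \<partial>M)
        = Re (T (\<lambda>x. complex_of_real (u x * indicator B x)) x)"
    "B \<in> sets M \<Longrightarrow> AE x in M. (\<integral>y. Im (k (x, y)) * (u y * indicator B y) \<partial>M)
        = Im (T (\<lambda>x. complex_of_real (u x * indicator B x)) x)"
proof -
  have *: "AE x in M. integrable M (\<lambda>y. k (x, y) * complex_of_real (v y)) \<and>
      T (\<lambda>x. complex_of_real (v x)) x = (\<integral>y. k (x, y) * complex_of_real (v y) \<partial>M)"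
    if "(\<lambda>x. complex_of_real (v x)) \<in> L2 M" for v
    using k that by (simp add: is_kernel_def)
  have re: "integrable M (\<lambda>y. Re (k (x, y)) * v y)"
    "(\<integral>y. Re (k (x, y)) * v y \<partial>M) = Re (\<integral>y. k (x, y) * complex_of_real (v y) \<partial>M)"
    "integrable M (\<lambda>y. Im (k (x, y)) * v y)"
    "(\<integral>y. Im (k (x, y)) * v y \<partial>M) = Im (\<integral>y. k (x, y) * complex_of_real (v y) \<partial>M)"
    if "integrable M (\<lambda>y. k (x, y) * complex_of_real (v y))" for x v
    using integrable_Re[OF that] integral_Re[OF that] integrable_Im[OF that] integral_Im[OF that]
    by simp_all
  show "AE x in M. integrable M (\<lambda>y. Re (k (x, y)) * u y)"
    using *[OF u] by eventually_elim (simp add: re)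
  show "AE x in M. integrable M (\<lambda>y. Im (k (x, y)) * u y)"
    using *[OF u] by eventually_elim (simp add: re)
  assume B: "B \<in> sets M"
  note v = *[OF L2_weight_indicator[OF u B]]
  show "AE x in M. (\<integral>y. Re (k (x, y)) * (u y * indicator B y) \<partial>M)
        = Re (T (\<lambda>x. complex_of_real (u x * indicator B x)) x)"
    using v by eventually_elim (simp add: re[where v = "\<lambda>x. u x * indicator B x"] del: of_real_mult)
  show "AE x in M. (\<integral>y. Im (k (x, y)) * (u y * indicator B y) \<partial>M)
        = Im (T (\<lambda>x. complex_of_real (u x * indicator B x)) x)"
    using v by eventually_elim (simp add: re[where v = "\<lambda>x. u x * indicator B x"] del: of_real_mult)
qed

text \<open>
  The real and imaginary parts of the difference of two kernels have vanishing integrals against all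
  functions \<open>u\<cdot>1\<^sub>B\<close>.
\<close>

lemma is_kernel_unique:
  assumes k: "is_kernel M k T" and k': "is_kernel M k' T"
  shows "AE p in M \<Otimes>\<^sub>M M. k p = k' p"
proof -
  obtain u :: "'a \<Rightarrow> real" where u': "u \<in> borel_measurable M" "\<And>x. x \<in> space M \<Longrightarrow> 0 < u x"
    "\<And>x. 0 \<le> u x" "(\<lambda>x. complex_of_real (u x)) \<in> L2 M" using obtain_positive_L2 by blast
  note u = u'(1,2,4)
  have [measurable]: "k \<in> borel_measurable (M \<Otimes>\<^sub>M M)" "k' \<in> borel_measurable (M \<Otimes>\<^sub>M M)"
    using k k' by (auto simp: is_kernel_def)
  note w = is_kernel_weight[OF k u(3)] and w' = is_kernel_weight[OF k' u(3)]
  have int_ind: "integrable M (\<lambda>y. g y * (u y * indicator B y))"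
    if "integrable M (\<lambda>y. g y * u y)" "B \<in> sets M" for g :: "'a \<Rightarrow> real" and B
    using integrable_real_mult_indicator[OF that(2,1)] by (simp add: mult.assoc)
  have "AE p in M \<Otimes>\<^sub>M M. Re (k p) - Re (k' p) = 0"
  proof (rule AE_zero_if_section_integrals_zero[OF _ u(1,2)])
    show "AE x in M. integrable M (\<lambda>y. (Re (k (x, y)) - Re (k' (x, y))) * u y)"
      using w(1) w'(1) by eventually_elim (simp add: left_diff_distrib)
    fix B assume B: "B \<in> sets M"
    show "AE x in M. (\<integral>y. (Re (k (x, y)) - Re (k' (x, y))) * (u y * indicator B y) \<partial>M) = 0"
      using w(1) w'(1) w(3)[OF B] w'(3)[OF B]
      by eventually_elim (simp add: left_diff_distrib int_ind B)
  qed measurable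
  moreover have "AE p in M \<Otimes>\<^sub>M M. Im (k p) - Im (k' p) = 0"
  proof (rule AE_zero_if_section_integrals_zero[OF _ u(1,2)])
    show "AE x in M. integrable M (\<lambda>y. (Im (k (x, y)) - Im (k' (x, y))) * u y)"
      using w(2) w'(2) by eventually_elim (simp add: left_diff_distrib)
    fix B assume B: "B \<in> sets M"
    show "AE x in M. (\<integral>y. (Im (k (x, y)) - Im (k' (x, y))) * (u y * indicator B y) \<partial>M) = 0"
      using w(2) w'(2) w(4)[OF B] w'(4)[OF B]
      by eventually_elim (simp add: left_diff_distrib int_ind B)
  qed measurable
  ultimately show ?thesis by eventually_elim (simp add: complex_eq_iff)
qed

text \<open>
  Positivity of the operator on the functions \<open>u\<cdot>1\<^sub>B\<close> makes the kernel nonnegative almost everywhere;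
  changing it on a null set makes it nonnegative.
\<close>

lemma obtain_nonneg_kernel:
  assumes "positive_kernel_op M T"
  obtains k where "nonneg_kernel M k T"
proof -
  obtain u :: "'a \<Rightarrow> real" where u: "u \<in> borel_measurable M" "\<And>x. x \<in> space M \<Longrightarrow> 0 < u x" "\<And>x. 0 \<le> u x"
    "(\<lambda>x. complex_of_real (u x)) \<in> L2 M" using obtain_positive_L2 by blast
  obtain k where k: "is_kernel M k T" using assms by (auto simp: positive_kernel_op_def)
  have [measurable]: "k \<in> borel_measurable (M \<Otimes>\<^sub>M M)" using k by (auto simp: is_kernel_def)
  have pos: "AE x in M. T (\<lambda>x. complex_of_real (u x * indicator B x)) x \<in> nonneg_Reals" if "B \<in> sets M" for B
  proof -
    have "AE x in M. complex_of_real (u x * indicator B x) \<in> nonneg_Reals"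
      using u(3) by (auto simp: complex_nonneg_Reals_iff)
    then show ?thesis
      by (rule assms[unfolded positive_kernel_op_def, THEN conjunct2, THEN bspec,
            OF L2_weight_indicator[OF u(4) that], THEN mp])
  qed
  note w = is_kernel_weight[OF k u(4)]
  have re: "AE p in M \<Otimes>\<^sub>M M. 0 \<le> Re (k p)"
  proof (rule AE_nonneg_if_section_integrals_nonneg[OF _ u(1,2) w(1)])
    fix B assume B: "B \<in> sets M"
    show "AE x in M. 0 \<le> (\<integral>y. Re (k (x, y)) * (u y * indicator B y) \<partial>M)"
      using w(3)[OF B] pos[OF B] by eventually_elim (simp add: complex_nonneg_Reals_iff)
  qed measurable
  have im: "AE p in M \<Otimes>\<^sub>M M. Im (k p) = 0"
  proof (rule AE_zero_if_section_integrals_zero[OF _ u(1,2) w(2)])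
    fix B assume B: "B \<in> sets M"
    show "AE x in M. (\<integral>y. Im (k (x, y)) * (u y * indicator B y) \<partial>M) = 0"
      using w(4)[OF B] pos[OF B] by eventually_elim (simp add: complex_nonneg_Reals_iff)
  qed measurable
  have "AE p in M \<Otimes>\<^sub>M M. k p = complex_of_real (max 0 (Re (k p)))"
    using re im by eventually_elim (simp add: complex_eq_iff)
  then have "is_kernel M (\<lambda>p. complex_of_real (max 0 (Re (k p)))) T"
    by (intro is_kernel_cong_AE[OF k]) measurable
  then have "nonneg_kernel M (\<lambda>p. max 0 (Re (k p))) T"
    unfolding nonneg_kernel_def by auto
  then show thesis by (rule that)
qed

end

section \<open>The form of a kernel and the operator norm\<close>

text \<open>
  Extended-real-valued arguments avoid all integrability questions.
\<close>

definition kernel_form :: "'a measure \<Rightarrow> ('a \<times> 'a \<Rightarrow> real) \<Rightarrow> ('a \<Rightarrow> ennreal) \<Rightarrow> ('a \<Rightarrow> ennreal) \<Rightarrow> ennreal" where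
  "kernel_form M k f g = (\<integral>\<^sup>+x. g x * (\<integral>\<^sup>+y. ennreal (k (x, y)) * f y \<partial>M) \<partial>M)"

definition nn_unit_ball :: "'a measure \<Rightarrow> ('a \<Rightarrow> ennreal) set" where
  "nn_unit_ball M = {f \<in> borel_measurable M. (\<integral>\<^sup>+x. (f x)\<^sup>2 \<partial>M) \<le> 1}"

text \<open>
  Boundedness of the bilinear form, in place of boundedness of the operator: in this form it is
  visibly monotone and subadditive in the kernel and invariant under transposition.
\<close>

definition kernel_bound :: "'a measure \<Rightarrow> ('a \<times> 'a \<Rightarrow> real) \<Rightarrow> real \<Rightarrow> bool" where
  "kernel_bound M k C \<longleftrightarrow> (\<forall>f\<in>nn_unit_ball M. \<forall>g\<in>nn_unit_ball M. kernel_form M k f g \<le> ennreal C)"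

context l2_space
begin

lemma kernel_form_mono_AE:
  assumes "AE p in M \<Otimes>\<^sub>M M. k p \<le> h p"
  shows "kernel_form M k f g \<le> kernel_form M h f g"
  unfolding kernel_form_def
proof (intro nn_integral_mono_AE, use product.AE_pair[OF assms] in eventually_elim)
  case (elim x)
  then show ?case
    by (intro mult_left_mono nn_integral_mono_AE) (auto intro!: mult_right_mono ennreal_leI)
qed

lemma kernel_form_lincomb:
  assumes [measurable]: "k \<in> borel_measurable (M \<Otimes>\<^sub>M M)" "h \<in> borel_measurable (M \<Otimes>\<^sub>M M)"
    "f \<in> borel_measurable M" "g \<in> borel_measurable M"
    and "\<And>p. 0 \<le> k p" "\<And>p. 0 \<le> h p" "0 \<le> c" "0 \<le> d"
  shows "kernel_form M (\<lambda>p. c * k p + d * h p) f g = ennreal c * kernel_form M k f g + ennreal d * kernel_form M h f g"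
proof -
  have "kernel_form M (\<lambda>p. c * k p + d * h p) f g
      = (\<integral>\<^sup>+x. ennreal c * (g x * (\<integral>\<^sup>+y. ennreal (k (x, y)) * f y \<partial>M))
          + ennreal d * (g x * (\<integral>\<^sup>+y. ennreal (h (x, y)) * f y \<partial>M)) \<partial>M)"
    unfolding kernel_form_def
  proof (rule nn_integral_cong)
    fix x assume x: "x \<in> space M"
    have "(\<integral>\<^sup>+y. ennreal (c * k (x, y) + d * h (x, y)) * f y \<partial>M)
        = (\<integral>\<^sup>+y. ennreal c * (ennreal (k (x, y)) * f y) + ennreal d * (ennreal (h (x, y)) * f y) \<partial>M)"
      using assms by (simp add: ennreal_mult ennreal_plus distrib_right mult.assoc)
    also have "\<dots> = ennreal c * (\<integral>\<^sup>+y. ennreal (k (x, y)) * f y \<partial>M)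
        + ennreal d * (\<integral>\<^sup>+y. ennreal (h (x, y)) * f y \<partial>M)"
      using x by (subst nn_integral_add) (auto simp: nn_integral_cmult)
    finally show "g x * (\<integral>\<^sup>+y. ennreal (c * k (x, y) + d * h (x, y)) * f y \<partial>M)
      = ennreal c * (g x * (\<integral>\<^sup>+y. ennreal (k (x, y)) * f y \<partial>M))
          + ennreal d * (g x * (\<integral>\<^sup>+y. ennreal (h (x, y)) * f y \<partial>M))"
      by (simp add: distrib_left mult_ac)
  qed
  also have "\<dots> = ennreal c * kernel_form M k f g + ennreal d * kernel_form M h f g"
    unfolding kernel_form_def by (subst nn_integral_add) (auto simp: nn_integral_cmult)
  finally show ?thesis .
qed

lemma kernel_form_swap:
  assumes [measurable]: "k \<in> borel_measurable (M \<Otimes>\<^sub>M M)" "f \<in> borel_measurable M" "g \<in> borel_measurable M"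
  shows "kernel_form M (\<lambda>p. k (prod.swap p)) f g = kernel_form M k g f"
proof -
  have "kernel_form M (\<lambda>p. k (prod.swap p)) f g = (\<integral>\<^sup>+x. \<integral>\<^sup>+y. g x * (ennreal (k (y, x)) * f y) \<partial>M \<partial>M)"
    unfolding kernel_form_def by (intro nn_integral_cong) (simp add: nn_integral_cmult)
  also have "\<dots> = (\<integral>\<^sup>+y. \<integral>\<^sup>+x. g x * (ennreal (k (y, x)) * f y) \<partial>M \<partial>M)"
    by (rule product.Fubini'[symmetric]) measurable
  also have "\<dots> = kernel_form M k g f"
    unfolding kernel_form_def
  proof (rule nn_integral_cong)
    fix y assume "y \<in> space M"
    then have "(\<integral>\<^sup>+x. f y * (ennreal (k (y, x)) * g x) \<partial>M) = f y * (\<integral>\<^sup>+x. ennreal (k (y, x)) * g x \<partial>M)"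
      by (simp add: nn_integral_cmult)
    then show "(\<integral>\<^sup>+x. g x * (ennreal (k (y, x)) * f y) \<partial>M) = f y * (\<integral>\<^sup>+x. ennreal (k (y, x)) * g x \<partial>M)"
      by (simp add: mult_ac)
  qed
  finally show ?thesis .
qed

lemma kernel_bound_dominated:
  assumes "kernel_bound M k C" "kernel_bound M h D" "t \<in> borel_measurable (M \<Otimes>\<^sub>M M)"
    "k \<in> borel_measurable (M \<Otimes>\<^sub>M M)" "h \<in> borel_measurable (M \<Otimes>\<^sub>M M)"
    "\<And>p. 0 \<le> k p" "\<And>p. 0 \<le> h p" "0 \<le> c" "0 \<le> d" "0 \<le> C" "0 \<le> D"
    "AE p in M \<Otimes>\<^sub>M M. t p \<le> c * k p + d * h p"
  shows "kernel_bound M t (c * C + d * D)"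
  unfolding kernel_bound_def
proof (intro ballI)
  fix f g assume f: "f \<in> nn_unit_ball M" and g: "g \<in> nn_unit_ball M"
  have "kernel_form M t f g \<le> kernel_form M (\<lambda>p. c * k p + d * h p) f g"
    by (rule kernel_form_mono_AE) fact
  also have "\<dots> = ennreal c * kernel_form M k f g + ennreal d * kernel_form M h f g"
    using f g assms by (intro kernel_form_lincomb) (auto simp: nn_unit_ball_def)
  also have "\<dots> \<le> ennreal c * ennreal C + ennreal d * ennreal D"
    using assms(1,2) f g unfolding kernel_bound_def by (intro add_mono mult_left_mono) auto
  also have "\<dots> = ennreal (c * C + d * D)"
    using assms by (simp add: ennreal_mult ennreal_plus)
  finally show "kernel_form M t f g \<le> ennreal (c * C + d * D)" .
qed

lemma kernel_bound_swap:
  assumes "kernel_bound M k C" "k \<in> borel_measurable (M \<Otimes>\<^sub>M M)"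
  shows "kernel_bound M (\<lambda>p. k (prod.swap p)) C"
  unfolding kernel_bound_def
proof (intro ballI)
  fix f g assume f: "f \<in> nn_unit_ball M" and g: "g \<in> nn_unit_ball M"
  have "kernel_form M (\<lambda>p. k (prod.swap p)) f g = kernel_form M k g f"
    using f g assms(2) by (intro kernel_form_swap) (auto simp: nn_unit_ball_def)
  then show "kernel_form M (\<lambda>p. k (prod.swap p)) f g \<le> ennreal C"
    using assms(1) f g by (simp add: kernel_bound_def)
qed

lemma kernel_bound_imp_sq:
  assumes "kernel_bound M k C" and [measurable]: "k \<in> borel_measurable (M \<Otimes>\<^sub>M M)" and "0 \<le> C"
    and f: "f \<in> L2 M"
  shows "(\<integral>\<^sup>+x. (\<integral>\<^sup>+y. ennreal (k (x, y)) * ennreal (cmod (f y)) \<partial>M)\<^sup>2 \<partial>M) \<le> ennreal ((C * l2norm M f)\<^sup>2)"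
proof (cases "l2norm M f = 0")
  case True
  then have "AE y in M. f y = 0" using l2norm_eq_0_AE[OF f] by simp
  then have "(\<integral>\<^sup>+y. ennreal (k (x, y)) * ennreal (cmod (f y)) \<partial>M) = (\<integral>\<^sup>+y. 0 \<partial>M)" for x
    by (intro nn_integral_cong_AE) auto
  then show ?thesis by simp
next
  case False
  note [measurable] = L2_measurable[OF f]
  define s where "s = l2norm M f"
  have s: "0 < s" using False unfolding s_def by (simp add: less_le)
  let ?f = "\<lambda>y. ennreal (cmod (f y))"
  let ?F = "\<lambda>y. ennreal (1 / s) * ?f y"
  have "(\<integral>\<^sup>+x. (?F x)\<^sup>2 \<partial>M) = 1"
    using l2norm_sq[OF f] s by (intro nn_integral_unit_normalize) (auto simp: s_def ennreal_power)
  then have F: "?F \<in> nn_unit_ball M" by (simp add: nn_unit_ball_def)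
  define G where "G x = (\<integral>\<^sup>+y. ennreal (k (x, y)) * ?F y \<partial>M)" for x
  have [measurable]: "G \<in> borel_measurable M" unfolding G_def by measurable
  have G_le: "(\<integral>\<^sup>+x. (G x)\<^sup>2 \<partial>M) \<le> ennreal (C\<^sup>2)"
  proof (rule nn_integral_sq_le_by_duality)
    fix g assume "g \<in> borel_measurable M" "(\<integral>\<^sup>+x. (g x)\<^sup>2 \<partial>M) \<le> 1"
    then have "kernel_form M k ?F g \<le> ennreal C"
      using assms(1) F unfolding kernel_bound_def by (auto simp: nn_unit_ball_def)
    then show "(\<integral>\<^sup>+x. G x * g x \<partial>M) \<le> ennreal C"
      unfolding kernel_form_def G_def by (simp add: mult.commute)
  qed (use assms in auto)
  have "(\<integral>\<^sup>+y. ennreal (k (x, y)) * ?f y \<partial>M) = ennreal s * G x" if "x \<in> space M" for x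
  proof -
    have "ennreal s * G x = (\<integral>\<^sup>+y. ennreal s * (ennreal (k (x, y)) * ?F y) \<partial>M)"
      unfolding G_def using that by (intro nn_integral_cmult[symmetric]) measurable
    also have "\<dots> = (\<integral>\<^sup>+y. ennreal (k (x, y)) * ?f y \<partial>M)"
    proof (rule nn_integral_cong)
      fix y
      have "ennreal s * (ennreal (k (x, y)) * ?F y) = (ennreal s * ennreal (1 / s)) * (ennreal (k (x, y)) * ?f y)"
        by (simp add: mult_ac)
      also have "ennreal s * ennreal (1 / s) = 1" using s by (simp add: ennreal_mult[symmetric])
      finally show "ennreal s * (ennreal (k (x, y)) * ?F y) = ennreal (k (x, y)) * ?f y" by simp
    qed
    finally show ?thesis ..
  qed
  then have "(\<integral>\<^sup>+x. (\<integral>\<^sup>+y. ennreal (k (x, y)) * ?f y \<partial>M)\<^sup>2 \<partial>M) = (\<integral>\<^sup>+x. (ennreal s)\<^sup>2 * (G x)\<^sup>2 \<partial>M)"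
    by (intro nn_integral_cong) (simp add: power_mult_distrib)
  also have "\<dots> = (ennreal s)\<^sup>2 * (\<integral>\<^sup>+x. (G x)\<^sup>2 \<partial>M)" by (rule nn_integral_cmult) measurable
  finally have eq: "(\<integral>\<^sup>+x. (\<integral>\<^sup>+y. ennreal (k (x, y)) * ?f y \<partial>M)\<^sup>2 \<partial>M)
      = (ennreal s)\<^sup>2 * (\<integral>\<^sup>+x. (G x)\<^sup>2 \<partial>M)" .
  have "ennreal ((C * l2norm M f)\<^sup>2) = (ennreal s)\<^sup>2 * ennreal (C\<^sup>2)"
    using s by (simp add: ennreal_power ennreal_mult[symmetric] power_mult_distrib mult.commute s_def)
  then show ?thesis unfolding eq using G_le by (simp add: mult_left_mono)
qed

lemma nn_integral_kernel_finite_AE: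
  assumes "kernel_bound M k C" "k \<in> borel_measurable (M \<Otimes>\<^sub>M M)" "0 \<le> C" "f \<in> L2 M"
  shows "AE x in M. (\<integral>\<^sup>+y. ennreal (k (x, y)) * ennreal (cmod (f y)) \<partial>M) < \<infinity>"
proof -
  note [measurable] = assms(2) L2_measurable[OF assms(4)]
  have "AE x in M. (\<integral>\<^sup>+y. ennreal (k (x, y)) * ennreal (cmod (f y)) \<partial>M)\<^sup>2 \<noteq> \<infinity>"
    using kernel_bound_imp_sq[OF assms] by (intro nn_integral_PInf_AE) (auto simp: top_unique)
  then show ?thesis by eventually_elim (auto simp: power_eq_top_ennreal_iff less_top)
qed

lemma integrable_kernel_iff:
  assumes [measurable]: "k \<in> borel_measurable (M \<Otimes>\<^sub>M M)" "f \<in> borel_measurable M"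
    and "\<And>p. 0 \<le> k p" "x \<in> space M"
  shows "integrable M (\<lambda>y. complex_of_real (k (x, y)) * f y)
    \<longleftrightarrow> (\<integral>\<^sup>+y. ennreal (k (x, y)) * ennreal (cmod (f y)) \<partial>M) < \<infinity>"
  using assms by (simp add: integrable_iff_bounded norm_mult ennreal_mult)

text \<open>
  A kernel with a bounded form defines an operator on \<open>L\<^sup>2\<close>. This is how all operators built from given
  ones (transposes, Hadamard means, restrictions to strips) are recognized as kernel operators.
\<close>

lemma nonneg_kernelI:
  assumes "kernel_bound M k C" and [measurable]: "k \<in> borel_measurable (M \<Otimes>\<^sub>M M)" and "\<And>p. 0 \<le> k p" "0 \<le> C"
    and T: "\<And>f. f \<in> L2 M \<Longrightarrow> T f \<in> borel_measurable M"
      "\<And>f. f \<in> L2 M \<Longrightarrow> AE x in M. T f x = (\<integral>y. complex_of_real (k (x, y)) * f y \<partial>M)"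
  shows "nonneg_kernel M k T" "\<And>f. f \<in> L2 M \<Longrightarrow> l2norm M (T f) \<le> C * l2norm M f"
proof -
  have *: "T f \<in> L2 M \<and> l2norm M (T f) \<le> C * l2norm M f \<and>
      (AE x in M. integrable M (\<lambda>y. complex_of_real (k (x, y)) * f y))" if f: "f \<in> L2 M" for f
  proof -
    note [measurable] = L2_measurable[OF f]
    let ?G = "\<lambda>x. \<integral>\<^sup>+y. ennreal (k (x, y)) * ennreal (cmod (f y)) \<partial>M"
    have fin: "AE x in M. ?G x < \<infinity>" using assms f by (intro nn_integral_kernel_finite_AE) auto
    have int: "AE x in M. integrable M (\<lambda>y. complex_of_real (k (x, y)) * f y)"
      using fin AE_space by eventually_elim (subst integrable_kernel_iff; use assms in auto)
    have le: "AE x in M. ennreal ((cmod (T f x))\<^sup>2) \<le> (?G x)\<^sup>2"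
      using T(2)[OF f] int
    proof eventually_elim
      case (elim x)
      have "ennreal (cmod (T f x)) \<le> (\<integral>\<^sup>+y. ennreal (cmod (complex_of_real (k (x, y)) * f y)) \<partial>M)"
        unfolding elim(1) by (rule integral_norm_bound_ennreal[OF elim(2)])
      also have "\<dots> = ?G x" using assms by (simp add: norm_mult ennreal_mult)
      finally have "(ennreal (cmod (T f x)))\<^sup>2 \<le> (?G x)\<^sup>2" by (intro power_mono) auto
      then show ?case by (simp add: ennreal_power)
    qed
    have "(\<integral>\<^sup>+x. ennreal ((cmod (T f x))\<^sup>2) \<partial>M) \<le> (\<integral>\<^sup>+x. (?G x)\<^sup>2 \<partial>M)"
      by (rule nn_integral_mono_AE[OF le])
    also have "\<dots> \<le> ennreal ((C * l2norm M f)\<^sup>2)" using assms f by (intro kernel_bound_imp_sq) auto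
    finally have b: "(\<integral>\<^sup>+x. ennreal ((cmod (T f x))\<^sup>2) \<partial>M) \<le> ennreal ((C * l2norm M f)\<^sup>2)" .
    then have "T f \<in> L2 M" using T(1)[OF f] le_less_trans[OF b] by (simp add: L2_iff)
    then show ?thesis using b int assms(4) by (simp add: l2norm_le_iff)
  qed
  show "nonneg_kernel M k T"
    unfolding nonneg_kernel_def is_kernel_def
  proof (intro conjI ballI)
    fix f assume f: "f \<in> L2 M"
    show "AE x in M. integrable M (\<lambda>y. complex_of_real (k (x, y)) * f y) \<and>
        T f x = (\<integral>y. complex_of_real (k (x, y)) * f y \<partial>M)"
      using T(2)[OF f] * f by auto
  qed (use assms * in auto)
  show "\<And>f. f \<in> L2 M \<Longrightarrow> l2norm M (T f) \<le> C * l2norm M f" using * by blast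
qed

lemma nonneg_kernelD:
  assumes "nonneg_kernel M k T"
  shows "k \<in> borel_measurable (M \<Otimes>\<^sub>M M)" "0 \<le> k p" "f \<in> L2 M \<Longrightarrow> T f \<in> L2 M"
    "f \<in> L2 M \<Longrightarrow> AE x in M. integrable M (\<lambda>y. complex_of_real (k (x, y)) * f y)"
    "f \<in> L2 M \<Longrightarrow> AE x in M. T f x = (\<integral>y. complex_of_real (k (x, y)) * f y \<partial>M)"
proof -
  show "AE x in M. integrable M (\<lambda>y. complex_of_real (k (x, y)) * f y)"
    "AE x in M. T f x = (\<integral>y. complex_of_real (k (x, y)) * f y \<partial>M)" if "f \<in> L2 M"
    using assms that unfolding nonneg_kernel_def is_kernel_def by auto
  show "0 \<le> k p" using assms unfolding nonneg_kernel_def by blast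
qed (use assms in \<open>auto simp: nonneg_kernel_def is_kernel_def\<close>)

text \<open>
  On \<open>|f|\<close> the operator is given by a nonnegative integral, which dominates \<open>|T f|\<close>.
\<close>

lemma nonneg_kernel_abs:
  assumes k: "nonneg_kernel M k T" and f: "f \<in> L2 M"
  shows "AE x in M. ennreal (cmod (T (\<lambda>y. complex_of_real (cmod (f y))) x))
      = (\<integral>\<^sup>+y. ennreal (k (x, y)) * ennreal (cmod (f y)) \<partial>M)"
    "AE x in M. T (\<lambda>y. complex_of_real (cmod (f y))) x
      = complex_of_real (cmod (T (\<lambda>y. complex_of_real (cmod (f y))) x))"
    "AE x in M. ennreal (cmod (T f x)) \<le> (\<integral>\<^sup>+y. ennreal (k (x, y)) * ennreal (cmod (f y)) \<partial>M)"
proof -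
  note kD = nonneg_kernelD[OF k]
  have *: "ennreal (cmod (T (\<lambda>y. complex_of_real (cmod (f y))) x))
      = (\<integral>\<^sup>+y. ennreal (k (x, y)) * ennreal (cmod (f y)) \<partial>M) \<and>
    T (\<lambda>y. complex_of_real (cmod (f y))) x
      = complex_of_real (cmod (T (\<lambda>y. complex_of_real (cmod (f y))) x))"
    if int: "integrable M (\<lambda>y. complex_of_real (k (x, y)) * complex_of_real (cmod (f y)))"
      and eq: "T (\<lambda>y. complex_of_real (cmod (f y))) x
        = (\<integral>y. complex_of_real (k (x, y)) * complex_of_real (cmod (f y)) \<partial>M)" for x
  proof -
    have int': "integrable M (\<lambda>y. k (x, y) * cmod (f y))"
      using integrable_Re[OF int] by simp
    have eq': "T (\<lambda>y. complex_of_real (cmod (f y))) x = complex_of_real (\<integral>y. k (x, y) * cmod (f y) \<partial>M)"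
      unfolding eq integral_complex_of_real[symmetric] by simp
    have nn: "0 \<le> (\<integral>y. k (x, y) * cmod (f y) \<partial>M)" by (intro Bochner_Integration.integral_nonneg mult_nonneg_nonneg kD(2)) auto
    have "ennreal (\<integral>y. k (x, y) * cmod (f y) \<partial>M) = (\<integral>\<^sup>+y. ennreal (k (x, y) * cmod (f y)) \<partial>M)"
      using int' kD(2) by (intro nn_integral_eq_integral[symmetric]) auto
    also have "\<dots> = (\<integral>\<^sup>+y. ennreal (k (x, y)) * ennreal (cmod (f y)) \<partial>M)"
      using kD(2) by (simp add: ennreal_mult)
    finally show ?thesis using nn unfolding eq' by simp
  qed
  note af = kD(4,5)[OF L2_of_real_cmod(1)[OF f]]
  show "AE x in M. ennreal (cmod (T (\<lambda>y. complex_of_real (cmod (f y))) x))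
      = (\<integral>\<^sup>+y. ennreal (k (x, y)) * ennreal (cmod (f y)) \<partial>M)"
    using af by eventually_elim (use * in blast)
  show "AE x in M. T (\<lambda>y. complex_of_real (cmod (f y))) x
      = complex_of_real (cmod (T (\<lambda>y. complex_of_real (cmod (f y))) x))"
    using af by eventually_elim (use * in blast)
  show "AE x in M. ennreal (cmod (T f x)) \<le> (\<integral>\<^sup>+y. ennreal (k (x, y)) * ennreal (cmod (f y)) \<partial>M)"
    using kD(4,5)[OF f]
  proof eventually_elim
    case (elim x)
    have "ennreal (cmod (T f x)) \<le> (\<integral>\<^sup>+y. ennreal (cmod (complex_of_real (k (x, y)) * f y)) \<partial>M)"
      unfolding elim(2) by (rule integral_norm_bound_ennreal[OF elim(1)])
    also have "\<dots> = (\<integral>\<^sup>+y. ennreal (k (x, y)) * ennreal (cmod (f y)) \<partial>M)"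
      using kD(2) by (simp add: norm_mult ennreal_mult)
    finally show ?case .
  qed
qed

lemma nonneg_kernel_mono_AE:
  assumes k: "nonneg_kernel M k T" and f: "f \<in> L2 M" and g: "g \<in> L2 M"
    and le: "AE x in M. cmod (f x) \<le> cmod (g x)"
  shows "AE x in M. cmod (T f x) \<le> cmod (T (\<lambda>y. complex_of_real (cmod (g y))) x)"
  using nonneg_kernel_abs(3)[OF k f] nonneg_kernel_abs(1)[OF k g]
proof eventually_elim
  case (elim x)
  have "(\<integral>\<^sup>+y. ennreal (k (x, y)) * ennreal (cmod (f y)) \<partial>M)
      \<le> (\<integral>\<^sup>+y. ennreal (k (x, y)) * ennreal (cmod (g y)) \<partial>M)"
    using le by (intro nn_integral_mono_AE) (auto intro!: mult_left_mono ennreal_leI)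
  then have "ennreal (cmod (T f x)) \<le> ennreal (cmod (T (\<lambda>y. complex_of_real (cmod (g y))) x))"
    using elim by simp
  then show ?case by simp
qed

lemma nonneg_kernel_cmult:
  assumes k: "nonneg_kernel M k T" and f: "f \<in> L2 M"
  shows "AE x in M. T (\<lambda>x. c * f x) x = c * T f x"
proof -
  note kD = nonneg_kernelD[OF k]
  show ?thesis
    using kD(5)[OF f] kD(5)[OF L2_cmult(1)[OF f, of c]]
  proof eventually_elim
    case (elim x)
    have "(\<integral>y. complex_of_real (k (x, y)) * (c * f y) \<partial>M) = (\<integral>y. c * (complex_of_real (k (x, y)) * f y) \<partial>M)"
      by (simp add: mult_ac)
    also have "\<dots> = c * (\<integral>y. complex_of_real (k (x, y)) * f y \<partial>M)" by (rule integral_mult_right_zero)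
    finally show ?case using elim by simp
  qed
qed

text \<open>
  Automatic boundedness of positive operators: if \<open>\<parallel>T f\<^sub>n\<parallel> > 4\<^sup>n \<parallel>f\<^sub>n\<parallel>\<close>, then \<open>T\<close> applied to the element
  \<open>\<Sum> 2\<^sup>-\<^sup>n |f\<^sub>n| / \<parallel>f\<^sub>n\<parallel>\<close> of \<open>L\<^sup>2\<close> would dominate functions of norm greater than \<open>2\<^sup>n\<close> for every \<open>n\<close>.
\<close>

lemma nonneg_kernel_bounded:
  assumes k: "nonneg_kernel M k T"
  shows "\<exists>C\<ge>0. \<forall>f\<in>L2 M. l2norm M (T f) \<le> C * l2norm M f"
proof (rule ccontr)
  assume "\<not> ?thesis"
  then have "\<exists>f\<in>L2 M. C * l2norm M f < l2norm M (T f)" if "0 \<le> C" for C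
    using that by (meson not_le)
  then have "\<forall>n::nat. \<exists>f\<in>L2 M. 4 ^ n * l2norm M f < l2norm M (T f)" by simp
  then obtain f where f: "\<And>n. f n \<in> L2 M" "\<And>n::nat. 4 ^ n * l2norm M (f n) < l2norm M (T (f n))" by metis
  note kD = nonneg_kernelD[OF k]
  have pos: "0 < l2norm M (f n)" for n
  proof (rule ccontr)
    assume "\<not> ?thesis"
    then have "l2norm M (f n) = 0" using l2norm_nonneg[of M "f n"] by linarith
    then have z: "AE y in M. f n y = 0" using l2norm_eq_0_AE[OF f(1)] by simp
    have "AE x in M. T (f n) x = 0"
      using kD(5)[OF f(1)[of n]]
    proof eventually_elim
      case (elim x)
      have "(\<integral>y. complex_of_real (k (x, y)) * f n y \<partial>M) = 0"
        using z by (intro integral_eq_zero_AE) auto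
      then show ?case using elim by simp
    qed
    then have "l2norm M (T (f n)) = 0" using l2norm_eq_0_AE[OF kD(3)[OF f(1)]] by simp
    then show False using f(2)[of n] \<open>l2norm M (f n) = 0\<close> by simp
  qed
  define g where "g n x = complex_of_real ((1 / 2) ^ n / l2norm M (f n)) * f n x" for n x
  have g: "g n \<in> L2 M" "l2norm M (g n) = (1 / 2) ^ n" for n
    using L2_cmult[OF f(1)[of n], of "complex_of_real ((1 / 2) ^ n / l2norm M (f n))"] pos[of n]
    unfolding g_def by (simp_all add: norm_divide norm_power)
  have summ: "summable (\<lambda>n. l2norm M (g n))" unfolding g(2) by (simp add: summable_geometric)
  define s where "s x = complex_of_real (\<Sum>n. cmod (g n x))" for x
  have s: "s \<in> L2 M" unfolding s_def by (rule L2_series_bound(2)[OF g(1) summ])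
  have g_le: "AE x in M. cmod (g n x) \<le> cmod (s x)" for n
    using L2_series_bound(1)[OF g(1) summ]
  proof eventually_elim
    case (elim x)
    have "cmod (g n x) \<le> (\<Sum>n. cmod (g n x))"
      using sum_le_suminf[OF elim, of "{n}"] by simp
    also have "\<dots> \<le> cmod (s x)" unfolding s_def norm_of_real by simp
    finally show ?case .
  qed
  define D where "D = l2norm M (T (\<lambda>y. complex_of_real (cmod (s y))))"
  have "2 ^ n < D" for n :: nat
  proof -
    have "AE x in M. T (g n) x = complex_of_real ((1 / 2) ^ n / l2norm M (f n)) * T (f n) x"
      unfolding g_def by (rule nonneg_kernel_cmult[OF k f(1)])
    then have "l2norm M (T (g n)) = l2norm M (\<lambda>x. complex_of_real ((1 / 2) ^ n / l2norm M (f n)) * T (f n) x)"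
      using kD(3)[OF g(1)] kD(3)[OF f(1)] by (intro l2norm_cong_AE) (auto dest: L2_measurable)
    also have "\<dots> = (1 / 2) ^ n / l2norm M (f n) * l2norm M (T (f n))"
      unfolding L2_cmult(2)[OF kD(3)[OF f(1)]] norm_of_real using pos[of n] by simp
    also have "\<dots> > (1 / 2) ^ n / l2norm M (f n) * (4 ^ n * l2norm M (f n))"
      using f(2)[of n] pos[of n] by (intro mult_strict_left_mono) auto
    also have "(1 / 2) ^ n / l2norm M (f n) * (4 ^ n * l2norm M (f n)) = ((1 / 2) * 4) ^ n"
      using pos[of n] unfolding power_mult_distrib by simp
    also have "((1 / 2) * 4) ^ n = (2::real) ^ n" by simp
    also have "l2norm M (T (g n)) \<le> D"
      unfolding D_def
      by (rule L2_dominated(2)[OF kD(3)[OF L2_of_real_cmod(1)[OF s]] L2_measurable[OF kD(3)[OF g(1)]]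
            nonneg_kernel_mono_AE[OF k g(1) s g_le]])
    finally show ?thesis .
  qed
  then show False using real_arch_pow[of 2 D] by (metis less_asym one_less_numeral_iff semiring_norm(76))
qed

lemma l2_bounded_op_nonneg_kernel:
  assumes k: "nonneg_kernel M k T"
  shows "l2_bounded_op M T"
  unfolding l2_bounded_op_def
proof (intro conjI ballI allI impI)
  note kD = nonneg_kernelD[OF k]
  fix f assume f: "f \<in> L2 M"
  show "T f \<in> L2 M" by (rule kD(3)[OF f])
  show "AE x in M. T (\<lambda>x. c * f x) x = c * T f x" for c by (rule nonneg_kernel_cmult[OF k f])
  fix g assume g: "g \<in> L2 M"
  show "AE x in M. T (\<lambda>x. f x + g x) x = T f x + T g x"
    using kD(5)[OF f] kD(5)[OF g] kD(5)[OF L2_add(1)[OF f g]] kD(4)[OF f] kD(4)[OF g]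
    by eventually_elim (simp add: distrib_left)
  show "AE x in M. T f x = T g x" if eq: "AE x in M. f x = g x"
    using kD(5)[OF f] kD(5)[OF g] AE_space
  proof eventually_elim
    case (elim x)
    note [measurable] = kD(1) L2_measurable[OF f] L2_measurable[OF g]
    have "(\<integral>y. complex_of_real (k (x, y)) * f y \<partial>M) = (\<integral>y. complex_of_real (k (x, y)) * g y \<partial>M)"
      using eq elim(3) by (intro integral_cong_AE) auto
    then show ?case using elim by simp
  qed
next
  show "\<exists>C. \<forall>f\<in>L2 M. l2norm M (T f) \<le> C * l2norm M f"
    using nonneg_kernel_bounded[OF k] by blast
qed

end

lemma l2_bounded_opD:
  assumes "l2_bounded_op M T"
  shows "f \<in> L2 M \<Longrightarrow> T f \<in> L2 M"
    "f \<in> L2 M \<Longrightarrow> g \<in> L2 M \<Longrightarrow> AE x in M. f x = g x \<Longrightarrow> AE x in M. T f x = T g x"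
    "f \<in> L2 M \<Longrightarrow> g \<in> L2 M \<Longrightarrow> AE x in M. T (\<lambda>x. f x + g x) x = T f x + T g x"
    "f \<in> L2 M \<Longrightarrow> AE x in M. T (\<lambda>x. c * f x) x = c * T f x"
    "\<exists>C. \<forall>f\<in>L2 M. l2norm M (T f) \<le> C * l2norm M f"
  using assms unfolding l2_bounded_op_def by blast+

lemma l2_opnorm_le:
  assumes "\<And>f. f \<in> L2 M \<Longrightarrow> l2norm M f \<le> 1 \<Longrightarrow> l2norm M (T f) \<le> C"
  shows "l2_opnorm M T \<le> C"
  unfolding l2_opnorm_def using assms by (intro cSUP_least) (auto intro!: exI[of _ "\<lambda>x. 0"])

lemma l2_opnorm_bdd_above:
  assumes "l2_bounded_op M T"
  shows "bdd_above ((\<lambda>f. l2norm M (T f)) ` {f \<in> L2 M. l2norm M f \<le> 1})"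
proof -
  obtain C where C: "\<And>f. f \<in> L2 M \<Longrightarrow> l2norm M (T f) \<le> C * l2norm M f"
    using l2_bounded_opD(5)[OF assms] by blast
  have "l2norm M (T f) \<le> \<bar>C\<bar>" if "f \<in> L2 M" "l2norm M f \<le> 1" for f
  proof -
    have "C * l2norm M f \<le> \<bar>C\<bar> * 1" using that by (intro mult_mono) auto
    then show ?thesis using C[OF that(1)] by simp
  qed
  then show ?thesis by (intro bdd_aboveI[of _ "\<bar>C\<bar>"]) auto
qed

lemma l2norm_le_opnorm_unit:
  assumes "l2_bounded_op M T" "f \<in> L2 M" "l2norm M f \<le> 1"
  shows "l2norm M (T f) \<le> l2_opnorm M T"
  unfolding l2_opnorm_def using assms by (intro cSUP_upper l2_opnorm_bdd_above) auto

lemma l2_opnorm_nonneg: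
  assumes "l2_bounded_op M T"
  shows "0 \<le> l2_opnorm M T"
  by (rule order_trans[OF l2norm_nonneg l2norm_le_opnorm_unit[OF assms L2_zero(1)]]) simp

lemma l2_bounded_op_scaled:
  assumes T: "l2_bounded_op M T" and f: "f \<in> L2 M"
  shows "l2norm M (T (\<lambda>x. c * f x)) = cmod c * l2norm M (T f)"
proof -
  note TD = l2_bounded_opD[OF T]
  have "l2norm M (T (\<lambda>x. c * f x)) = l2norm M (\<lambda>x. c * T f x)"
    using TD(1)[OF f] TD(1)[OF L2_cmult(1)[OF f]] by (intro l2norm_cong_AE TD(4)[OF f]) (auto dest: L2_measurable)
  then show ?thesis using L2_cmult(2)[OF TD(1)[OF f]] by simp
qed

lemma l2norm_le_opnorm:
  assumes T: "l2_bounded_op M T" and f: "f \<in> L2 M"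
  shows "l2norm M (T f) \<le> l2_opnorm M T * l2norm M f"
proof (cases "l2norm M f = 0")
  case True
  obtain C where "l2norm M (T f) \<le> C * l2norm M f" using l2_bounded_opD(5)[OF T] f by blast
  then show ?thesis using True by simp
next
  case False
  then have s: "0 < l2norm M f" by (simp add: less_le)
  let ?c = "complex_of_real (1 / l2norm M f)"
  have "l2norm M (T (\<lambda>x. ?c * f x)) \<le> l2_opnorm M T"
    using L2_cmult[OF f, of ?c] s by (intro l2norm_le_opnorm_unit[OF T]) (auto simp: norm_divide)
  then have "(1 / l2norm M f) * l2norm M (T f) \<le> l2_opnorm M T"
    unfolding l2_bounded_op_scaled[OF T f] using s by (simp add: norm_divide)
  then show ?thesis using s by (simp add: field_simps)
qed

context l2_space
begin

lemma opnorm_le_if_kernel_bound: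
  assumes k: "nonneg_kernel M k T" and "kernel_bound M k C" "0 \<le> C"
  shows "l2_opnorm M T \<le> C"
proof (rule l2_opnorm_le)
  note kD = nonneg_kernelD[OF k]
  fix f assume f: "f \<in> L2 M" "l2norm M f \<le> 1"
  have "l2norm M (T f) \<le> C * l2norm M f"
    using kD assms(2,3) f(1) by (intro nonneg_kernelI(2)[of k C T]) (auto dest: L2_measurable)
  also have "\<dots> \<le> C * 1" using f(2) assms(3) by (intro mult_left_mono) auto
  finally show "l2norm M (T f) \<le> C" by simp
qed

text \<open>
  Passage from the extended half-line back to elements of \<open>L\<^sup>2\<close>.
\<close>

lemma nn_unit_ball_repr:
  assumes "f \<in> nn_unit_ball M"
  shows "(\<lambda>x. complex_of_real (enn2real (f x))) \<in> L2 M"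
    "l2norm M (\<lambda>x. complex_of_real (enn2real (f x))) \<le> 1"
    "AE x in M. ennreal (cmod (complex_of_real (enn2real (f x)))) = f x"
proof -
  have [measurable]: "f \<in> borel_measurable M" and le: "(\<integral>\<^sup>+x. (f x)\<^sup>2 \<partial>M) \<le> 1"
    using assms by (auto simp: nn_unit_ball_def)
  have "AE x in M. (f x)\<^sup>2 \<noteq> \<infinity>"
    using le by (intro nn_integral_PInf_AE) (auto simp: top_unique)
  then show ae: "AE x in M. ennreal (cmod (complex_of_real (enn2real (f x)))) = f x"
    by eventually_elim (auto simp: power_eq_top_ennreal_iff less_top)
  have "(\<integral>\<^sup>+x. ennreal ((cmod (complex_of_real (enn2real (f x))))\<^sup>2) \<partial>M) = (\<integral>\<^sup>+x. (f x)\<^sup>2 \<partial>M)"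
    by (intro nn_integral_cong_AE, use ae in eventually_elim) (metis ennreal_power norm_ge_zero)
  then have *: "(\<integral>\<^sup>+x. ennreal ((cmod (complex_of_real (enn2real (f x))))\<^sup>2) \<partial>M) \<le> ennreal (1\<^sup>2)"
    using le by simp
  then show "(\<lambda>x. complex_of_real (enn2real (f x))) \<in> L2 M"
    unfolding L2_iff using le_less_trans[OF *] by auto
  then show "l2norm M (\<lambda>x. complex_of_real (enn2real (f x))) \<le> 1"
    using * by (subst l2norm_le_iff) auto
qed

lemma kernel_form_eq_abs:
  assumes k: "nonneg_kernel M k T" and f: "f \<in> L2 M"
    and f': "AE x in M. ennreal (cmod (f x)) = f' x" and g': "AE x in M. ennreal (cmod (g x)) = g' x"
  shows "kernel_form M k f' g' = (\<integral>\<^sup>+x. ennreal (cmod (g x) * cmod (T (\<lambda>y. complex_of_real (cmod (f y))) x)) \<partial>M)"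
  unfolding kernel_form_def
proof (intro nn_integral_cong_AE, use nonneg_kernel_abs(1)[OF k f] g' in eventually_elim)
  case (elim x)
  have "(\<integral>\<^sup>+y. ennreal (k (x, y)) * f' y \<partial>M) = (\<integral>\<^sup>+y. ennreal (k (x, y)) * ennreal (cmod (f y)) \<partial>M)"
    using f' by (intro nn_integral_cong_AE) auto
  then show ?case using elim by (simp add: ennreal_mult)
qed

text \<open>
  Together with \<open>opnorm_le_if_kernel_bound\<close> this identifies the operator norm with the least bound of the
  form.
\<close>

lemma kernel_bound_opnorm:
  assumes k: "nonneg_kernel M k T"
  shows "kernel_bound M k (l2_opnorm M T)"
  unfolding kernel_bound_def
proof (intro ballI)
  fix f g assume fg: "f \<in> nn_unit_ball M" "g \<in> nn_unit_ball M"
  let ?f = "\<lambda>x. complex_of_real (enn2real (f x))" and ?g = "\<lambda>x. complex_of_real (enn2real (g x))"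
  let ?a = "\<lambda>y. complex_of_real (cmod (?f y))"
  note f = nn_unit_ball_repr[OF fg(1)] and g = nn_unit_ball_repr[OF fg(2)]
  have Tf: "T ?a \<in> L2 M" by (intro nonneg_kernelD(3)[OF k] L2_of_real_cmod f)
  have "kernel_form M k f g = (\<integral>\<^sup>+x. ennreal (cmod (?g x) * cmod (T ?a x)) \<partial>M)"
    by (rule kernel_form_eq_abs[OF k f(1,3) g(3)])
  also have "\<dots> \<le> ennreal (l2norm M ?g * l2norm M (T ?a))"
    by (rule l2_nn_Cauchy_Schwarz[OF g(1) Tf])
  also have "\<dots> \<le> ennreal (1 * l2_opnorm M T)"
    using g(2) f(2) L2_of_real_cmod[OF f(1)] l2_bounded_op_nonneg_kernel[OF k]
    by (intro ennreal_leI mult_mono l2norm_le_opnorm_unit) auto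
  finally show "kernel_form M k f g \<le> ennreal (l2_opnorm M T)" by simp
qed

end

section \<open>Hadamard log-convex functionals, adjoints and compositions\<close>

definition kernel_mean :: "real \<Rightarrow> ('b \<Rightarrow> real) \<Rightarrow> ('b \<Rightarrow> real) \<Rightarrow> 'b \<Rightarrow> real" where
  "kernel_mean \<alpha> a b p = rpow (a p) \<alpha> * rpow (b p) (1 - \<alpha>)"

text \<open>
  Where the integral diverges the value is \<open>0\<close>. For kernels of operators on \<open>L\<^sup>2\<close> this happens only on a null
  set (\<open>kernel_comp_integrable_AE\<close>).
\<close>

definition kernel_comp :: "'a measure \<Rightarrow> ('a \<times> 'a \<Rightarrow> real) \<Rightarrow> ('a \<times> 'a \<Rightarrow> real) \<Rightarrow> 'a \<times> 'a \<Rightarrow> real" where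
  "kernel_comp M k h p = (\<integral>y. k (fst p, y) * h (y, snd p) \<partial>M)"

definition kernel_transpose :: "('a \<times> 'a \<Rightarrow> real) \<Rightarrow> 'a \<times> 'a \<Rightarrow> real" where
  "kernel_transpose k p = k (prod.swap p)"

lemma kernel_mean_nonneg: "0 \<le> kernel_mean \<alpha> a b p"
  by (simp add: kernel_mean_def)

lemma kernel_mean_self: "0 \<le> a p \<Longrightarrow> kernel_mean \<alpha> a a p = a p"
  by (simp add: kernel_mean_def rpow_self_mean)

lemma kernel_mean_le_young:
  assumes "0 \<le> a p" "0 \<le> b p" "0 \<le> \<alpha>" "\<alpha> \<le> 1" "0 < t"
  shows "kernel_mean \<alpha> a b p \<le> (\<alpha> * t powr (1 - \<alpha>)) * a p + ((1 - \<alpha>) * t powr (- \<alpha>)) * b p"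
  using young_rpow[OF assms] by (simp add: kernel_mean_def)

lemma borel_measurable_rpow [measurable (raw)]:
  "f \<in> borel_measurable N \<Longrightarrow> (\<lambda>x. rpow (f x) t) \<in> borel_measurable N"
  unfolding rpow_def by (cases "t = 0") auto

lemma borel_measurable_kernel_mean [measurable (raw)]:
  "a \<in> borel_measurable N \<Longrightarrow> b \<in> borel_measurable N \<Longrightarrow> kernel_mean \<alpha> a b \<in> borel_measurable N"
  unfolding kernel_mean_def[abs_def] by (intro borel_measurable_times borel_measurable_rpow)

lemma kernel_mean_add_le:
  assumes nn: "\<And>p. 0 \<le> a1 p" "\<And>p. 0 \<le> b1 p" "\<And>p. 0 \<le> a2 p" "\<And>p. 0 \<le> b2 p"
    and \<alpha>: "0 \<le> \<alpha>" "\<alpha> \<le> 1"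
  shows "kernel_mean \<alpha> a1 b1 p + kernel_mean \<alpha> a2 b2 p \<le> kernel_mean \<alpha> (\<lambda>p. a1 p + a2 p) (\<lambda>p. b1 p + b2 p) p"
  unfolding kernel_mean_def[of \<alpha> "\<lambda>p. a1 p + a2 p"]
proof (rule le_rpow_mean_if_young)
  fix t :: real assume t: "0 < t"
  show "kernel_mean \<alpha> a1 b1 p + kernel_mean \<alpha> a2 b2 p
      \<le> (\<alpha> * t powr (1 - \<alpha>)) * (a1 p + a2 p) + ((1 - \<alpha>) * t powr (- \<alpha>)) * (b1 p + b2 p)"
    using kernel_mean_le_young[of a1 p b1 \<alpha> t] kernel_mean_le_young[of a2 p b2 \<alpha> t] nn \<alpha> t
    by (simp add: distrib_left)
qed (use nn \<alpha> in auto)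

text \<open>
  The last clause combines monotonicity, subadditivity and positive homogeneity, without mentioning
  sums of operators.
\<close>

definition dominated_seminorm :: "'a measure \<Rightarrow> ('a l2op \<Rightarrow> real) \<Rightarrow> bool" where
  "dominated_seminorm M \<rho> \<longleftrightarrow>
     (\<forall>k T. nonneg_kernel M k T \<longrightarrow> 0 \<le> \<rho> T) \<and>
     (\<forall>k T S. nonneg_kernel M k T \<longrightarrow> nonneg_kernel M (kernel_transpose k) S \<longrightarrow> \<rho> S \<le> \<rho> T) \<and>
     (\<forall>t a b T A B c d. nonneg_kernel M t T \<longrightarrow> nonneg_kernel M a A \<longrightarrow> nonneg_kernel M b B \<longrightarrow>
        0 \<le> c \<longrightarrow> 0 \<le> d \<longrightarrow> (AE p in M \<Otimes>\<^sub>M M. t p \<le> c * a p + d * b p) \<longrightarrow>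
        \<rho> T \<le> c * \<rho> A + d * \<rho> B)"

text \<open>
  One inequality in the second clause suffices, since the kernel of \<open>T\<close> is the transpose of the kernel of
  \<open>S\<close>. Operators enter only through their kernels, so the third clause also makes \<open>\<rho>\<close> independent of the
  choice of representatives.
\<close>

definition hadamard_log_convex :: "'a measure \<Rightarrow> ('a l2op \<Rightarrow> real) \<Rightarrow> bool" where
  "hadamard_log_convex M \<rho> \<longleftrightarrow>
     (\<forall>k T. nonneg_kernel M k T \<longrightarrow> 0 \<le> \<rho> T) \<and>
     (\<forall>k T S. nonneg_kernel M k T \<longrightarrow> nonneg_kernel M (kernel_transpose k) S \<longrightarrow> \<rho> S \<le> \<rho> T) \<and>
     (\<forall>\<alpha> t a b T A B. 0 \<le> \<alpha> \<longrightarrow> \<alpha> \<le> 1 \<longrightarrow>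
        nonneg_kernel M t T \<longrightarrow> nonneg_kernel M a A \<longrightarrow> nonneg_kernel M b B \<longrightarrow>
        (AE p in M \<Otimes>\<^sub>M M. t p \<le> kernel_mean \<alpha> a b p) \<longrightarrow>
        \<rho> T \<le> rpow (\<rho> A) \<alpha> * rpow (\<rho> B) (1 - \<alpha>))"

context l2_space
begin

text \<open>
  Apply the seminorm to the linear upper bounds of \<open>a\<^sup>\<alpha> b\<^sup>1\<^sup>-\<^sup>\<alpha>\<close> and minimize over the parameter.
\<close>

lemma dominated_seminorm_imp_log_convex:
  assumes \<rho>: "dominated_seminorm M \<rho>"
  shows "hadamard_log_convex M \<rho>"
proof -
  have nn: "0 \<le> \<rho> T" if "nonneg_kernel M k T" for k T
    using \<rho> that unfolding dominated_seminorm_def by blast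
  have adj: "\<rho> S \<le> \<rho> T" if "nonneg_kernel M k T" "nonneg_kernel M (kernel_transpose k) S" for k T S
    using \<rho> that unfolding dominated_seminorm_def by blast
  have dom: "\<rho> T \<le> c * \<rho> A + d * \<rho> B"
    if "nonneg_kernel M t T" "nonneg_kernel M a A" "nonneg_kernel M b B" "0 \<le> c" "0 \<le> d"
      "AE p in M \<Otimes>\<^sub>M M. t p \<le> c * a p + d * b p" for t a b T A B c d
    using \<rho> that unfolding dominated_seminorm_def by blast
  have mean: "\<rho> T \<le> rpow (\<rho> A) \<alpha> * rpow (\<rho> B) (1 - \<alpha>)"
    if \<alpha>: "0 \<le> \<alpha>" "\<alpha> \<le> 1" and t: "nonneg_kernel M t T" and a: "nonneg_kernel M a A" and b: "nonneg_kernel M b B"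
      and le: "AE p in M \<Otimes>\<^sub>M M. t p \<le> kernel_mean \<alpha> a b p" for \<alpha> t a b T A B
  proof (rule le_rpow_mean_if_young[OF nn[OF a] nn[OF b] \<alpha>])
    fix s :: real assume s: "0 < s"
    show "\<rho> T \<le> (\<alpha> * s powr (1 - \<alpha>)) * \<rho> A + ((1 - \<alpha>) * s powr (- \<alpha>)) * \<rho> B"
    proof (rule dom[OF t a b])
      show "AE p in M \<Otimes>\<^sub>M M. t p \<le> (\<alpha> * s powr (1 - \<alpha>)) * a p + ((1 - \<alpha>) * s powr (- \<alpha>)) * b p"
        using le
      proof eventually_elim
        case (elim p)
        then show ?case
          using kernel_mean_le_young[of a p b \<alpha> s] nonneg_kernelD(2)[OF a] nonneg_kernelD(2)[OF b] \<alpha> s by fastforce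
      qed
    qed (use \<alpha> in auto)
  qed
  show ?thesis
    unfolding hadamard_log_convex_def
    by (intro conjI allI impI; (rule nn | rule adj | rule mean); assumption)
qed

lemma hadamard_log_convexD:
  assumes "hadamard_log_convex M \<rho>"
  shows "nonneg_kernel M k T \<Longrightarrow> 0 \<le> \<rho> T"
    "nonneg_kernel M k T \<Longrightarrow> nonneg_kernel M (kernel_transpose k) S \<Longrightarrow> \<rho> S \<le> \<rho> T"
    "0 \<le> \<alpha> \<Longrightarrow> \<alpha> \<le> 1 \<Longrightarrow> nonneg_kernel M t T \<Longrightarrow> nonneg_kernel M a A \<Longrightarrow> nonneg_kernel M b B \<Longrightarrow>
      AE p in M \<Otimes>\<^sub>M M. t p \<le> kernel_mean \<alpha> a b p \<Longrightarrow> \<rho> T \<le> rpow (\<rho> A) \<alpha> * rpow (\<rho> B) (1 - \<alpha>)"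
  using assms unfolding hadamard_log_convex_def by blast+

lemma hadamard_log_convex_mono:
  assumes \<rho>: "hadamard_log_convex M \<rho>" and t: "nonneg_kernel M t T" and a: "nonneg_kernel M a A"
    and le: "AE p in M \<Otimes>\<^sub>M M. t p \<le> a p"
  shows "\<rho> T \<le> \<rho> A"
proof -
  have "AE p in M \<Otimes>\<^sub>M M. t p \<le> kernel_mean 1 a a p"
    using le by eventually_elim (simp add: kernel_mean_self nonneg_kernelD(2)[OF a])
  then have "\<rho> T \<le> rpow (\<rho> A) 1 * rpow (\<rho> A) (1 - 1)"
    by (intro hadamard_log_convexD(3)[OF \<rho> _ _ t a a]) auto
  then show ?thesis using hadamard_log_convexD(1)[OF \<rho> a] by simp
qed

lemma dominated_seminorm_opnorm: "dominated_seminorm M (l2_opnorm M)"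
  unfolding dominated_seminorm_def
proof (intro conjI allI impI)
  fix k T assume k: "nonneg_kernel M k T"
  show nn: "0 \<le> l2_opnorm M T" by (rule l2_opnorm_nonneg[OF l2_bounded_op_nonneg_kernel[OF k]])
  fix S assume S: "nonneg_kernel M (kernel_transpose k) S"
  have "kernel_bound M (kernel_transpose k) (l2_opnorm M T)"
    unfolding kernel_transpose_def[abs_def] by (rule kernel_bound_swap[OF kernel_bound_opnorm[OF k] nonneg_kernelD(1)[OF k]])
  then show "l2_opnorm M S \<le> l2_opnorm M T" using nn by (rule opnorm_le_if_kernel_bound[OF S])
next
  fix t a b T A B and c d :: real
  assume t: "nonneg_kernel M t T" and a: "nonneg_kernel M a A" and b: "nonneg_kernel M b B"
    and cd: "0 \<le> c" "0 \<le> d" and le: "AE p in M \<Otimes>\<^sub>M M. t p \<le> c * a p + d * b p"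
  have nn: "0 \<le> l2_opnorm M A" "0 \<le> l2_opnorm M B"
    using a b by (auto intro!: l2_opnorm_nonneg l2_bounded_op_nonneg_kernel)
  have "kernel_bound M t (c * l2_opnorm M A + d * l2_opnorm M B)"
    by (rule kernel_bound_dominated[OF kernel_bound_opnorm[OF a] kernel_bound_opnorm[OF b]])
       (use nonneg_kernelD[OF t] nonneg_kernelD[OF a] nonneg_kernelD[OF b] cd nn le in auto)
  then show "l2_opnorm M T \<le> c * l2_opnorm M A + d * l2_opnorm M B"
    using cd nn by (intro opnorm_le_if_kernel_bound[OF t]) auto
qed

lemma kernel_form_abs_eq_inner:
  assumes k: "nonneg_kernel M k T" and f: "f \<in> L2 M"
  defines "F \<equiv> \<lambda>y. complex_of_real (cmod (f y))"
  shows "kernel_form M k (\<lambda>x. ennreal (cmod (f x))) (\<lambda>x. ennreal (cmod (f x))) = ennreal (cmod (l2inner M (T F) F))"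
proof -
  have F: "F \<in> L2 M" unfolding F_def by (rule L2_of_real_cmod(1)[OF f])
  note TF = nonneg_kernelD(3)[OF k F]
  have int: "integrable M (\<lambda>x. cmod (f x) * cmod (T F x))" by (rule L2_mult_integrable(2)[OF f TF])
  have "l2inner M (T F) F = (\<integral>x. complex_of_real (cmod (f x) * cmod (T F x)) \<partial>M)"
    unfolding l2inner_def
  proof (rule integral_cong_AE)
    show "(\<lambda>x. T F x * cnj (F x)) \<in> borel_measurable M"
      using L2_measurable[OF TF] L2_measurable[OF F] by measurable
    show "(\<lambda>x. complex_of_real (cmod (f x) * cmod (T F x))) \<in> borel_measurable M"
      using L2_measurable[OF TF] L2_measurable[OF f] by measurable
    show "AE x in M. T F x * cnj (F x) = complex_of_real (cmod (f x) * cmod (T F x))"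
      using nonneg_kernel_abs(2)[OF k f, folded F_def]
      by eventually_elim (metis F_def complex_cnj_complex_of_real mult.commute of_real_mult)
  qed
  also have "\<dots> = complex_of_real (\<integral>x. cmod (f x) * cmod (T F x) \<partial>M)" by (rule integral_complex_of_real)
  finally have "cmod (l2inner M (T F) F) = (\<integral>x. cmod (f x) * cmod (T F x) \<partial>M)"
    by (simp add: Bochner_Integration.integral_nonneg)
  moreover have "kernel_form M k (\<lambda>x. ennreal (cmod (f x))) (\<lambda>x. ennreal (cmod (f x)))
      = (\<integral>\<^sup>+x. ennreal (cmod (f x) * cmod (T F x)) \<partial>M)"
    unfolding F_def by (rule kernel_form_eq_abs[OF k f]) auto
  ultimately show ?thesis using int by (simp add: nn_integral_eq_integral)
qed

lemma numerical_radius_set_bdd: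
  assumes T: "l2_bounded_op M T"
  shows "bdd_above (insert 0 {cmod (l2inner M (T f) f) | f. f \<in> L2 M \<and> l2norm M f = 1})"
proof (rule bdd_aboveI[of _ "l2_opnorm M T"])
  fix r assume "r \<in> insert 0 {cmod (l2inner M (T f) f) | f. f \<in> L2 M \<and> l2norm M f = 1}"
  then consider "r = 0" | f where "r = cmod (l2inner M (T f) f)" "f \<in> L2 M" "l2norm M f = 1" by auto
  then show "r \<le> l2_opnorm M T"
  proof cases
    case 2
    have "r \<le> l2norm M (T f) * l2norm M f"
      unfolding 2(1) using l2_bounded_opD(1)[OF T] 2 by (intro l2_Cauchy_Schwarz) auto
    then show ?thesis using l2norm_le_opnorm[OF T 2(2)] 2(3) by simp
  qed (use l2_opnorm_nonneg[OF T] in simp)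
qed

lemma inner_le_numerical_radius:
  assumes T: "l2_bounded_op M T" and f: "f \<in> L2 M" "l2norm M f \<le> 1"
  shows "cmod (l2inner M (T f) f) \<le> numerical_radius M T" "0 \<le> numerical_radius M T"
proof -
  show nn: "0 \<le> numerical_radius M T"
    unfolding numerical_radius_def by (rule cSup_upper[OF _ numerical_radius_set_bdd[OF T]]) simp
  show "cmod (l2inner M (T f) f) \<le> numerical_radius M T"
  proof (cases "l2norm M f = 0")
    case True
    then have "cmod (l2inner M (T f) f) \<le> 0"
      using l2_Cauchy_Schwarz[OF l2_bounded_opD(1)[OF T f(1)] f(1)] by simp
    then show ?thesis using nn by simp
  next
    case False
    define s where "s = l2norm M f"
    have s: "0 < s" "s \<le> 1" using False f(2) unfolding s_def by (auto simp: less_le)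
    let ?c = "complex_of_real (1 / s)"
    let ?g = "\<lambda>x. ?c * f x"
    have g: "?g \<in> L2 M" "l2norm M ?g = 1"
      using L2_cmult[OF f(1), of ?c] s by (auto simp: s_def norm_divide)
    have "l2inner M (T ?g) ?g = l2inner M (\<lambda>x. ?c * T f x) ?g"
      using l2_bounded_opD(1)[OF T] f(1) g(1)
      by (intro l2inner_cong_AE l2_bounded_opD(4)[OF T]) (auto dest!: L2_measurable)
    also have "\<dots> = ?c * ?c * l2inner M (T f) f"
      unfolding l2inner_def integral_mult_right_zero[symmetric] by (simp add: mult_ac)
    finally have eq: "cmod (l2inner M (T ?g) ?g) = (1 / s) * (1 / s) * cmod (l2inner M (T f) f)"
      using s by (simp add: norm_mult norm_divide)
    have "1 * cmod (l2inner M (T f) f) \<le> ((1 / s) * (1 / s)) * cmod (l2inner M (T f) f)"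
      using s by (intro mult_right_mono) (auto simp: mult_le_one)
    also have "\<dots> \<le> numerical_radius M T"
      unfolding eq[symmetric] numerical_radius_def
      by (rule cSup_upper[OF _ numerical_radius_set_bdd[OF T]]) (use g in blast)
    finally show ?thesis by simp
  qed
qed

lemma kernel_form_le_numerical_radius:
  assumes k: "nonneg_kernel M k T" and f: "f \<in> nn_unit_ball M"
  shows "kernel_form M k f f \<le> ennreal (numerical_radius M T)"
proof -
  let ?f = "\<lambda>x. complex_of_real (enn2real (f x))"
  note F = nn_unit_ball_repr[OF f]
  let ?a = "\<lambda>x. complex_of_real (cmod (?f x))"
  have "kernel_form M k f f = kernel_form M k (\<lambda>x. ennreal (cmod (?f x))) (\<lambda>x. ennreal (cmod (?f x)))"
    unfolding kernel_form_eq_abs[OF k F(1,3,3)] by (rule kernel_form_eq_abs[OF k F(1), symmetric]) auto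
  also have "\<dots> = ennreal (cmod (l2inner M (T ?a) ?a))"
    by (rule kernel_form_abs_eq_inner[OF k F(1)])
  also have "\<dots> \<le> ennreal (numerical_radius M T)"
    using F L2_of_real_cmod[OF F(1)]
    by (intro ennreal_leI inner_le_numerical_radius(1) l2_bounded_op_nonneg_kernel[OF k]) auto
  finally show ?thesis .
qed

text \<open>
  For a positive operator it suffices to test nonnegative functions, since
  \<open>|\<langle>T f, f\<rangle>| \<le> \<langle>T |f|, |f|\<rangle>\<close>.
\<close>

lemma numerical_radius_le:
  assumes k: "nonneg_kernel M k T" and "0 \<le> C"
    and b: "\<And>f. f \<in> nn_unit_ball M \<Longrightarrow> kernel_form M k f f \<le> ennreal C"
  shows "numerical_radius M T \<le> C"
  unfolding numerical_radius_def
proof (rule cSup_least)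
  fix r assume "r \<in> insert 0 {cmod (l2inner M (T f) f) | f. f \<in> L2 M \<and> l2norm M f = 1}"
  then consider "r = 0" | f where "r = cmod (l2inner M (T f) f)" "f \<in> L2 M" "l2norm M f = 1" by auto
  then show "r \<le> C"
  proof cases
    case 2
    note [measurable] = L2_measurable[OF 2(2)]
    have Tf: "T f \<in> L2 M" by (rule nonneg_kernelD(3)[OF k 2(2)])
    have "ennreal r \<le> (\<integral>\<^sup>+x. ennreal (cmod (T f x * cnj (f x))) \<partial>M)"
      unfolding 2(1) l2inner_def by (rule integral_norm_bound_ennreal[OF L2_mult_integrable(3)[OF Tf 2(2)]])
    also have "\<dots> \<le> kernel_form M k (\<lambda>x. ennreal (cmod (f x))) (\<lambda>x. ennreal (cmod (f x)))"
      unfolding kernel_form_def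
      by (intro nn_integral_mono_AE, use nonneg_kernel_abs(3)[OF k 2(2)] in eventually_elim)
         (simp only: norm_mult complex_mod_cnj ennreal_mult norm_ge_zero mult.commute[of "ennreal (cmod (T f _))"] mult_left_mono zero_le)
    also have "\<dots> \<le> ennreal C"
      using l2norm_sq[OF 2(2)] 2(3) by (intro b) (auto simp: nn_unit_ball_def ennreal_power)
    finally show ?thesis using assms(2) by simp
  qed (use assms in simp)
qed simp

lemma dominated_seminorm_numerical_radius: "dominated_seminorm M (numerical_radius M)"
proof -
  have nn: "0 \<le> numerical_radius M T" if "nonneg_kernel M k T" for k T
    by (rule inner_le_numerical_radius(2)[OF l2_bounded_op_nonneg_kernel[OF that] L2_zero(1)]) simp
  show ?thesis
    unfolding dominated_seminorm_def
  proof (intro conjI allI impI)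
    fix k T assume k: "nonneg_kernel M k T"
    show "0 \<le> numerical_radius M T" by (rule nn[OF k])
    fix S assume S: "nonneg_kernel M (kernel_transpose k) S"
    show "numerical_radius M S \<le> numerical_radius M T"
    proof (rule numerical_radius_le[OF S nn[OF k]])
      fix f assume f: "f \<in> nn_unit_ball M"
      have "kernel_form M (kernel_transpose k) f f = kernel_form M k f f"
        unfolding kernel_transpose_def[abs_def] using nonneg_kernelD(1)[OF k] f by (intro kernel_form_swap) (auto simp: nn_unit_ball_def)
      then show "kernel_form M (kernel_transpose k) f f \<le> ennreal (numerical_radius M T)"
        using kernel_form_le_numerical_radius[OF k f] by simp
    qed
  next
    fix t a b T A B and c d :: real
    assume t: "nonneg_kernel M t T" and a: "nonneg_kernel M a A" and b: "nonneg_kernel M b B"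
      and cd: "0 \<le> c" "0 \<le> d" and le: "AE p in M \<Otimes>\<^sub>M M. t p \<le> c * a p + d * b p"
    note nn = nn[OF a] nn[OF b]
    show "numerical_radius M T \<le> c * numerical_radius M A + d * numerical_radius M B"
    proof (rule numerical_radius_le[OF t])
      fix f assume f: "f \<in> nn_unit_ball M"
      have "kernel_form M t f f \<le> kernel_form M (\<lambda>p. c * a p + d * b p) f f" by (rule kernel_form_mono_AE[OF le])
      also have "\<dots> = ennreal c * kernel_form M a f f + ennreal d * kernel_form M b f f"
        using f nonneg_kernelD(1,2)[OF a] nonneg_kernelD(1,2)[OF b] cd
        by (intro kernel_form_lincomb) (auto simp: nn_unit_ball_def)
      also have "\<dots> \<le> ennreal c * ennreal (numerical_radius M A) + ennreal d * ennreal (numerical_radius M B)"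
        using kernel_form_le_numerical_radius[OF a f] kernel_form_le_numerical_radius[OF b f]
        by (intro add_mono mult_left_mono) auto
      also have "\<dots> = ennreal (c * numerical_radius M A + d * numerical_radius M B)"
        using cd nn by (simp add: ennreal_mult ennreal_plus)
      finally show "kernel_form M t f f \<le> ennreal (c * numerical_radius M A + d * numerical_radius M B)" .
    qed (use cd nn in auto)
  qed
qed

lemma opnorm_nonneg: "nonneg_kernel M k T \<Longrightarrow> 0 \<le> l2_opnorm M T"
  by (rule l2_opnorm_nonneg[OF l2_bounded_op_nonneg_kernel])

lemma kernel_of_AE:
  assumes k: "nonneg_kernel M k T"
  shows "kernel_of M T \<in> borel_measurable (M \<Otimes>\<^sub>M M)"
    "AE p in M \<Otimes>\<^sub>M M. kernel_of M T p = complex_of_real (k p)"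
proof -
  have k': "is_kernel M (\<lambda>p. complex_of_real (k p)) T" using k by (simp add: nonneg_kernel_def)
  then have "is_kernel M (kernel_of M T) T" unfolding kernel_of_def by (rule someI[where P = "\<lambda>k. is_kernel M k T"])
  then show "kernel_of M T \<in> borel_measurable (M \<Otimes>\<^sub>M M)"
    "AE p in M \<Otimes>\<^sub>M M. kernel_of M T p = complex_of_real (k p)"
    using is_kernel_unique[OF _ k'] by (auto simp: is_kernel_def)
qed

lemma kernel_op_measurable:
  assumes [measurable]: "\<kappa> \<in> borel_measurable (M \<Otimes>\<^sub>M M)" "f \<in> borel_measurable M"
  shows "kernel_op M \<kappa> f \<in> borel_measurable M"
  unfolding kernel_op_def[abs_def] by measurable

lemma kernel_op_cong_AE:
  assumes [measurable]: "\<kappa> \<in> borel_measurable (M \<Otimes>\<^sub>M M)" "\<kappa>' \<in> borel_measurable (M \<Otimes>\<^sub>M M)"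
    "f \<in> borel_measurable M" and ae: "AE p in M \<Otimes>\<^sub>M M. \<kappa> p = \<kappa>' p"
  shows "AE x in M. kernel_op M \<kappa> f x = kernel_op M \<kappa>' f x"
  using product.AE_pair[OF ae] AE_space
proof eventually_elim
  case (elim x)
  then show ?case unfolding kernel_op_def by (intro integral_cong_AE) auto
qed

text \<open>
  By Young's inequality the mean of two kernels is dominated by \<open>\<alpha> a + (1 - \<alpha>) b\<close>, hence has a bounded
  form. The chosen kernels of \<open>A\<close> and \<open>B\<close> agree with \<open>a\<close> and \<open>b\<close> almost everywhere.
\<close>

lemma nonneg_kernel_hadamard_mean:
  assumes a: "nonneg_kernel M a A" and b: "nonneg_kernel M b B" and \<alpha>: "0 \<le> \<alpha>" "\<alpha> \<le> 1"
  shows "nonneg_kernel M (kernel_mean \<alpha> a b) (hadamard_mean M \<alpha> A B)"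
proof -
  note [measurable] = nonneg_kernelD(1)[OF a] nonneg_kernelD(1)[OF b] kernel_of_AE(1)[OF a] kernel_of_AE(1)[OF b]
  let ?\<kappa> = "hadamard_prod (hadamard_power (kernel_of M A) \<alpha>) (hadamard_power (kernel_of M B) (1 - \<alpha>))"
  have \<kappa>[measurable]: "?\<kappa> \<in> borel_measurable (M \<Otimes>\<^sub>M M)"
    unfolding hadamard_prod_def[abs_def] hadamard_power_def[abs_def] by measurable
  have ae: "AE p in M \<Otimes>\<^sub>M M. ?\<kappa> p = complex_of_real (kernel_mean \<alpha> a b p)"
    using kernel_of_AE(2)[OF a] kernel_of_AE(2)[OF b]
    by eventually_elim
       (simp add: hadamard_prod_def hadamard_power_def kernel_mean_def nonneg_kernelD(2)[OF a] nonneg_kernelD(2)[OF b])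
  show ?thesis
  proof (rule nonneg_kernelI(1))
    show "kernel_bound M (kernel_mean \<alpha> a b) ((\<alpha> * 1 powr (1 - \<alpha>)) * l2_opnorm M A + ((1 - \<alpha>) * 1 powr (- \<alpha>)) * l2_opnorm M B)"
      by (rule kernel_bound_dominated[OF kernel_bound_opnorm[OF a] kernel_bound_opnorm[OF b]])
         (use nonneg_kernelD(1,2)[OF a] nonneg_kernelD(1,2)[OF b] \<alpha>
            kernel_mean_le_young[of a _ b \<alpha> 1] opnorm_nonneg[OF a] opnorm_nonneg[OF b]
          in auto)
    show "0 \<le> (\<alpha> * 1 powr (1 - \<alpha>)) * l2_opnorm M A + ((1 - \<alpha>) * 1 powr (- \<alpha>)) * l2_opnorm M B"
      using \<alpha> opnorm_nonneg[OF a] opnorm_nonneg[OF b] by (intro add_nonneg_nonneg mult_nonneg_nonneg) auto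
    fix f assume f: "f \<in> L2 M"
    note [measurable] = L2_measurable[OF f]
    show "hadamard_mean M \<alpha> A B f \<in> borel_measurable M"
      unfolding hadamard_mean_def by (rule kernel_op_measurable) measurable
    show "AE x in M. hadamard_mean M \<alpha> A B f x = (\<integral>y. complex_of_real (kernel_mean \<alpha> a b (x, y)) * f y \<partial>M)"
      unfolding hadamard_mean_def using kernel_op_cong_AE[OF _ _ _ ae, of f]
      unfolding kernel_op_def[of M "\<lambda>p. complex_of_real (kernel_mean \<alpha> a b p)"] by measurable
  qed (auto simp: kernel_mean_nonneg)
qed

lemma nonneg_kernel_transpose_op:
  assumes k: "nonneg_kernel M k T"
  shows "nonneg_kernel M (kernel_transpose k) (kernel_op M (\<lambda>p. complex_of_real (kernel_transpose k p)))"
proof -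
  note [measurable] = nonneg_kernelD(1)[OF k]
  have [measurable]: "kernel_transpose k \<in> borel_measurable (M \<Otimes>\<^sub>M M)"
    unfolding kernel_transpose_def[abs_def] prod.swap_def by measurable
  have "kernel_bound M (kernel_transpose k) (l2_opnorm M T)"
    unfolding kernel_transpose_def[abs_def] by (rule kernel_bound_swap[OF kernel_bound_opnorm[OF k]]) measurable
  then show ?thesis
  proof (rule nonneg_kernelI(1))
    show "kernel_op M (\<lambda>p. complex_of_real (kernel_transpose k p)) f \<in> borel_measurable M" if "f \<in> L2 M" for f
      using L2_measurable[OF that] by (intro kernel_op_measurable) measurable
  qed (auto simp: kernel_transpose_def nonneg_kernelD(2)[OF k] opnorm_nonneg[OF k]
      kernel_op_def[of _ "\<lambda>p. complex_of_real (k (prod.swap p))"])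
qed

lemma kernel_transpose_adjoint:
  assumes k: "nonneg_kernel M k T" and S: "nonneg_kernel M (kernel_transpose k) S" and f: "f \<in> L2 M" and g: "g \<in> L2 M"
  shows "l2inner M (T f) g = l2inner M f (S g)"
proof -
  note [measurable] = nonneg_kernelD(1)[OF k] L2_measurable[OF f] L2_measurable[OF g]
    L2_measurable[OF nonneg_kernelD(3)[OF k f]] L2_measurable[OF nonneg_kernelD(3)[OF S g]]
  define F where "F x y = complex_of_real (k (x, y)) * f y * cnj (g x)" for x y
  have [measurable]: "case_prod F \<in> borel_measurable (M \<Otimes>\<^sub>M M)"
    unfolding F_def case_prod_beta by measurable
  have int: "integrable (M \<Otimes>\<^sub>M M) (case_prod F)"
    unfolding integrable_iff_bounded
  proof
    have "(\<integral>\<^sup>+p. ennreal (norm (case_prod F p)) \<partial>(M \<Otimes>\<^sub>M M)) = (\<integral>\<^sup>+x. \<integral>\<^sup>+y. ennreal (norm (F x y)) \<partial>M \<partial>M)"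
      by (subst nn_integral_fst[symmetric]) auto
    also have "\<dots> = kernel_form M k (\<lambda>x. ennreal (cmod (f x))) (\<lambda>x. ennreal (cmod (g x)))"
      unfolding kernel_form_def
    proof (rule nn_integral_cong)
      fix x assume x: "x \<in> space M"
      have "(\<integral>\<^sup>+y. ennreal (norm (F x y)) \<partial>M)
          = (\<integral>\<^sup>+y. ennreal (cmod (g x)) * (ennreal (k (x, y)) * ennreal (cmod (f y))) \<partial>M)"
        unfolding F_def using nonneg_kernelD(2)[OF k] by (simp add: norm_mult ennreal_mult mult_ac)
      also have "\<dots> = ennreal (cmod (g x)) * (\<integral>\<^sup>+y. ennreal (k (x, y)) * ennreal (cmod (f y)) \<partial>M)"
        using x by (intro nn_integral_cmult) measurable
      finally show "(\<integral>\<^sup>+y. ennreal (norm (F x y)) \<partial>M)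
          = ennreal (cmod (g x)) * (\<integral>\<^sup>+y. ennreal (k (x, y)) * ennreal (cmod (f y)) \<partial>M)" .
    qed
    also have "\<dots> = (\<integral>\<^sup>+x. ennreal (cmod (g x) * cmod (T (\<lambda>y. complex_of_real (cmod (f y))) x)) \<partial>M)"
      by (rule kernel_form_eq_abs[OF k f]) auto
    also have "\<dots> \<le> ennreal (l2norm M g * l2norm M (T (\<lambda>y. complex_of_real (cmod (f y)))))"
      by (rule l2_nn_Cauchy_Schwarz[OF g nonneg_kernelD(3)[OF k L2_of_real_cmod(1)[OF f]]])
    also have "\<dots> < \<infinity>" by simp
    finally show "(\<integral>\<^sup>+p. ennreal (norm (case_prod F p)) \<partial>(M \<Otimes>\<^sub>M M)) < \<infinity>" .
  qed measurable
  have "l2inner M (T f) g = (\<integral>x. \<integral>y. F x y \<partial>M \<partial>M)"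
    unfolding l2inner_def
  proof (rule integral_cong_AE)
    show "AE x in M. T f x * cnj (g x) = (\<integral>y. F x y \<partial>M)"
      using nonneg_kernelD(5)[OF k f] by eventually_elim (simp add: F_def)
  qed measurable
  also have "\<dots> = (\<integral>y. \<integral>x. F x y \<partial>M \<partial>M)" by (rule product.Fubini_integral[OF int, symmetric])
  also have "\<dots> = l2inner M f (S g)"
    unfolding l2inner_def
  proof (rule integral_cong_AE)
    show "AE y in M. (\<integral>x. F x y \<partial>M) = f y * cnj (S g y)"
      using nonneg_kernelD(5)[OF S g] nonneg_kernelD(4)[OF S g]
    proof eventually_elim
      case (elim y)
      have "(\<integral>x. F x y \<partial>M) = (\<integral>x. f y * cnj (complex_of_real (k (x, y)) * g x) \<partial>M)"
        unfolding F_def by (simp add: mult_ac)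
      also have "\<dots> = f y * (\<integral>x. cnj (complex_of_real (k (x, y)) * g x) \<partial>M)" by (rule integral_mult_right_zero)
      also have "(\<integral>x. cnj (complex_of_real (k (x, y)) * g x) \<partial>M) = cnj (\<integral>x. complex_of_real (k (x, y)) * g x \<partial>M)"
        using elim(2) by (intro integral_bounded_linear bounded_linear_cnj) (simp add: kernel_transpose_def)
      finally show ?case using elim by (simp add: kernel_transpose_def)
    qed
  qed measurable
  finally show ?thesis .
qed

text \<open>
  The operator with the transposed kernel satisfies the defining property of the adjoint by Fubini, and
  that property determines the adjoint almost everywhere.
\<close>

lemma nonneg_kernel_adjoint:
  assumes k: "nonneg_kernel M k T"
  shows "nonneg_kernel M (kernel_transpose k) (l2_adjoint M T)"
proof -
  define S0 where "S0 = kernel_op M (\<lambda>p. complex_of_real (kernel_transpose k p))"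
  have S0: "nonneg_kernel M (kernel_transpose k) S0" unfolding S0_def by (rule nonneg_kernel_transpose_op[OF k])
  have "l2_bounded_op M S0 \<and> (\<forall>f\<in>L2 M. \<forall>g\<in>L2 M. l2inner M (T f) g = l2inner M f (S0 g))"
    using l2_bounded_op_nonneg_kernel[OF S0] kernel_transpose_adjoint[OF k S0] by blast
  then have S: "l2_bounded_op M (l2_adjoint M T) \<and>
      (\<forall>f\<in>L2 M. \<forall>g\<in>L2 M. l2inner M (T f) g = l2inner M f (l2_adjoint M T g))"
    unfolding l2_adjoint_def
    by (rule someI[where P = "\<lambda>S. l2_bounded_op M S \<and> (\<forall>f\<in>L2 M. \<forall>g\<in>L2 M. l2inner M (T f) g = l2inner M f (S g))"])
  have eq: "AE x in M. l2_adjoint M T g x = S0 g x" if g: "g \<in> L2 M" for g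
  proof -
    have L: "l2_adjoint M T g \<in> L2 M" "S0 g \<in> L2 M"
      using S g nonneg_kernelD(3)[OF S0 g] l2_bounded_opD(1) by auto
    let ?h = "\<lambda>x. l2_adjoint M T g x - S0 g x"
    have h: "?h \<in> L2 M" using L by (rule L2_diff(1))
    have "l2inner M ?h (l2_adjoint M T g) = l2inner M ?h (S0 g)"
      using S kernel_transpose_adjoint[OF k S0 h g] g h by metis
    then have "l2inner M ?h ?h = 0"
      unfolding l2inner_def complex_cnj_diff right_diff_distrib
      using L2_mult_integrable(3)[OF h L(1)] L2_mult_integrable(3)[OF h L(2)] by simp
    moreover have "l2inner M ?h ?h = complex_of_real ((l2norm M ?h)\<^sup>2)"
      unfolding l2inner_def l2norm_def complex_norm_square[symmetric] integral_complex_of_real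
      by (simp add: Bochner_Integration.integral_nonneg)
    ultimately have "l2norm M ?h = 0" by simp
    then show ?thesis using l2norm_eq_0_AE[OF h] by simp
  qed
  show ?thesis
  proof (rule nonneg_kernelI(1)[OF kernel_bound_opnorm[OF S0] nonneg_kernelD(1,2)[OF S0]
        l2_opnorm_nonneg[OF l2_bounded_op_nonneg_kernel[OF S0]]])
    fix f assume f: "f \<in> L2 M"
    show "l2_adjoint M T f \<in> borel_measurable M"
      using S f l2_bounded_opD(1) by (blast intro: L2_measurable)
    show "AE x in M. l2_adjoint M T f x = (\<integral>y. complex_of_real (kernel_transpose k (x, y)) * f y \<partial>M)"
      using eq[OF f] by eventually_elim (simp add: S0_def kernel_op_def)
  qed
qed

lemma kernel_comp_nonneg:
  assumes "\<And>p. 0 \<le> k p" "\<And>p. 0 \<le> h p"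
  shows "0 \<le> kernel_comp M k h p"
  unfolding kernel_comp_def using assms by (intro Bochner_Integration.integral_nonneg mult_nonneg_nonneg) auto

lemma kernel_comp_measurable [measurable]:
  assumes [measurable]: "k \<in> borel_measurable (M \<Otimes>\<^sub>M M)" "h \<in> borel_measurable (M \<Otimes>\<^sub>M M)"
  shows "kernel_comp M k h \<in> borel_measurable (M \<Otimes>\<^sub>M M)"
  unfolding kernel_comp_def[abs_def] by measurable

lemma kernel_comp_swap: "kernel_comp M (kernel_transpose h) (kernel_transpose k) = kernel_transpose (kernel_comp M k h)"
  by (auto simp: kernel_comp_def kernel_transpose_def fun_eq_iff mult.commute)

text \<open>
  Absolute integrability needed for Fubini, obtained from the fact that \<open>T (S |f|)\<close> is finite almost
  everywhere.
\<close>

lemma kernel_product_integrable_AE: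
  assumes k: "nonneg_kernel M k T" and h: "nonneg_kernel M h S" and f: "f \<in> L2 M"
  shows "AE x in M. integrable (M \<Otimes>\<^sub>M M) (\<lambda>(y, z). complex_of_real (k (x, y)) * (complex_of_real (h (y, z)) * f z))"
proof -
  note [measurable] = nonneg_kernelD(1)[OF k] nonneg_kernelD(1)[OF h] L2_measurable[OF f]
  let ?a = "\<lambda>y. complex_of_real (cmod (f y))"
  have Sa: "S ?a \<in> L2 M" by (rule nonneg_kernelD(3)[OF h L2_of_real_cmod(1)[OF f]])
  have "AE x in M. (\<integral>\<^sup>+y. ennreal (k (x, y)) * ennreal (cmod (S ?a y)) \<partial>M) < \<infinity>"
    by (rule nn_integral_kernel_finite_AE[OF kernel_bound_opnorm[OF k] _ _ Sa])
       (auto intro!: l2_opnorm_nonneg l2_bounded_op_nonneg_kernel[OF k])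
  then show ?thesis
    using AE_space
  proof eventually_elim
    case (elim x)
    note x = elim(2)
    have [measurable]: "(\<lambda>(y, z). complex_of_real (k (x, y)) * (complex_of_real (h (y, z)) * f z)) \<in> borel_measurable (M \<Otimes>\<^sub>M M)"
      using x by measurable
    have "(\<integral>\<^sup>+p. ennreal (norm (case p of (y, z) \<Rightarrow> complex_of_real (k (x, y)) * (complex_of_real (h (y, z)) * f z))) \<partial>(M \<Otimes>\<^sub>M M))
        = (\<integral>\<^sup>+y. \<integral>\<^sup>+z. ennreal (norm (complex_of_real (k (x, y)) * (complex_of_real (h (y, z)) * f z))) \<partial>M \<partial>M)"
      by (subst nn_integral_fst[symmetric]) auto
    also have "\<dots> = (\<integral>\<^sup>+y. ennreal (k (x, y)) * (\<integral>\<^sup>+z. ennreal (h (y, z)) * ennreal (cmod (f z)) \<partial>M) \<partial>M)"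
      using x nonneg_kernelD(2)[OF k] nonneg_kernelD(2)[OF h]
      by (intro nn_integral_cong) (simp add: norm_mult ennreal_mult nn_integral_cmult)
    also have "\<dots> = (\<integral>\<^sup>+y. ennreal (k (x, y)) * ennreal (cmod (S ?a y)) \<partial>M)"
      by (intro nn_integral_cong_AE, use nonneg_kernel_abs(1)[OF h f] in eventually_elim) simp
    also note elim(1)
    finally show ?case by (auto simp: integrable_iff_bounded)
  qed
qed

text \<open>
  Apply the previous lemma to a strictly positive \<open>f\<close>. Without this the kernel of a composition could
  take the default value \<open>0\<close> of a divergent integral, and inequalities between kernels would fail.
\<close>

lemma kernel_comp_integrable_AE:
  assumes k: "nonneg_kernel M k T" and h: "nonneg_kernel M h S"
  shows "AE x in M. AE z in M. integrable M (\<lambda>y. k (x, y) * h (y, z))"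
proof -
  obtain u :: "'a \<Rightarrow> real" where u: "u \<in> borel_measurable M" "\<And>x. x \<in> space M \<Longrightarrow> 0 < u x" "\<And>x. 0 \<le> u x"
    "(\<lambda>x. complex_of_real (u x)) \<in> L2 M" using obtain_positive_L2 by blast
  show ?thesis
    using kernel_product_integrable_AE[OF k h u(4)]
  proof eventually_elim
    case (elim x)
    from product.AE_integrable_snd[OF elim] show ?case
      using AE_space
    proof eventually_elim
      case (elim z)
      from integrable_Re[OF elim(1)] have "integrable M (\<lambda>y. (k (x, y) * h (y, z)) * u z)" by (simp add: mult.assoc)
      then have "integrable M (\<lambda>y. (k (x, y) * h (y, z)) * u z * (1 / u z))" by (rule integrable_mult_left)
      then show ?case using u(2)[OF elim(2)] by simp
    qed
  qed
qed

lemma nonneg_kernel_comp: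
  assumes k: "nonneg_kernel M k T" and h: "nonneg_kernel M h S"
  shows "nonneg_kernel M (kernel_comp M k h) (T \<circ> S)"
  unfolding nonneg_kernel_def is_kernel_def
proof (intro conjI ballI allI)
  note [measurable] = nonneg_kernelD(1)[OF k] nonneg_kernelD(1)[OF h]
  show "kernel_comp M k h \<in> borel_measurable (M \<Otimes>\<^sub>M M)" by measurable
  then show "(\<lambda>p. complex_of_real (kernel_comp M k h p)) \<in> borel_measurable (M \<Otimes>\<^sub>M M)" by measurable
  show "0 \<le> kernel_comp M k h p" for p by (rule kernel_comp_nonneg[OF nonneg_kernelD(2)[OF k] nonneg_kernelD(2)[OF h]])
  fix f assume f: "f \<in> L2 M"
  note Sf = nonneg_kernelD(3)[OF h f]
  show "(T \<circ> S) f \<in> L2 M" using nonneg_kernelD(3)[OF k Sf] by simp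
  note [measurable] = L2_measurable[OF f] L2_measurable[OF Sf]
  show "AE x in M. integrable M (\<lambda>y. complex_of_real (kernel_comp M k h (x, y)) * f y) \<and>
      (T \<circ> S) f x = (\<integral>y. complex_of_real (kernel_comp M k h (x, y)) * f y \<partial>M)"
    using kernel_product_integrable_AE[OF k h f] nonneg_kernelD(5)[OF k Sf] AE_space
  proof eventually_elim
    case (elim x)
    let ?F = "\<lambda>y z. complex_of_real (k (x, y)) * (complex_of_real (h (y, z)) * f z)"
    have inner: "(\<integral>y. ?F y z \<partial>M) = complex_of_real (kernel_comp M k h (x, z)) * f z" for z
    proof -
      have "(\<integral>y. ?F y z \<partial>M) = (\<integral>y. complex_of_real (k (x, y) * h (y, z)) * f z \<partial>M)" by (simp add: mult_ac)
      also have "\<dots> = (\<integral>y. complex_of_real (k (x, y) * h (y, z)) \<partial>M) * f z" by (rule integral_mult_left_zero)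
      finally show ?thesis unfolding integral_complex_of_real kernel_comp_def by simp
    qed
    have "(T \<circ> S) f x = (\<integral>y. complex_of_real (k (x, y)) * S f y \<partial>M)" using elim(2) by simp
    also have "\<dots> = (\<integral>y. \<integral>z. ?F y z \<partial>M \<partial>M)"
    proof (rule integral_cong_AE)
      show "AE y in M. complex_of_real (k (x, y)) * S f y = (\<integral>z. ?F y z \<partial>M)"
        using nonneg_kernelD(5)[OF h f] by eventually_elim simp
    qed (use elim(3) in measurable)
    also have "\<dots> = (\<integral>z. \<integral>y. ?F y z \<partial>M \<partial>M)"
      by (rule product.Fubini_integral[OF elim(1), symmetric])
    finally show ?case
      using product.integrable_snd[OF elim(1)] by (simp add: inner)
  qed
qed

text \<open>
  Hoelder's inequality for compositions. For each \<open>s > 0\<close> the integrand is bounded by a linear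
  combination of \<open>a\<^sub>1 a\<^sub>2\<close> and \<open>b\<^sub>1 b\<^sub>2\<close>; integrate and then minimize over \<open>s\<close>.
\<close>

lemma kernel_comp_mean_le:
  assumes t1: "nonneg_kernel M t1 T1" and t2: "nonneg_kernel M t2 T2"
    and a1: "nonneg_kernel M a1 A1" and a2: "nonneg_kernel M a2 A2"
    and b1: "nonneg_kernel M b1 B1" and b2: "nonneg_kernel M b2 B2"
    and \<alpha>: "0 \<le> \<alpha>" "\<alpha> \<le> 1"
    and le1: "AE p in M \<Otimes>\<^sub>M M. t1 p \<le> kernel_mean \<alpha> a1 b1 p" and le2: "AE p in M \<Otimes>\<^sub>M M. t2 p \<le> kernel_mean \<alpha> a2 b2 p"
  shows "AE p in M \<Otimes>\<^sub>M M. kernel_comp M t1 t2 p \<le> kernel_mean \<alpha> (kernel_comp M a1 a2) (kernel_comp M b1 b2) p"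
proof -
  note [measurable] = nonneg_kernelD(1)[OF t1] nonneg_kernelD(1)[OF t2] nonneg_kernelD(1)[OF a1]
    nonneg_kernelD(1)[OF a2] nonneg_kernelD(1)[OF b1] nonneg_kernelD(1)[OF b2]
  note nn = nonneg_kernelD(2)[OF t1] nonneg_kernelD(2)[OF t2] nonneg_kernelD(2)[OF a1]
    nonneg_kernelD(2)[OF a2] nonneg_kernelD(2)[OF b1] nonneg_kernelD(2)[OF b2]
  have "AE y in M. AE z in M. t2 (y, z) \<le> kernel_mean \<alpha> a2 b2 (y, z)" by (rule product.AE_pair[OF le2])
  then have le2': "AE z in M. AE y in M. t2 (y, z) \<le> kernel_mean \<alpha> a2 b2 (y, z)"
    by (subst (asm) product.AE_commute) measurable
  have "AE x in M. AE z in M. kernel_comp M t1 t2 (x, z) \<le> kernel_mean \<alpha> (kernel_comp M a1 a2) (kernel_comp M b1 b2) (x, z)"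
    using product.AE_pair[OF le1] kernel_comp_integrable_AE[OF a1 a2] kernel_comp_integrable_AE[OF b1 b2] AE_space
  proof eventually_elim
    case (elim x)
    note ex = elim
    show ?case
      using le2' ex(2,3) AE_space
    proof eventually_elim
      case (elim z)
      show ?case
        unfolding kernel_mean_def
      proof (rule le_rpow_mean_if_young[OF kernel_comp_nonneg kernel_comp_nonneg \<alpha>])
        fix s :: real assume s: "0 < s"
        let ?p = "\<alpha> * s powr (1 - \<alpha>)" and ?q = "(1 - \<alpha>) * s powr (- \<alpha>)"
        let ?g = "\<lambda>y. ?p * (a1 (x, y) * a2 (y, z)) + ?q * (b1 (x, y) * b2 (y, z))"
        have "kernel_comp M t1 t2 (x, z) \<le> (\<integral>y. ?g y \<partial>M)"
          unfolding kernel_comp_def fst_conv snd_conv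
        proof (rule integral_mono_AE')
          show "integrable M ?g" using elim by auto
          show "AE y in M. t1 (x, y) * t2 (y, z) \<le> ?g y"
            using ex(1) elim(1)
          proof eventually_elim
            case (elim y)
            have "t1 (x, y) * t2 (y, z) \<le> kernel_mean \<alpha> a1 b1 (x, y) * kernel_mean \<alpha> a2 b2 (y, z)"
              using elim nn by (intro mult_mono) (auto simp: kernel_mean_nonneg)
            also have "\<dots> = rpow (a1 (x, y) * a2 (y, z)) \<alpha> * rpow (b1 (x, y) * b2 (y, z)) (1 - \<alpha>)"
              using nn by (simp add: kernel_mean_def rpow_mult)
            also have "\<dots> \<le> ?g y" using nn \<alpha> s by (intro young_rpow) auto
            finally show ?case .
          qed
          show "AE y in M. 0 \<le> ?g y"
            using nn \<alpha> by (intro AE_I2 add_nonneg_nonneg mult_nonneg_nonneg) auto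
        qed
        also have "\<dots> = ?p * kernel_comp M a1 a2 (x, z) + ?q * kernel_comp M b1 b2 (x, z)"
          using elim unfolding kernel_comp_def by simp
        finally show "kernel_comp M t1 t2 (x, z) \<le> ?p * kernel_comp M a1 a2 (x, z) + ?q * kernel_comp M b1 b2 (x, z)" .
      qed (use nn in auto)
    qed
  qed
  then show ?thesis by (intro product.AE_pair_measure) measurable
qed

lemma nonneg_kernel_zero: "nonneg_kernel M (\<lambda>p. 0) (\<lambda>f x. 0)"
  unfolding nonneg_kernel_def is_kernel_def by auto

lemma nonneg_kernel_add:
  assumes k: "nonneg_kernel M k T" and h: "nonneg_kernel M h S"
  shows "nonneg_kernel M (\<lambda>p. k p + h p) (\<lambda>f x. T f x + S f x)"
  unfolding nonneg_kernel_def is_kernel_def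
proof (intro conjI ballI allI)
  note [measurable] = nonneg_kernelD(1)[OF k] nonneg_kernelD(1)[OF h]
  show "(\<lambda>p. k p + h p) \<in> borel_measurable (M \<Otimes>\<^sub>M M)"
    "(\<lambda>p. complex_of_real (k p + h p)) \<in> borel_measurable (M \<Otimes>\<^sub>M M)" by measurable
  show "0 \<le> k p + h p" for p using nonneg_kernelD(2)[OF k] nonneg_kernelD(2)[OF h] by (rule add_nonneg_nonneg)
  fix f assume f: "f \<in> L2 M"
  show "(\<lambda>x. T f x + S f x) \<in> L2 M" by (rule L2_add(1)[OF nonneg_kernelD(3)[OF k f] nonneg_kernelD(3)[OF h f]])
  show "AE x in M. integrable M (\<lambda>y. complex_of_real (k (x, y) + h (x, y)) * f y) \<and>
      T f x + S f x = (\<integral>y. complex_of_real (k (x, y) + h (x, y)) * f y \<partial>M)"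
    using nonneg_kernelD(4,5)[OF k f] nonneg_kernelD(4,5)[OF h f]
    by eventually_elim (simp add: distrib_right)
qed

end

section \<open>Compactness on order intervals\<close>

lemma ennreal_sum_squared_le:
  fixes a b :: ennreal
  shows "(a + b)\<^sup>2 \<le> 2 * a\<^sup>2 + 2 * b\<^sup>2"
proof (cases "a = top \<or> b = top")
  case True
  then show ?thesis by (auto simp: power2_eq_square ennreal_mult_eq_top_iff)
next
  case False
  then obtain x y where xy: "a = ennreal x" "0 \<le> x" "b = ennreal y" "0 \<le> y"
    by (metis ennreal_cases)
  have "(x + y)\<^sup>2 \<le> 2 * x\<^sup>2 + 2 * y\<^sup>2"
    using sum_squares_bound[of x y] by (simp add: power2_sum)
  then have "ennreal ((x + y)\<^sup>2) \<le> ennreal (2 * x\<^sup>2 + 2 * y\<^sup>2)" by (rule ennreal_leI)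
  also have "ennreal (2 * x\<^sup>2 + 2 * y\<^sup>2) = 2 * a\<^sup>2 + 2 * b\<^sup>2"
    using xy by (simp add: ennreal_mult ennreal_power)
  also have "ennreal ((x + y)\<^sup>2) = (a + b)\<^sup>2"
    using xy by (simp add: ennreal_power ennreal_plus[symmetric] del: ennreal_plus)
  finally show ?thesis .
qed

text \<open>
  These kernels need not define operators on all of \<open>L\<^sup>2\<close>, but they act on the order interval
  \<open>|g| \<le> v\<close>.
\<close>

definition order_bounded_kernel :: "'a measure \<Rightarrow> ('a \<Rightarrow> real) \<Rightarrow> ('a \<times> 'a \<Rightarrow> real) \<Rightarrow> bool" where
  "order_bounded_kernel M v \<kappa> \<longleftrightarrow> \<kappa> \<in> borel_measurable (M \<Otimes>\<^sub>M M) \<and>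
     (\<integral>\<^sup>+x. (\<integral>\<^sup>+y. ennreal (\<bar>\<kappa> (x, y)\<bar> * v y) \<partial>M)\<^sup>2 \<partial>M) < \<infinity>"

text \<open>
  AM-compactness, restricted to one order interval \<open>|g| \<le> v\<close>: its image is totally bounded.
\<close>

definition order_compact_kernel :: "'a measure \<Rightarrow> ('a \<Rightarrow> real) \<Rightarrow> ('a \<times> 'a \<Rightarrow> real) \<Rightarrow> bool" where
  "order_compact_kernel M v \<kappa> \<longleftrightarrow> order_bounded_kernel M v \<kappa> \<and>
     (\<forall>\<eta>>0. \<exists>F. finite F \<and> F \<subseteq> L2 M \<and>
        (\<forall>g\<in>L2 M. (\<forall>x\<in>space M. cmod (g x) \<le> v x) \<longrightarrow>
          (\<exists>f\<in>F. l2norm M (\<lambda>x. kernel_op M (\<lambda>p. complex_of_real (\<kappa> p)) g x - f x) \<le> \<eta>)))"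

lemma order_compact_kernelE:
  assumes \<kappa>: "order_compact_kernel M v \<kappa>" and "0 < \<eta>"
  obtains F where "finite F" "F \<subseteq> L2 M"
    "\<And>g. g \<in> L2 M \<Longrightarrow> (\<forall>x\<in>space M. cmod (g x) \<le> v x) \<Longrightarrow>
      \<exists>f\<in>F. l2norm M (\<lambda>x. kernel_op M (\<lambda>p. complex_of_real (\<kappa> p)) g x - f x) \<le> \<eta>"
proof -
  from \<kappa>[unfolded order_compact_kernel_def, THEN conjunct2, rule_format, OF assms(2)]
  obtain F where "finite F \<and> F \<subseteq> L2 M \<and> (\<forall>g\<in>L2 M. (\<forall>x\<in>space M. cmod (g x) \<le> v x) \<longrightarrow>
      (\<exists>f\<in>F. l2norm M (\<lambda>x. kernel_op M (\<lambda>p. complex_of_real (\<kappa> p)) g x - f x) \<le> \<eta>))" ..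
  then show thesis by (intro that[of F]) blast+
qed

context l2_space
begin

context
  fixes v :: "'a \<Rightarrow> real"
  assumes v_nonneg: "\<And>x. 0 \<le> v x" and v_L2: "(\<lambda>x. complex_of_real (v x)) \<in> L2 M"
begin

abbreviation kop where "kop \<kappa> \<equiv> kernel_op M (\<lambda>p. complex_of_real (\<kappa> p))"

lemma v_measurable [measurable]: "v \<in> borel_measurable M"
proof -
  have "(\<lambda>x. Re (complex_of_real (v x))) \<in> borel_measurable M"
    using L2_measurable[OF v_L2] by measurable
  then show ?thesis by simp
qed

lemma order_bounded_kernel_apply:
  assumes \<kappa>: "order_bounded_kernel M v \<kappa>" and g: "g \<in> L2 M" "\<forall>x\<in>space M. cmod (g x) \<le> v x"
  shows "AE x in M. integrable M (\<lambda>y. complex_of_real (\<kappa> (x, y)) * g y)"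
    and "kop \<kappa> g \<in> L2 M"
    and "0 \<le> c \<Longrightarrow> (\<integral>\<^sup>+x. (\<integral>\<^sup>+y. ennreal (\<bar>\<kappa> (x, y)\<bar> * v y) \<partial>M)\<^sup>2 \<partial>M) \<le> ennreal (c\<^sup>2) \<Longrightarrow>
      l2norm M (kop \<kappa> g) \<le> c"
proof -
  have [measurable]: "\<kappa> \<in> borel_measurable (M \<Otimes>\<^sub>M M)"
    and fin: "(\<integral>\<^sup>+x. (\<integral>\<^sup>+y. ennreal (\<bar>\<kappa> (x, y)\<bar> * v y) \<partial>M)\<^sup>2 \<partial>M) < \<infinity>"
    using \<kappa> by (auto simp: order_bounded_kernel_def)
  note [measurable] = L2_measurable[OF g(1)]
  have le: "(\<integral>\<^sup>+y. ennreal (norm (complex_of_real (\<kappa> (x, y)) * g y)) \<partial>M) \<le> (\<integral>\<^sup>+y. ennreal (\<bar>\<kappa> (x, y)\<bar> * v y) \<partial>M)" for x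
    using g(2) by (intro nn_integral_mono ennreal_leI) (simp add: norm_mult mult_left_mono)
  have "AE x in M. (\<integral>\<^sup>+y. ennreal (\<bar>\<kappa> (x, y)\<bar> * v y) \<partial>M)\<^sup>2 \<noteq> \<infinity>"
    using fin by (intro nn_integral_PInf_AE) auto
  then show int: "AE x in M. integrable M (\<lambda>y. complex_of_real (\<kappa> (x, y)) * g y)"
    using AE_space
  proof eventually_elim
    case (elim x)
    then have "(\<integral>\<^sup>+y. ennreal (\<bar>\<kappa> (x, y)\<bar> * v y) \<partial>M) < \<infinity>"
      by (auto simp: power_eq_top_ennreal_iff less_top)
    then show ?case
      using le_less_trans[OF le[of x]] elim(2) unfolding integrable_iff_bounded by simp
  qed
  have b: "(\<integral>\<^sup>+x. ennreal ((cmod (kop \<kappa> g x))\<^sup>2) \<partial>M) \<le> (\<integral>\<^sup>+x. (\<integral>\<^sup>+y. ennreal (\<bar>\<kappa> (x, y)\<bar> * v y) \<partial>M)\<^sup>2 \<partial>M)"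
  proof (intro nn_integral_mono_AE, use int in eventually_elim)
    case (elim x)
    have "ennreal (cmod (kop \<kappa> g x)) \<le> (\<integral>\<^sup>+y. ennreal (\<bar>\<kappa> (x, y)\<bar> * v y) \<partial>M)"
      unfolding kernel_op_def by (rule order_trans[OF integral_norm_bound_ennreal[OF elim] le])
    then have "(ennreal (cmod (kop \<kappa> g x)))\<^sup>2 \<le> (\<integral>\<^sup>+y. ennreal (\<bar>\<kappa> (x, y)\<bar> * v y) \<partial>M)\<^sup>2"
      by (intro power_mono) auto
    then show ?case by (simp add: ennreal_power)
  qed
  show L: "kop \<kappa> g \<in> L2 M"
    unfolding L2_iff using le_less_trans[OF b fin] by (intro conjI kernel_op_measurable) auto
  show "l2norm M (kop \<kappa> g) \<le> c"
    if "0 \<le> c" "(\<integral>\<^sup>+x. (\<integral>\<^sup>+y. ennreal (\<bar>\<kappa> (x, y)\<bar> * v y) \<partial>M)\<^sup>2 \<partial>M) \<le> ennreal (c\<^sup>2)"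
    using order_trans[OF b that(2)] l2norm_le_iff[OF L that(1)] by simp
qed

lemma order_bounded_kernel_lincomb:
  assumes "order_bounded_kernel M v \<kappa>1" "order_bounded_kernel M v \<kappa>2"
  shows "order_bounded_kernel M v (\<lambda>p. \<kappa>1 p + c * \<kappa>2 p)"
proof -
  have [measurable]: "\<kappa>1 \<in> borel_measurable (M \<Otimes>\<^sub>M M)" "\<kappa>2 \<in> borel_measurable (M \<Otimes>\<^sub>M M)"
    and fin: "(\<integral>\<^sup>+x. (\<integral>\<^sup>+y. ennreal (\<bar>\<kappa>1 (x, y)\<bar> * v y) \<partial>M)\<^sup>2 \<partial>M) < \<infinity>"
      "(\<integral>\<^sup>+x. (\<integral>\<^sup>+y. ennreal (\<bar>\<kappa>2 (x, y)\<bar> * v y) \<partial>M)\<^sup>2 \<partial>M) < \<infinity>"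
    using assms by (auto simp: order_bounded_kernel_def)
  let ?I = "\<lambda>\<kappa> x. \<integral>\<^sup>+y. ennreal (\<bar>\<kappa> (x, y)\<bar> * v y) \<partial>M"
  have "(\<integral>\<^sup>+x. (?I (\<lambda>p. \<kappa>1 p + c * \<kappa>2 p) x)\<^sup>2 \<partial>M)
      \<le> (\<integral>\<^sup>+x. 2 * (?I \<kappa>1 x)\<^sup>2 + 2 * (ennreal \<bar>c\<bar>)\<^sup>2 * (?I \<kappa>2 x)\<^sup>2 \<partial>M)"
  proof (rule nn_integral_mono)
    fix x assume x: "x \<in> space M"
    have "?I (\<lambda>p. \<kappa>1 p + c * \<kappa>2 p) x
        \<le> (\<integral>\<^sup>+y. ennreal (\<bar>\<kappa>1 (x, y)\<bar> * v y) + ennreal \<bar>c\<bar> * ennreal (\<bar>\<kappa>2 (x, y)\<bar> * v y) \<partial>M)"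
    proof (rule nn_integral_mono)
      fix y
      have "\<bar>\<kappa>1 (x, y) + c * \<kappa>2 (x, y)\<bar> * v y \<le> (\<bar>\<kappa>1 (x, y)\<bar> + \<bar>c\<bar> * \<bar>\<kappa>2 (x, y)\<bar>) * v y"
        using v_nonneg by (intro mult_right_mono) (auto simp: abs_mult[symmetric])
      then show "ennreal (\<bar>\<kappa>1 (x, y) + c * \<kappa>2 (x, y)\<bar> * v y)
          \<le> ennreal (\<bar>\<kappa>1 (x, y)\<bar> * v y) + ennreal \<bar>c\<bar> * ennreal (\<bar>\<kappa>2 (x, y)\<bar> * v y)"
        using v_nonneg
        by (simp add: ennreal_mult[symmetric] ennreal_plus[symmetric] distrib_right mult.assoc del: ennreal_plus)
    qed
    also have "\<dots> = ?I \<kappa>1 x + ennreal \<bar>c\<bar> * ?I \<kappa>2 x"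
      using x by (subst nn_integral_add) (auto simp: nn_integral_cmult)
    finally have "(?I (\<lambda>p. \<kappa>1 p + c * \<kappa>2 p) x)\<^sup>2 \<le> (?I \<kappa>1 x + ennreal \<bar>c\<bar> * ?I \<kappa>2 x)\<^sup>2"
      by (intro power_mono) auto
    then show "(?I (\<lambda>p. \<kappa>1 p + c * \<kappa>2 p) x)\<^sup>2 \<le> 2 * (?I \<kappa>1 x)\<^sup>2 + 2 * (ennreal \<bar>c\<bar>)\<^sup>2 * (?I \<kappa>2 x)\<^sup>2"
      using ennreal_sum_squared_le[of "?I \<kappa>1 x" "ennreal \<bar>c\<bar> * ?I \<kappa>2 x"]
      by (simp add: power_mult_distrib mult.assoc)
  qed
  also have "\<dots> = 2 * (\<integral>\<^sup>+x. (?I \<kappa>1 x)\<^sup>2 \<partial>M) + 2 * (ennreal \<bar>c\<bar>)\<^sup>2 * (\<integral>\<^sup>+x. (?I \<kappa>2 x)\<^sup>2 \<partial>M)"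
    by (subst nn_integral_add) (auto simp: nn_integral_cmult)
  also have "\<dots> < \<infinity>"
    using fin by (auto simp: ennreal_mult_less_top power_less_top_ennreal)
  finally show ?thesis unfolding order_bounded_kernel_def by auto
qed

lemma kop_lincomb:
  assumes "order_bounded_kernel M v \<kappa>1" "order_bounded_kernel M v \<kappa>2"
    and g: "g \<in> L2 M" "\<forall>x\<in>space M. cmod (g x) \<le> v x"
  shows "AE x in M. kop (\<lambda>p. \<kappa>1 p + c * \<kappa>2 p) g x = kop \<kappa>1 g x + complex_of_real c * kop \<kappa>2 g x"
  using order_bounded_kernel_apply(1)[OF assms(1) g] order_bounded_kernel_apply(1)[OF assms(2) g]
proof eventually_elim
  case (elim x)
  have "kop (\<lambda>p. \<kappa>1 p + c * \<kappa>2 p) g x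
      = (\<integral>y. complex_of_real (\<kappa>1 (x, y)) * g y + complex_of_real c * (complex_of_real (\<kappa>2 (x, y)) * g y) \<partial>M)"
    unfolding kernel_op_def by (simp add: distrib_right mult.assoc)
  also have "\<dots> = kop \<kappa>1 g x + complex_of_real c * kop \<kappa>2 g x"
    unfolding kernel_op_def
    by (subst Bochner_Integration.integral_add[OF elim(1) integrable_mult_right[OF elim(2)]]) simp
  finally show ?case .
qed

lemma order_compact_kernel_lincomb:
  assumes 1: "order_compact_kernel M v \<kappa>1" and 2: "order_compact_kernel M v \<kappa>2"
  shows "order_compact_kernel M v (\<lambda>p. \<kappa>1 p + c * \<kappa>2 p)"
  unfolding order_compact_kernel_def
proof (intro conjI allI impI)
  have b: "order_bounded_kernel M v \<kappa>1" "order_bounded_kernel M v \<kappa>2"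
    using 1 2 by (auto simp: order_compact_kernel_def)
  show b': "order_bounded_kernel M v (\<lambda>p. \<kappa>1 p + c * \<kappa>2 p)" by (rule order_bounded_kernel_lincomb[OF b])
  fix \<eta> :: real assume \<eta>: "0 < \<eta>"
  define \<eta>' where "\<eta>' = \<eta> / (2 * (\<bar>c\<bar> + 1))"
  have \<eta>': "0 < \<eta>'" "\<bar>c\<bar> * \<eta>' \<le> \<eta> / 2" using \<eta> by (auto simp: \<eta>'_def field_simps)
  obtain F1 where F1: "finite F1" "F1 \<subseteq> L2 M"
    "\<And>g. g \<in> L2 M \<Longrightarrow> (\<forall>x\<in>space M. cmod (g x) \<le> v x) \<Longrightarrow> \<exists>f\<in>F1. l2norm M (\<lambda>x. kop \<kappa>1 g x - f x) \<le> \<eta> / 2"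
    using order_compact_kernelE[OF 1 half_gt_zero[OF \<eta>]] by blast
  obtain F2 where F2: "finite F2" "F2 \<subseteq> L2 M"
    "\<And>g. g \<in> L2 M \<Longrightarrow> (\<forall>x\<in>space M. cmod (g x) \<le> v x) \<Longrightarrow> \<exists>f\<in>F2. l2norm M (\<lambda>x. kop \<kappa>2 g x - f x) \<le> \<eta>'"
    using order_compact_kernelE[OF 2 \<eta>'(1)] by blast
  let ?h = "\<lambda>(f1, f2) x. f1 x + complex_of_real c * f2 x"
  let ?F = "?h ` (F1 \<times> F2)"
  have "\<exists>f\<in>?F. l2norm M (\<lambda>x. kop (\<lambda>p. \<kappa>1 p + c * \<kappa>2 p) g x - f x) \<le> \<eta>"
    if g: "g \<in> L2 M" "\<forall>x\<in>space M. cmod (g x) \<le> v x" for g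
  proof -
    obtain f1 where f1: "f1 \<in> F1" "l2norm M (\<lambda>x. kop \<kappa>1 g x - f1 x) \<le> \<eta> / 2" using F1(3)[OF g] by blast
    obtain f2 where f2: "f2 \<in> F2" "l2norm M (\<lambda>x. kop \<kappa>2 g x - f2 x) \<le> \<eta>'" using F2(3)[OF g] by blast
    have L: "f1 \<in> L2 M" "f2 \<in> L2 M" using f1 f2 F1 F2 by auto
    have K: "kop \<kappa>1 g \<in> L2 M" "kop \<kappa>2 g \<in> L2 M" "kop (\<lambda>p. \<kappa>1 p + c * \<kappa>2 p) g \<in> L2 M"
      by (rule order_bounded_kernel_apply(2)[OF b(1) g] order_bounded_kernel_apply(2)[OF b(2) g] order_bounded_kernel_apply(2)[OF b' g])+
    note d1 = L2_diff(1)[OF K(1) L(1)] and d2 = L2_diff(1)[OF K(2) L(2)]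
    note d2' = L2_cmult[OF d2, of "complex_of_real c"]
    have "l2norm M (\<lambda>x. kop (\<lambda>p. \<kappa>1 p + c * \<kappa>2 p) g x - ?h (f1, f2) x)
        = l2norm M (\<lambda>x. (kop \<kappa>1 g x - f1 x) + complex_of_real c * (kop \<kappa>2 g x - f2 x))"
    proof (rule l2norm_cong_AE)
      show "(\<lambda>x. kop (\<lambda>p. \<kappa>1 p + c * \<kappa>2 p) g x - ?h (f1, f2) x) \<in> borel_measurable M"
        using K(3) L by (auto dest!: L2_measurable)
      show "(\<lambda>x. (kop \<kappa>1 g x - f1 x) + complex_of_real c * (kop \<kappa>2 g x - f2 x)) \<in> borel_measurable M"
        using K(1,2) L by (auto dest!: L2_measurable)
      show "AE x in M. kop (\<lambda>p. \<kappa>1 p + c * \<kappa>2 p) g x - ?h (f1, f2) x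
          = (kop \<kappa>1 g x - f1 x) + complex_of_real c * (kop \<kappa>2 g x - f2 x)"
        using kop_lincomb[OF b g, of c] by eventually_elim (simp add: algebra_simps)
    qed
    also have "\<dots> \<le> l2norm M (\<lambda>x. kop \<kappa>1 g x - f1 x) + \<bar>c\<bar> * l2norm M (\<lambda>x. kop \<kappa>2 g x - f2 x)"
      using L2_add(2)[OF d1 d2'(1)] d2'(2) by simp
    also have "\<dots> \<le> \<eta> / 2 + \<bar>c\<bar> * \<eta>'" using f1 f2 by (intro add_mono mult_left_mono) auto
    also have "\<dots> \<le> \<eta>" using \<eta>' by simp
    finally show ?thesis using f1 f2 by (intro bexI[of _ "?h (f1, f2)"]) auto
  qed
  moreover have "?F \<subseteq> L2 M" using F1(2) F2(2) by (auto intro!: L2_add L2_cmult)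
  ultimately show "\<exists>F. finite F \<and> F \<subseteq> L2 M \<and> (\<forall>g\<in>L2 M. (\<forall>x\<in>space M. cmod (g x) \<le> v x) \<longrightarrow>
          (\<exists>f\<in>F. l2norm M (\<lambda>x. kop (\<lambda>p. \<kappa>1 p + c * \<kappa>2 p) g x - f x) \<le> \<eta>))"
    using F1(1) F2(1) by (intro exI[of _ ?F]) auto
qed

text \<open>
  Convergence in the mixed norm \<open>\<integral> (\<integral> |\<kappa>(x,y)| v(y) dy)\<^sup>2 dx\<close> is uniform convergence on the order
  interval.
\<close>

lemma order_compact_kernel_limit:
  assumes b: "order_bounded_kernel M v \<kappa>" and c: "\<And>n. order_compact_kernel M v (\<kappa>' n)"
    and lim: "(\<lambda>n. \<integral>\<^sup>+x. (\<integral>\<^sup>+y. ennreal (\<bar>\<kappa> (x, y) - \<kappa>' n (x, y)\<bar> * v y) \<partial>M)\<^sup>2 \<partial>M) \<longlonglongrightarrow> 0"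
  shows "order_compact_kernel M v \<kappa>"
  unfolding order_compact_kernel_def
proof (intro conjI allI impI b)
  fix \<eta> :: real assume \<eta>: "0 < \<eta>"
  have "0 < ennreal ((\<eta> / 2)\<^sup>2)" using \<eta> by simp
  from order_tendstoD(2)[OF lim this] obtain n where
    n: "(\<integral>\<^sup>+x. (\<integral>\<^sup>+y. ennreal (\<bar>\<kappa> (x, y) - \<kappa>' n (x, y)\<bar> * v y) \<partial>M)\<^sup>2 \<partial>M) < ennreal ((\<eta> / 2)\<^sup>2)"
    by (auto simp: eventually_sequentially)
  have b': "order_bounded_kernel M v (\<kappa>' n)" using c by (auto simp: order_compact_kernel_def)
  obtain F where F: "finite F" "F \<subseteq> L2 M"
    "\<And>g. g \<in> L2 M \<Longrightarrow> (\<forall>x\<in>space M. cmod (g x) \<le> v x) \<Longrightarrow> \<exists>f\<in>F. l2norm M (\<lambda>x. kop (\<kappa>' n) g x - f x) \<le> \<eta> / 2"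
    using order_compact_kernelE[OF c[of n] half_gt_zero[OF \<eta>]] by blast
  have "\<exists>f\<in>F. l2norm M (\<lambda>x. kop \<kappa> g x - f x) \<le> \<eta>"
    if g: "g \<in> L2 M" "\<forall>x\<in>space M. cmod (g x) \<le> v x" for g
  proof -
    obtain f where f: "f \<in> F" "l2norm M (\<lambda>x. kop (\<kappa>' n) g x - f x) \<le> \<eta> / 2" using F(3)[OF g] by blast
    have bd: "order_bounded_kernel M v (\<lambda>p. \<kappa> p + (-1) * \<kappa>' n p)"
      by (rule order_bounded_kernel_lincomb[OF b b'])
    have K: "kop \<kappa> g \<in> L2 M" "kop (\<kappa>' n) g \<in> L2 M" "kop (\<lambda>p. \<kappa> p + (-1) * \<kappa>' n p) g \<in> L2 M" and fL: "f \<in> L2 M"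
      using order_bounded_kernel_apply(2)[OF b g] order_bounded_kernel_apply(2)[OF b' g]
        order_bounded_kernel_apply(2)[OF bd g] f(1) F(2) by blast+
    have "l2norm M (\<lambda>x. kop \<kappa> g x - kop (\<kappa>' n) g x) = l2norm M (kop (\<lambda>p. \<kappa> p + (-1) * \<kappa>' n p) g)"
    proof (rule l2norm_cong_AE)
      show "AE x in M. kop \<kappa> g x - kop (\<kappa>' n) g x = kop (\<lambda>p. \<kappa> p + (-1) * \<kappa>' n p) g x"
        using kop_lincomb[OF b b' g, of "-1"] by eventually_elim simp
    qed (use K in \<open>auto dest!: L2_measurable\<close>)
    also have "\<dots> \<le> \<eta> / 2"
      using n \<eta> by (intro order_bounded_kernel_apply(3)[OF bd g]) auto
    finally have "l2norm M (\<lambda>x. kop \<kappa> g x - kop (\<kappa>' n) g x) \<le> \<eta> / 2" .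
    then have "l2norm M (\<lambda>x. kop \<kappa> g x - f x) \<le> \<eta>"
      using l2norm_diff_triangle[OF K(1,2) fL] f(2) by simp
    then show ?thesis using f(1) by blast
  qed
  then show "\<exists>F. finite F \<and> F \<subseteq> L2 M \<and> (\<forall>g\<in>L2 M. (\<forall>x\<in>space M. cmod (g x) \<le> v x) \<longrightarrow>
          (\<exists>f\<in>F. l2norm M (\<lambda>x. kop \<kappa> g x - f x) \<le> \<eta>))"
    using F(1,2) by blast
qed

lemma order_bounded_kernel_mono:
  assumes "order_bounded_kernel M v \<kappa>" "\<kappa>' \<in> borel_measurable (M \<Otimes>\<^sub>M M)"
    "\<And>p. p \<in> space (M \<Otimes>\<^sub>M M) \<Longrightarrow> \<bar>\<kappa>' p\<bar> \<le> \<bar>\<kappa> p\<bar>"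
  shows "order_bounded_kernel M v \<kappa>'"
proof -
  have "(\<integral>\<^sup>+x. (\<integral>\<^sup>+y. ennreal (\<bar>\<kappa>' (x, y)\<bar> * v y) \<partial>M)\<^sup>2 \<partial>M)
      \<le> (\<integral>\<^sup>+x. (\<integral>\<^sup>+y. ennreal (\<bar>\<kappa> (x, y)\<bar> * v y) \<partial>M)\<^sup>2 \<partial>M)"
    using assms(3) v_nonneg
    by (intro nn_integral_mono power_mono) (auto intro!: ennreal_leI mult_right_mono simp: space_pair_measure)
  then show ?thesis using assms(1,2) unfolding order_bounded_kernel_def by auto
qed

lemma order_compact_kernel_pointwise_limit:
  assumes b: "order_bounded_kernel M v \<kappa>" and c: "\<And>n. order_compact_kernel M v (\<kappa>' n)"
    and dom: "\<And>n p. p \<in> space (M \<Otimes>\<^sub>M M) \<Longrightarrow> \<bar>\<kappa> p - \<kappa>' n p\<bar> \<le> \<bar>\<kappa> p\<bar>"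
    and lim: "\<And>p. p \<in> space (M \<Otimes>\<^sub>M M) \<Longrightarrow> (\<lambda>n. \<kappa>' n p) \<longlonglongrightarrow> \<kappa> p"
  shows "order_compact_kernel M v \<kappa>"
proof (rule order_compact_kernel_limit[OF b c])
  have [measurable]: "\<kappa> \<in> borel_measurable (M \<Otimes>\<^sub>M M)" "\<kappa>' n \<in> borel_measurable (M \<Otimes>\<^sub>M M)" for n
    using b c by (auto simp: order_bounded_kernel_def order_compact_kernel_def)
  define I where "I x = (\<integral>\<^sup>+y. ennreal (\<bar>\<kappa> (x, y)\<bar> * v y) \<partial>M)" for x
  define J where "J n x = (\<integral>\<^sup>+y. ennreal (\<bar>\<kappa> (x, y) - \<kappa>' n (x, y)\<bar> * v y) \<partial>M)" for n x
  have [measurable]: "I \<in> borel_measurable M" "J n \<in> borel_measurable M" for n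
    unfolding I_def J_def by measurable
  have I2: "(\<integral>\<^sup>+x. (I x)\<^sup>2 \<partial>M) < \<infinity>" using b unfolding I_def order_bounded_kernel_def by simp
  have JI: "J n x \<le> I x" if "x \<in> space M" for n x
    unfolding J_def I_def using dom v_nonneg that
    by (intro nn_integral_mono ennreal_leI mult_right_mono) (auto simp: space_pair_measure)
  have "AE x in M. (I x)\<^sup>2 \<noteq> \<infinity>" using I2 by (intro nn_integral_PInf_AE) auto
  then have "AE x in M. (\<lambda>n. I x * J n x) \<longlonglongrightarrow> 0"
    using AE_space
  proof eventually_elim
    case (elim x)
    then have fin: "I x < \<infinity>" by (auto simp: power_eq_top_ennreal_iff less_top)
    have "(\<lambda>n. J n x) \<longlonglongrightarrow> (\<integral>\<^sup>+y. 0 \<partial>M)"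
      unfolding J_def
    proof (rule nn_integral_dominated_convergence[where w = "\<lambda>y. ennreal (\<bar>\<kappa> (x, y)\<bar> * v y)"])
      show "AE y in M. ennreal (\<bar>\<kappa> (x, y) - \<kappa>' n (x, y)\<bar> * v y) \<le> ennreal (\<bar>\<kappa> (x, y)\<bar> * v y)" for n
        using dom v_nonneg elim(2) by (intro AE_I2 ennreal_leI mult_right_mono) (auto simp: space_pair_measure)
      show "AE y in M. (\<lambda>n. ennreal (\<bar>\<kappa> (x, y) - \<kappa>' n (x, y)\<bar> * v y)) \<longlonglongrightarrow> 0"
      proof (rule AE_I2)
        fix y assume "y \<in> space M"
        then have "(\<lambda>n. \<kappa>' n (x, y)) \<longlonglongrightarrow> \<kappa> (x, y)" using elim(2) lim by (simp add: space_pair_measure)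
        then have "(\<lambda>n. ennreal (\<bar>\<kappa> (x, y) - \<kappa>' n (x, y)\<bar> * v y)) \<longlonglongrightarrow> ennreal (\<bar>\<kappa> (x, y) - \<kappa> (x, y)\<bar> * v y)"
          by (intro tendsto_intros)
        then show "(\<lambda>n. ennreal (\<bar>\<kappa> (x, y) - \<kappa>' n (x, y)\<bar> * v y)) \<longlonglongrightarrow> 0" by simp
      qed
    qed (use elim(2) fin in \<open>auto simp: I_def\<close>)
    then have "(\<lambda>n. I x * J n x) \<longlonglongrightarrow> I x * 0" using fin by (intro ennreal_tendsto_cmult) auto
    then show ?case by simp
  qed
  moreover have "(\<integral>\<^sup>+x. I x * I x \<partial>M) < \<infinity>" using I2 by (simp add: power2_eq_square)
  ultimately have "(\<lambda>n. \<integral>\<^sup>+x. I x * J n x \<partial>M) \<longlonglongrightarrow> (\<integral>\<^sup>+x. 0 \<partial>M)"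
    using JI by (intro nn_integral_dominated_convergence[where w = "\<lambda>x. I x * I x"]) (auto intro!: mult_left_mono)
  then have lim0: "(\<lambda>n. \<integral>\<^sup>+x. I x * J n x \<partial>M) \<longlonglongrightarrow> 0" by simp
  show "(\<lambda>n. \<integral>\<^sup>+x. (\<integral>\<^sup>+y. ennreal (\<bar>\<kappa> (x, y) - \<kappa>' n (x, y)\<bar> * v y) \<partial>M)\<^sup>2 \<partial>M) \<longlonglongrightarrow> 0"
  proof (rule tendsto_sandwich[OF _ _ tendsto_const lim0])
    show "eventually (\<lambda>n. (\<integral>\<^sup>+x. (\<integral>\<^sup>+y. ennreal (\<bar>\<kappa> (x, y) - \<kappa>' n (x, y)\<bar> * v y) \<partial>M)\<^sup>2 \<partial>M)
        \<le> (\<integral>\<^sup>+x. I x * J n x \<partial>M)) sequentially"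
      unfolding J_def[symmetric] power2_eq_square using JI
      by (intro always_eventually allI nn_integral_mono mult_right_mono) auto
  qed simp
qed

lemma order_compact_kernel_cong:
  assumes "order_compact_kernel M v \<kappa>" "\<kappa> = \<kappa>'"
  shows "order_compact_kernel M v \<kappa>'"
  using assms by simp

lemma nn_integral_v_finite:
  assumes [measurable]: "E \<in> sets M" and "emeasure M E < \<infinity>"
  shows "(\<integral>\<^sup>+x. ennreal (v x) * indicator E x \<partial>M) < \<infinity>"
proof -
  have "(\<integral>\<^sup>+x. ennreal (v x) * indicator E x \<partial>M)\<^sup>2
      \<le> (\<integral>\<^sup>+x. (ennreal (v x))\<^sup>2 \<partial>M) * (\<integral>\<^sup>+x. (indicator E x)\<^sup>2 \<partial>M)"
    by (rule Cauchy_Schwarz_nn_integral) measurable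
  also have "(\<integral>\<^sup>+x. (ennreal (v x))\<^sup>2 \<partial>M) = (\<integral>\<^sup>+x. ennreal ((cmod (complex_of_real (v x)))\<^sup>2) \<partial>M)"
    using v_nonneg by (simp add: ennreal_power)
  also have "(\<integral>\<^sup>+x. (indicator E x)\<^sup>2 \<partial>M) = (\<integral>\<^sup>+x. indicator E x \<partial>M)"
    by (intro nn_integral_cong) (simp add: indicator_def)
  also have "\<dots> = emeasure M E" by (rule nn_integral_indicator) fact
  finally have "(\<integral>\<^sup>+x. ennreal (v x) * indicator E x \<partial>M)\<^sup>2
      \<le> (\<integral>\<^sup>+x. ennreal ((cmod (complex_of_real (v x)))\<^sup>2) \<partial>M) * emeasure M E" .
  moreover have "(\<integral>\<^sup>+x. ennreal ((cmod (complex_of_real (v x)))\<^sup>2) \<partial>M) * emeasure M E < \<infinity>"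
    using v_L2 assms(2) by (auto simp: L2_iff ennreal_mult_less_top)
  ultimately have "(\<integral>\<^sup>+x. ennreal (v x) * indicator E x \<partial>M)\<^sup>2 < \<infinity>" by (rule le_less_trans)
  then show ?thesis by (simp add: power_less_top_ennreal)
qed

lemma order_bounded_kernel_square:
  assumes [measurable]: "E \<in> sets M" and E: "emeasure M E < \<infinity>"
  shows "order_bounded_kernel M v (indicator (E \<times> E))"
proof -
  let ?c = "\<integral>\<^sup>+y. ennreal (v y) * indicator E y \<partial>M"
  have "(\<integral>\<^sup>+x. (\<integral>\<^sup>+y. ennreal (\<bar>indicator (E \<times> E) (x, y)\<bar> * v y) \<partial>M)\<^sup>2 \<partial>M) = (\<integral>\<^sup>+x. ?c\<^sup>2 * indicator E x \<partial>M)"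
  proof (rule nn_integral_cong)
    fix x
    have "(\<integral>\<^sup>+y. ennreal (\<bar>indicator (E \<times> E) (x, y)\<bar> * v y) \<partial>M) = (if x \<in> E then ?c else 0)"
      by (auto intro!: nn_integral_cong simp: indicator_def)
    then show "(\<integral>\<^sup>+y. ennreal (\<bar>indicator (E \<times> E) (x, y)\<bar> * v y) \<partial>M)\<^sup>2 = ?c\<^sup>2 * indicator E x"
      by (simp add: indicator_def)
  qed
  also have "\<dots> = ?c\<^sup>2 * emeasure M E" by (rule nn_integral_cmult_indicator) simp
  also have "\<dots> < \<infinity>"
    using nn_integral_v_finite[OF assms] E by (auto simp: ennreal_mult_less_top power_less_top_ennreal)
  finally show ?thesis unfolding order_bounded_kernel_def by auto
qed

text \<open>
  The operator has rank one: the image consists of bounded multiples of \<open>1\<^sub>A\<close>.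
\<close>

lemma order_compact_kernel_rectangle:
  assumes [measurable]: "A \<in> sets M" "B \<in> sets M" "E \<in> sets M" and E: "emeasure M E < \<infinity>" "A \<subseteq> E" "B \<subseteq> E"
  shows "order_compact_kernel M v (indicator (A \<times> B))"
  unfolding order_compact_kernel_def
proof (intro conjI allI impI)
  show b: "order_bounded_kernel M v (indicator (A \<times> B))"
    by (rule order_bounded_kernel_mono[OF order_bounded_kernel_square[OF _ E(1)]])
       (use E in \<open>auto simp: indicator_def\<close>)
  fix \<eta> :: real assume \<eta>: "0 < \<eta>"
  have A_fin: "emeasure M A < \<infinity>" using emeasure_mono[OF E(2), of M] E(1) by auto
  define R where "R = enn2real (\<integral>\<^sup>+y. ennreal (v y) * indicator E y \<partial>M)"
  define m where "m = sqrt (measure M A)"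
  define r where "r = \<eta> / (m + 1)"
  have m: "0 \<le> m" unfolding m_def by simp
  have r: "0 < r" "r * m \<le> \<eta>" using \<eta> m unfolding r_def by (auto simp: field_simps)
  obtain Z where Z: "finite Z" "cball (0::complex) R \<subseteq> (\<Union>z\<in>Z. ball z r)"
    using compact_cball[of "0::complex" R] r(1) unfolding compact_eq_totally_bounded by blast
  define F where "F = (\<lambda>z x. z * complex_of_real (indicator A x)) ` Z"
  have ind_L2: "(\<lambda>x. complex_of_real (indicator A x)) \<in> L2 M" "l2norm M (\<lambda>x. complex_of_real (indicator A x)) = m"
  proof -
    have eq: "(cmod (complex_of_real (indicator A x)))\<^sup>2 = indicat_real A x" for x by (simp add: indicator_def)
    have "integrable M (\<lambda>x. (cmod (complex_of_real (indicator A x)))\<^sup>2)"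
      unfolding eq using A_fin by (intro integrable_real_indicator) auto
    then show "(\<lambda>x. complex_of_real (indicator A x)) \<in> L2 M"
      unfolding L2_def by auto
    show "l2norm M (\<lambda>x. complex_of_real (indicator A x)) = m"
      unfolding l2norm_def eq m_def by simp
  qed
  have "\<exists>f\<in>F. l2norm M (\<lambda>x. kop (indicator (A \<times> B)) g x - f x) \<le> \<eta>"
    if g: "g \<in> L2 M" "\<forall>x\<in>space M. cmod (g x) \<le> v x" for g
  proof -
    note [measurable] = L2_measurable[OF g(1)]
    define w where "w = (\<integral>y. complex_of_real (indicator B y) * g y \<partial>M)"
    have nn: "(\<integral>\<^sup>+y. ennreal (norm (complex_of_real (indicator B y) * g y)) \<partial>M) \<le> (\<integral>\<^sup>+y. ennreal (v y) * indicator E y \<partial>M)"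
      using g(2) E(3) v_nonneg by (intro nn_integral_mono) (auto simp: indicator_def intro!: ennreal_leI)
    have fin: "(\<integral>\<^sup>+y. ennreal (v y) * indicator E y \<partial>M) < \<infinity>" by (rule nn_integral_v_finite[OF _ E(1)]) simp
    have "integrable M (\<lambda>y. complex_of_real (indicator B y) * g y)"
      unfolding integrable_iff_bounded using le_less_trans[OF nn fin] by simp
    then have "ennreal (cmod w) \<le> (\<integral>\<^sup>+y. ennreal (v y) * indicator E y \<partial>M)"
      unfolding w_def by (rule order_trans[OF integral_norm_bound_ennreal nn])
    also have "\<dots> = ennreal R" using fin unfolding R_def by simp
    finally have "cmod w \<le> R" unfolding R_def by simp
    then have "w \<in> cball 0 R" by simp
    then obtain z where z: "z \<in> Z" "dist z w < r" using Z(2) by auto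
    have eq: "kop (indicator (A \<times> B)) g x - z * complex_of_real (indicator A x) = (w - z) * complex_of_real (indicator A x)" for x
    proof -
      have "kop (indicator (A \<times> B)) g x = complex_of_real (indicator A x) * w"
        unfolding kernel_op_def w_def by (cases "x \<in> A") (auto simp: indicator_times)
      then show ?thesis by (simp add: algebra_simps)
    qed
    have "l2norm M (\<lambda>x. kop (indicator (A \<times> B)) g x - z * complex_of_real (indicator A x)) = cmod (w - z) * m"
      unfolding eq using L2_cmult(2)[OF ind_L2(1)] ind_L2(2) by simp
    also have "\<dots> \<le> r * m" using z(2) m by (intro mult_right_mono) (auto simp: dist_norm norm_minus_commute)
    also note r(2)
    finally show ?thesis
      using z(1) unfolding F_def by (intro bexI[of _ "\<lambda>x. z * complex_of_real (indicator A x)"]) auto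
  qed
  moreover have "F \<subseteq> L2 M" unfolding F_def using L2_cmult(1)[OF ind_L2(1)] by auto
  ultimately show "\<exists>F. finite F \<and> F \<subseteq> L2 M \<and> (\<forall>g\<in>L2 M. (\<forall>x\<in>space M. cmod (g x) \<le> v x) \<longrightarrow>
          (\<exists>f\<in>F. l2norm M (\<lambda>x. kop (indicator (A \<times> B)) g x - f x) \<le> \<eta>))"
    using Z(1) unfolding F_def by blast
qed

lemma order_compact_kernel_zero: "order_compact_kernel M v (\<lambda>p. 0)"
proof (rule order_compact_kernel_cong)
  show "order_compact_kernel M v (indicator ({} \<times> {}))"
    by (rule order_compact_kernel_rectangle[of "{}" "{}" "{}"]) auto
qed (simp add: fun_eq_iff)

lemma order_compact_kernel_indicator:
  assumes S: "S \<in> sets (M \<Otimes>\<^sub>M M)" and E[measurable]: "E \<in> sets M" and fin: "emeasure M E < \<infinity>"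
  shows "order_compact_kernel M v (indicator (S \<inter> E \<times> E))"
proof -
  define G where "G = {a \<times> b | a b. a \<in> sets M \<and> b \<in> sets M}"
  have G: "Int_stable G" "G \<subseteq> Pow (space M \<times> space M)"
    unfolding G_def by (auto simp: Int_stable_pair_measure_generator pair_measure_closed)
  have sig: "sigma_sets (space M \<times> space M) G = sets (M \<Otimes>\<^sub>M M)"
    unfolding G_def by (rule sets_pair_measure[symmetric])
  have EE: "order_compact_kernel M v (indicator (E \<times> E))"
    by (rule order_compact_kernel_rectangle[OF E E E fin]) auto
  have "S \<in> sigma_sets (space M \<times> space M) G" using S sig by simp
  with G show ?thesis
  proof (induction rule: sigma_sets_induct_disjoint)
    case (basic A)
    then obtain a b where ab: "A = a \<times> b" "a \<in> sets M" "b \<in> sets M" unfolding G_def by auto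
    have "A \<inter> E \<times> E = (a \<inter> E) \<times> (b \<inter> E)" unfolding ab by auto
    then show ?case using ab order_compact_kernel_rectangle[of "a \<inter> E" "b \<inter> E" E] fin by simp
  next
    case empty
    show ?case by (rule order_compact_kernel_cong[OF order_compact_kernel_zero]) (simp add: fun_eq_iff)
  next
    case (compl A)
    have "(\<lambda>p. indicator (E \<times> E) p + (-1) * indicator (A \<inter> E \<times> E) p) = (indicator ((space M \<times> space M - A) \<inter> E \<times> E) :: _ \<Rightarrow> real)"
      using sets.sets_into_space[OF E] by (auto simp: fun_eq_iff indicator_def)
    then show ?case by (rule order_compact_kernel_cong[OF order_compact_kernel_lincomb[OF EE compl(2)]])
  next
    case (union A)
    have [measurable]: "A i \<in> sets (M \<Otimes>\<^sub>M M)" for i using union(2) sig by auto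
    have part: "order_compact_kernel M v (indicator ((\<Union>i<n. A i) \<inter> E \<times> E))" for n :: nat
    proof (induction n)
      case 0
      show ?case by (rule order_compact_kernel_cong[OF order_compact_kernel_zero]) (simp add: fun_eq_iff)
    next
      case (Suc n)
      have "A i \<inter> A n = {}" if "i < n" for i
        by (rule disjoint_family_onD[OF union(1)]) (use that in simp_all)
      then have dis: "(\<Union>i<n. A i) \<inter> A n = {}" by blast
      have "(\<Union>i<Suc n. A i) = (\<Union>i<n. A i) \<union> A n" by (auto simp: less_Suc_eq)
      then have "(\<lambda>p. indicator ((\<Union>i<n. A i) \<inter> E \<times> E) p + 1 * indicator (A n \<inter> E \<times> E) p)
          = (indicator ((\<Union>i<Suc n. A i) \<inter> E \<times> E) :: _ \<Rightarrow> real)"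
        using dis by (intro ext) (simp only: indicator_def, fastforce)
      then show ?case by (rule order_compact_kernel_cong[OF order_compact_kernel_lincomb[OF Suc union(3)]])
    qed
    have b: "order_bounded_kernel M v (indicator ((\<Union>i. A i) \<inter> E \<times> E))"
      by (rule order_bounded_kernel_mono[OF order_bounded_kernel_square[OF _ fin]])
         (auto simp: indicator_def)
    show ?case
    proof (rule order_compact_kernel_pointwise_limit[OF b part])
      fix p
      show "(\<lambda>n. indicator ((\<Union>i<n. A i) \<inter> E \<times> E) p) \<longlonglongrightarrow> (indicator ((\<Union>i. A i) \<inter> E \<times> E) p :: real)"
      proof (cases "p \<in> (\<Union>i. A i)")
        case True
        then obtain j where j: "p \<in> A j" by blast
        have "eventually (\<lambda>n. indicator ((\<Union>i<n. A i) \<inter> E \<times> E) p = (indicator ((\<Union>i. A i) \<inter> E \<times> E) p :: real)) sequentially"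
          using j by (intro eventually_sequentiallyI[of "Suc j"]) (auto simp: indicator_def)
        then show ?thesis by (rule tendsto_eventually)
      qed (auto simp: indicator_def)
    qed (auto simp: indicator_def)
  qed
qed

text \<open>
  A monotone class argument from rectangles to indicator functions to nonnegative functions, first on
  squares of finite measure and then in the limit over an exhaustion by such squares. All limits are
  dominated by the kernel itself.
\<close>

lemma order_compact_nonneg_kernel:
  assumes k: "k \<in> borel_measurable (M \<Otimes>\<^sub>M M)" "\<And>p. 0 \<le> k p" and b: "order_bounded_kernel M v k"
  shows "order_compact_kernel M v k"
proof -
  obtain A :: "nat \<Rightarrow> 'a set" where A: "range A \<subseteq> sets M" "(\<Union>i. A i) = space M"
    "\<And>i. emeasure M (A i) \<noteq> \<infinity>" "incseq A"
    using sigma_finite_incseq by metis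
  have [measurable]: "A i \<in> sets M" for i using A(1) by auto
  note zero = order_compact_kernel_zero
  have cut: "order_bounded_kernel M v (\<lambda>p. indicator (E \<times> E) p * \<kappa> p) \<longrightarrow>
      order_compact_kernel M v (\<lambda>p. indicator (E \<times> E) p * \<kappa> p)"
    if "\<kappa> \<in> borel_measurable (M \<Otimes>\<^sub>M M)" "\<And>p. 0 \<le> \<kappa> p" and E[measurable]: "E \<in> sets M" and fin: "emeasure M E < \<infinity>" for \<kappa> E
    using that(1,2)
  proof (induction \<kappa> rule: borel_measurable_induct_real)
    case (set S)
    have "indicator (S \<inter> E \<times> E) = (\<lambda>p. indicator (E \<times> E) p * indicator S p :: real)"
      by (auto simp: fun_eq_iff indicator_def)
    then show ?case using order_compact_kernel_indicator[OF set E fin] by simp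
  next
    case (mult \<kappa> c)
    show ?case
    proof (cases "c = 0")
      case False
      show ?thesis
      proof
        assume b: "order_bounded_kernel M v (\<lambda>p. indicator (E \<times> E) p * (c * \<kappa> p))"
        have "order_bounded_kernel M v (\<lambda>p. 0 + (1 / c) * (indicator (E \<times> E) p * (c * \<kappa> p)))"
          using zero b by (intro order_bounded_kernel_lincomb) (auto simp: order_compact_kernel_def)
        moreover have "(\<lambda>p. 0 + (1 / c) * (indicator (E \<times> E) p * (c * \<kappa> p))) = (\<lambda>p. indicator (E \<times> E) p * \<kappa> p)"
          using False by (auto simp: fun_eq_iff)
        ultimately have "order_compact_kernel M v (\<lambda>p. indicator (E \<times> E) p * \<kappa> p)" using mult by simp
        then have "order_compact_kernel M v (\<lambda>p. 0 + c * (indicator (E \<times> E) p * \<kappa> p))"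
          by (rule order_compact_kernel_lincomb[OF zero])
        then show "order_compact_kernel M v (\<lambda>p. indicator (E \<times> E) p * (c * \<kappa> p))"
          by (rule order_compact_kernel_cong) (auto simp: fun_eq_iff)
      qed
    qed (simp add: zero)
  next
    case (add \<kappa>1 \<kappa>2)
    note [measurable] = add.hyps(1,3)
    show ?case
    proof
      assume b: "order_bounded_kernel M v (\<lambda>p. indicator (E \<times> E) p * (\<kappa>2 p + \<kappa>1 p))"
      have "order_bounded_kernel M v (\<lambda>p. indicator (E \<times> E) p * \<kappa>2 p)"
        "order_bounded_kernel M v (\<lambda>p. indicator (E \<times> E) p * \<kappa>1 p)"
        by (rule order_bounded_kernel_mono[OF b], measurable, simp add: abs_mult mult_left_mono add.hyps(2,4))+
      then have "order_compact_kernel M v (\<lambda>p. indicator (E \<times> E) p * \<kappa>2 p + 1 * (indicator (E \<times> E) p * \<kappa>1 p))"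
        using add by (intro order_compact_kernel_lincomb) auto
      then show "order_compact_kernel M v (\<lambda>p. indicator (E \<times> E) p * (\<kappa>2 p + \<kappa>1 p))"
        by (rule order_compact_kernel_cong) (auto simp: fun_eq_iff distrib_left)
    qed
  next
    case (seq U)
    note [measurable] = seq.hyps(1)
    show ?case
    proof
      assume b: "order_bounded_kernel M v (\<lambda>p. indicator (E \<times> E) p * \<kappa> p)"
      have le: "U i p \<le> \<kappa> p" if "p \<in> space (M \<Otimes>\<^sub>M M)" for i p
        using seq.hyps(3) by (intro incseq_le[OF _ seq.hyps(4)[OF that]] incseq_SucI) (simp add: incseq_SucD le_funD)
      show "order_compact_kernel M v (\<lambda>p. indicator (E \<times> E) p * \<kappa> p)"
      proof (rule order_compact_kernel_pointwise_limit[OF b])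
        show "order_compact_kernel M v (\<lambda>p. indicator (E \<times> E) p * U n p)" for n
        proof (rule seq.IH[of n, THEN mp], rule order_bounded_kernel_mono[OF b])
          show "\<bar>indicator (E \<times> E) p * U n p\<bar> \<le> \<bar>indicator (E \<times> E) p * \<kappa> p\<bar>" if "p \<in> space (M \<Otimes>\<^sub>M M)" for p
            using le[OF that, of n] seq.hyps(2)[of n p] by (auto simp: indicator_def)
        qed measurable
        fix p assume p: "p \<in> space (M \<Otimes>\<^sub>M M)"
        show "\<bar>indicator (E \<times> E) p * \<kappa> p - indicator (E \<times> E) p * U n p\<bar> \<le> \<bar>indicator (E \<times> E) p * \<kappa> p\<bar>" for n
          using le[OF p, of n] seq.hyps(2)[of n p] by (auto simp: indicator_def)
        show "(\<lambda>n. indicator (E \<times> E) p * U n p) \<longlonglongrightarrow> indicator (E \<times> E) p * \<kappa> p"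
          using seq.hyps(4)[OF p] by (intro tendsto_intros)
      qed
    qed
  qed
  note [measurable] = k(1)
  show ?thesis
  proof (rule order_compact_kernel_pointwise_limit[OF b])
    fix n :: nat
    have "order_bounded_kernel M v (\<lambda>p. indicator (A n \<times> A n) p * k p)"
      by (rule order_bounded_kernel_mono[OF b]) (auto simp: indicator_def)
    then show "order_compact_kernel M v (\<lambda>p. indicator (A n \<times> A n) p * k p)"
      using cut[OF k, of "A n"] A(3)[of n] by (simp add: less_top)
  next
    fix p assume p: "p \<in> space (M \<Otimes>\<^sub>M M)"
    show "\<bar>k p - indicator (A n \<times> A n) p * k p\<bar> \<le> \<bar>k p\<bar>" for n by (auto simp: indicator_def)
    have "fst p \<in> (\<Union>i. A i)" "snd p \<in> (\<Union>i. A i)" using p A(2) by (auto simp: space_pair_measure)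
    then obtain i j where "fst p \<in> A i" "snd p \<in> A j" by blast
    moreover have "A i \<subseteq> A n" "A j \<subseteq> A n" if "max i j \<le> n" for n
      using that A(4) unfolding incseq_def by auto
    ultimately have "p \<in> A n \<times> A n" if "max i j \<le> n" for n
      using that by (cases p) auto
    then have "eventually (\<lambda>n. indicator (A n \<times> A n) p * k p = k p) sequentially"
      by (intro eventually_sequentiallyI[of "max i j"]) (auto simp: indicator_def)
    then show "(\<lambda>n. indicator (A n \<times> A n) p * k p) \<longlonglongrightarrow> k p" by (rule tendsto_eventually)
  qed
qed

lemma nonneg_kernel_order_compact:
  assumes k: "nonneg_kernel M k T" and \<eta>: "0 < \<eta>"
  obtains F where "finite F" "F \<subseteq> L2 M"
    "\<And>g. g \<in> L2 M \<Longrightarrow> (\<And>x. x \<in> space M \<Longrightarrow> cmod (g x) \<le> v x) \<Longrightarrow> \<exists>f\<in>F. l2norm M (\<lambda>x. T g x - f x) \<le> \<eta>"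
proof -
  note kD = nonneg_kernelD[OF k]
  have "(\<integral>\<^sup>+x. (\<integral>\<^sup>+y. ennreal (\<bar>k (x, y)\<bar> * v y) \<partial>M)\<^sup>2 \<partial>M)
      = (\<integral>\<^sup>+x. (\<integral>\<^sup>+y. ennreal (k (x, y)) * ennreal (cmod (complex_of_real (v y))) \<partial>M)\<^sup>2 \<partial>M)"
    using kD(2) v_nonneg by (simp add: ennreal_mult)
  also have "\<dots> \<le> ennreal ((l2_opnorm M T * l2norm M (\<lambda>x. complex_of_real (v x)))\<^sup>2)"
    by (rule kernel_bound_imp_sq[OF kernel_bound_opnorm[OF k] kD(1) opnorm_nonneg[OF k] v_L2])
  also have "\<dots> < \<infinity>" by simp
  finally have "order_bounded_kernel M v k" using kD(1) by (simp add: order_bounded_kernel_def)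
  then have compact: "order_compact_kernel M v k" by (rule order_compact_nonneg_kernel[OF kD(1,2)])
  obtain F where F: "finite F" "F \<subseteq> L2 M"
    "\<And>g. g \<in> L2 M \<Longrightarrow> (\<forall>x\<in>space M. cmod (g x) \<le> v x) \<Longrightarrow> \<exists>f\<in>F. l2norm M (\<lambda>x. kop k g x - f x) \<le> \<eta>"
    using order_compact_kernelE[OF compact \<eta>] by blast
  show thesis
  proof (rule that[OF F(1,2)])
    fix g assume g: "g \<in> L2 M" "\<And>x. x \<in> space M \<Longrightarrow> cmod (g x) \<le> v x"
    obtain f where f: "f \<in> F" "l2norm M (\<lambda>x. kop k g x - f x) \<le> \<eta>" using F(3)[OF g(1)] g(2) by blast
    note [measurable] = kD(1) L2_measurable[OF g(1)] L2_measurable[OF kD(3)[OF g(1)]]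
    have [measurable]: "f \<in> borel_measurable M" using f F(2) by (auto dest: L2_measurable)
    have [measurable]: "kop k g \<in> borel_measurable M" by (rule kernel_op_measurable) measurable
    have "AE x in M. T g x - f x = kop k g x - f x"
      using kD(5)[OF g(1)] by eventually_elim (simp add: kernel_op_def)
    then have "l2norm M (\<lambda>x. T g x - f x) = l2norm M (\<lambda>x. kop k g x - f x)"
      by (intro l2norm_cong_AE) auto
    then show "\<exists>f\<in>F. l2norm M (\<lambda>x. T g x - f x) \<le> \<eta>" using f by (intro bexI[of _ f]) auto
  qed
qed

end

end

section \<open>The measure of noncompactness\<close>

definition mnc_admissible :: "'a measure \<Rightarrow> 'a l2op \<Rightarrow> real \<Rightarrow> bool" where
  "mnc_admissible M T \<delta> \<longleftrightarrow> 0 < \<delta> \<and> (\<exists>F. finite F \<and> F \<subseteq> L2 M \<and>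
     (\<forall>f\<in>L2 M. l2norm M f \<le> 1 \<longrightarrow> (\<exists>g\<in>F. l2norm M (\<lambda>x. T f x - g x) \<le> \<delta>)))"

text \<open>
  The size of \<open>E\<close> is measured by the finite measure with density \<open>u\<^sup>2\<close>, which for \<open>u > 0\<close> has the same null
  sets as \<open>\<mu>\<close>; so every element of \<open>L\<^sup>2\<close> has small norm on small sets.
\<close>

definition small_rows :: "'a measure \<Rightarrow> ('a \<Rightarrow> real) \<Rightarrow> ('a \<times> 'a \<Rightarrow> real) \<Rightarrow> real \<Rightarrow> bool" where
  "small_rows M u k C \<longleftrightarrow> (\<exists>e>0. \<forall>E\<in>sets M. (\<integral>\<^sup>+x. ennreal ((u x)\<^sup>2) * indicator E x \<partial>M) \<le> ennreal e \<longrightarrow>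
     kernel_bound M (\<lambda>p. indicator E (fst p) * k p) C)"

definition small_cols :: "'a measure \<Rightarrow> ('a \<Rightarrow> real) \<Rightarrow> ('a \<times> 'a \<Rightarrow> real) \<Rightarrow> real \<Rightarrow> bool" where
  "small_cols M u k C \<longleftrightarrow> (\<exists>e>0. \<forall>E\<in>sets M. (\<integral>\<^sup>+x. ennreal ((u x)\<^sup>2) * indicator E x \<partial>M) \<le> ennreal e \<longrightarrow>
     kernel_bound M (\<lambda>p. indicator E (snd p) * k p) C)"

lemma hausdorff_mnc_alt: "hausdorff_mnc M T = Inf {\<delta>. mnc_admissible M T \<delta>}"
  by (simp add: hausdorff_mnc_def mnc_admissible_def)

lemma hausdorff_mnc_le: "mnc_admissible M T \<delta> \<Longrightarrow> hausdorff_mnc M T \<le> \<delta>"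
  unfolding hausdorff_mnc_alt
  by (rule cInf_lower) (auto intro!: bdd_belowI[of _ 0] simp: mnc_admissible_def)

lemma mnc_admissible_opnorm:
  assumes "l2_bounded_op M T"
  shows "mnc_admissible M T (l2_opnorm M T + 1)"
  unfolding mnc_admissible_def
proof (intro conjI exI[of _ "{\<lambda>x. 0}"])
  show "0 < l2_opnorm M T + 1" using l2_opnorm_nonneg[OF assms] by simp
  show "\<forall>f\<in>L2 M. l2norm M f \<le> 1 \<longrightarrow> (\<exists>g\<in>{\<lambda>x. 0}. l2norm M (\<lambda>x. T f x - g x) \<le> l2_opnorm M T + 1)"
    using l2norm_le_opnorm_unit[OF assms] by (auto intro!: add_increasing2)
qed auto

lemma hausdorff_mnc_nonneg:
  assumes "l2_bounded_op M T"
  shows "0 \<le> hausdorff_mnc M T"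
  unfolding hausdorff_mnc_alt
  by (rule cInf_greatest) (use mnc_admissible_opnorm[OF assms] in \<open>auto simp: mnc_admissible_def\<close>)

lemma hausdorff_mnc_less:
  assumes "l2_bounded_op M T" "hausdorff_mnc M T < C"
  obtains \<delta> where "mnc_admissible M T \<delta>" "\<delta> < C"
proof -
  have "{\<delta>. mnc_admissible M T \<delta>} \<noteq> {}" using mnc_admissible_opnorm[OF assms(1)] by blast
  from cInf_lessD[OF this assms(2)[unfolded hausdorff_mnc_alt]]
  obtain \<delta> where "\<delta> \<in> {\<delta>. mnc_admissible M T \<delta>}" "\<delta> < C" by (rule bexE)
  then show thesis by (intro that[of \<delta>]) simp_all
qed

context l2_space
begin

lemma L2_indicator_mult:
  assumes "f \<in> L2 M" "E \<in> sets M"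
  shows "(\<lambda>x. complex_of_real (indicator E x) * f x) \<in> L2 M"
    "l2norm M (\<lambda>x. complex_of_real (indicator E x) * f x) \<le> l2norm M f"
proof -
  note [measurable] = L2_measurable[OF assms(1)] assms(2)
  have m: "(\<lambda>x. complex_of_real (indicator E x) * f x) \<in> borel_measurable M" by measurable
  have le: "AE x in M. cmod (complex_of_real (indicator E x) * f x) \<le> cmod (f x)"
    by (auto simp: indicator_def)
  show "(\<lambda>x. complex_of_real (indicator E x) * f x) \<in> L2 M"
    by (rule L2_dominated(1)[OF assms(1) m le])
  show "l2norm M (\<lambda>x. complex_of_real (indicator E x) * f x) \<le> l2norm M f"
    by (rule L2_dominated(2)[OF assms(1) m le])
qed

text \<open>
  Split \<open>E\<close> along the set where \<open>|g|\<^sup>2 > n u\<^sup>2\<close>, on which \<open>|g|\<^sup>2\<close> has small integral for large \<open>n\<close>.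
\<close>

lemma l2norm_absolutely_continuous:
  assumes u[measurable]: "u \<in> borel_measurable M" and u_pos: "\<And>x. x \<in> space M \<Longrightarrow> 0 < u x"
    and g: "g \<in> L2 M" and \<eta>: "0 < \<eta>"
  shows "\<exists>e>0. \<forall>E\<in>sets M. (\<integral>\<^sup>+x. ennreal ((u x)\<^sup>2) * indicator E x \<partial>M) \<le> ennreal e \<longrightarrow>
    l2norm M (\<lambda>x. complex_of_real (indicator E x) * g x) \<le> \<eta>"
proof -
  note [measurable] = L2_measurable[OF g]
  define A where "A n = {x \<in> space M. real n * (u x)\<^sup>2 < (cmod (g x))\<^sup>2}" for n :: nat
  have [measurable]: "A n \<in> sets M" for n unfolding A_def by measurable
  have "(\<lambda>n. \<integral>\<^sup>+x. ennreal ((cmod (g x))\<^sup>2) * indicator (A n) x \<partial>M) \<longlonglongrightarrow> (\<integral>\<^sup>+x. 0 \<partial>M)"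
  proof (rule nn_integral_dominated_convergence[where w = "\<lambda>x. ennreal ((cmod (g x))\<^sup>2)"])
    show "AE x in M. (\<lambda>n. ennreal ((cmod (g x))\<^sup>2) * indicator (A n) x) \<longlonglongrightarrow> 0"
    proof (rule AE_I2)
      fix x assume x: "x \<in> space M"
      obtain n0 where n0: "(cmod (g x))\<^sup>2 / (u x)\<^sup>2 < real n0" using reals_Archimedean2 by blast
      have "x \<notin> A n" if "n0 \<le> n" for n
      proof -
        have "(cmod (g x))\<^sup>2 / (u x)\<^sup>2 < real n" using n0 that by (meson le_less_trans less_le_trans of_nat_le_iff)
        then show ?thesis using u_pos[OF x] unfolding A_def by (simp add: divide_less_eq)
      qed
      then have "eventually (\<lambda>n. ennreal ((cmod (g x))\<^sup>2) * indicator (A n) x = 0) sequentially"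
        by (intro eventually_sequentiallyI[of n0]) auto
      then show "(\<lambda>n. ennreal ((cmod (g x))\<^sup>2) * indicator (A n) x) \<longlonglongrightarrow> 0" by (rule tendsto_eventually)
    qed
    show "AE x in M. ennreal ((cmod (g x))\<^sup>2) * indicator (A n) x \<le> ennreal ((cmod (g x))\<^sup>2)" for n
      by (auto simp: indicator_def)
  qed (use g in \<open>auto simp: L2_iff\<close>)
  moreover have "(\<integral>\<^sup>+x. 0 \<partial>M) < ennreal (\<eta>\<^sup>2 / 2)" using \<eta> by simp
  ultimately have "eventually (\<lambda>n. (\<integral>\<^sup>+x. ennreal ((cmod (g x))\<^sup>2) * indicator (A n) x \<partial>M) < ennreal (\<eta>\<^sup>2 / 2)) sequentially"
    by (rule order_tendstoD(2))
  then obtain n where n: "(\<integral>\<^sup>+x. ennreal ((cmod (g x))\<^sup>2) * indicator (A n) x \<partial>M) < ennreal (\<eta>\<^sup>2 / 2)"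
    by (auto simp: eventually_sequentially)
  define e where "e = \<eta>\<^sup>2 / (2 * (real n + 1))"
  have e: "0 < e" "real n * e \<le> \<eta>\<^sup>2 / 2" using \<eta> unfolding e_def by (auto simp: field_simps)
  show ?thesis
  proof (intro exI[of _ e] conjI ballI impI)
    fix E assume [measurable]: "E \<in> sets M" and E: "(\<integral>\<^sup>+x. ennreal ((u x)\<^sup>2) * indicator E x \<partial>M) \<le> ennreal e"
    have "(\<integral>\<^sup>+x. ennreal ((cmod (complex_of_real (indicator E x) * g x))\<^sup>2) \<partial>M)
        \<le> (\<integral>\<^sup>+x. ennreal ((cmod (g x))\<^sup>2) * indicator (A n) x + ennreal (real n) * (ennreal ((u x)\<^sup>2) * indicator E x) \<partial>M)"
      by (intro nn_integral_mono)
         (auto simp: A_def indicator_def norm_mult ennreal_mult[symmetric] intro!: ennreal_leI)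
    also have "\<dots> = (\<integral>\<^sup>+x. ennreal ((cmod (g x))\<^sup>2) * indicator (A n) x \<partial>M)
        + ennreal (real n) * (\<integral>\<^sup>+x. ennreal ((u x)\<^sup>2) * indicator E x \<partial>M)"
      by (subst nn_integral_add) (auto simp: nn_integral_cmult)
    also have "\<dots> \<le> ennreal (\<eta>\<^sup>2 / 2) + ennreal (real n) * ennreal e"
      using n E by (intro add_mono mult_left_mono) auto
    also have "\<dots> = ennreal (\<eta>\<^sup>2 / 2 + real n * e)" using e by (simp add: ennreal_mult ennreal_plus)
    also have "\<dots> \<le> ennreal (\<eta>\<^sup>2)" using e by (intro ennreal_leI) simp
    finally show "l2norm M (\<lambda>x. complex_of_real (indicator E x) * g x) \<le> \<eta>"
      using \<eta> L2_indicator_mult(1)[OF g] by (subst l2norm_le_iff) auto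
  qed (rule e)
qed

lemma l2norm_uniformly_absolutely_continuous:
  assumes u: "u \<in> borel_measurable M" "\<And>x. x \<in> space M \<Longrightarrow> 0 < u x"
    and F: "finite F" "F \<subseteq> L2 M" and \<eta>: "0 < \<eta>"
  shows "\<exists>e>0. \<forall>g\<in>F. \<forall>E\<in>sets M. (\<integral>\<^sup>+x. ennreal ((u x)\<^sup>2) * indicator E x \<partial>M) \<le> ennreal e \<longrightarrow>
    l2norm M (\<lambda>x. complex_of_real (indicator E x) * g x) \<le> \<eta>"
  using F
proof (induction F rule: finite_induct)
  case (insert g F)
  then obtain e1 where e1: "0 < e1" "\<And>h E. h \<in> F \<Longrightarrow> E \<in> sets M \<Longrightarrow>
      (\<integral>\<^sup>+x. ennreal ((u x)\<^sup>2) * indicator E x \<partial>M) \<le> ennreal e1 \<Longrightarrow> l2norm M (\<lambda>x. complex_of_real (indicator E x) * h x) \<le> \<eta>"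
    by auto
  obtain e2 where e2: "0 < e2" "\<And>E. E \<in> sets M \<Longrightarrow>
      (\<integral>\<^sup>+x. ennreal ((u x)\<^sup>2) * indicator E x \<partial>M) \<le> ennreal e2 \<Longrightarrow> l2norm M (\<lambda>x. complex_of_real (indicator E x) * g x) \<le> \<eta>"
    using l2norm_absolutely_continuous[OF u _ \<eta>, of g] insert by auto
  have le: "ennreal (min e1 e2) \<le> ennreal e1" "ennreal (min e1 e2) \<le> ennreal e2" by (auto intro: ennreal_leI)
  show ?case
  proof (intro exI[of _ "min e1 e2"] conjI ballI impI)
    fix h E assume "h \<in> insert g F" "E \<in> sets M" "(\<integral>\<^sup>+x. ennreal ((u x)\<^sup>2) * indicator E x \<partial>M) \<le> ennreal (min e1 e2)"
    then show "l2norm M (\<lambda>x. complex_of_real (indicator E x) * h x) \<le> \<eta>"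
      using e1(2) e2(2) order_trans[OF _ le(1)] order_trans[OF _ le(2)] by (cases "h = g") auto
  qed (use e1 e2 in auto)
qed (auto intro: exI[of _ 1])

text \<open>
  The image of the unit ball is within \<open>\<delta>\<close> of a finite set, and the elements of a finite set have
  uniformly small norm on small sets.
\<close>

lemma small_rows_if_admissible:
  assumes k: "nonneg_kernel M k T" and adm: "mnc_admissible M T \<delta>" and \<eta>: "0 < \<eta>"
    and u: "u \<in> borel_measurable M" "\<And>x. x \<in> space M \<Longrightarrow> 0 < u x"
  shows "small_rows M u k (\<delta> + \<eta>)"
proof -
  obtain F where F: "finite F" "F \<subseteq> L2 M"
    "\<And>f. f \<in> L2 M \<Longrightarrow> l2norm M f \<le> 1 \<Longrightarrow> \<exists>g\<in>F. l2norm M (\<lambda>x. T f x - g x) \<le> \<delta>"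
    using adm unfolding mnc_admissible_def by blast
  obtain e where e: "0 < e" "\<And>g E. g \<in> F \<Longrightarrow> E \<in> sets M \<Longrightarrow>
      (\<integral>\<^sup>+x. ennreal ((u x)\<^sup>2) * indicator E x \<partial>M) \<le> ennreal e \<Longrightarrow> l2norm M (\<lambda>x. complex_of_real (indicator E x) * g x) \<le> \<eta>"
    using l2norm_uniformly_absolutely_continuous[OF u F(1,2) \<eta>] by auto
  show ?thesis
    unfolding small_rows_def kernel_bound_def
  proof (intro exI[of _ e] conjI ballI impI e(1))
    fix E f' g' assume E[measurable]: "E \<in> sets M" and small: "(\<integral>\<^sup>+x. ennreal ((u x)\<^sup>2) * indicator E x \<partial>M) \<le> ennreal e"
      and f': "f' \<in> nn_unit_ball M" and g': "g' \<in> nn_unit_ball M"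
    let ?i = "\<lambda>x. complex_of_real (indicator E x)"
    let ?f = "\<lambda>x. complex_of_real (enn2real (f' x))" and ?g = "\<lambda>x. complex_of_real (enn2real (g' x))"
    let ?a = "\<lambda>x. complex_of_real (cmod (?f x))"
    note f = nn_unit_ball_repr[OF f'] and g = nn_unit_ball_repr[OF g']
    note a = L2_of_real_cmod[OF f(1)]
    have Ta: "T ?a \<in> L2 M" by (rule nonneg_kernelD(3)[OF k a(1)])
    obtain \<phi> where \<phi>: "\<phi> \<in> F" "l2norm M (\<lambda>x. T ?a x - \<phi> x) \<le> \<delta>" using F(3)[OF a(1)] f(2) unfolding a(2) by blast
    have \<phi>L: "\<phi> \<in> L2 M" using \<phi> F(2) by blast
    have cut: "l2norm M (\<lambda>x. ?i x * T ?a x) \<le> \<delta> + \<eta>"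
    proof -
      note d = L2_diff(1)[OF Ta \<phi>L]
      have "(\<lambda>x. ?i x * T ?a x) = (\<lambda>x. ?i x * (T ?a x - \<phi> x) + ?i x * \<phi> x)" by (simp add: algebra_simps)
      then have "l2norm M (\<lambda>x. ?i x * T ?a x) \<le> l2norm M (\<lambda>x. ?i x * (T ?a x - \<phi> x)) + l2norm M (\<lambda>x. ?i x * \<phi> x)"
        using L2_add(2)[OF L2_indicator_mult(1)[OF d E] L2_indicator_mult(1)[OF \<phi>L E]] by simp
      also have "\<dots> \<le> \<delta> + \<eta>"
        using order_trans[OF L2_indicator_mult(2)[OF d E] \<phi>(2)] e(2)[OF \<phi>(1) E small] by (rule add_mono)
      finally show ?thesis .
    qed
    have "kernel_form M (\<lambda>p. indicator E (fst p) * k p) f' g' = kernel_form M k f' (\<lambda>x. indicator E x * g' x)"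
      unfolding kernel_form_def by (intro nn_integral_cong) (auto simp: indicator_def)
    also have "\<dots> = (\<integral>\<^sup>+x. ennreal (cmod (?i x * ?g x) * cmod (T ?a x)) \<partial>M)"
    proof (rule kernel_form_eq_abs[OF k f(1,3)])
      show "AE x in M. ennreal (cmod (?i x * ?g x)) = indicator E x * g' x"
        using g(3) by eventually_elim (auto simp: indicator_def)
    qed
    also have "\<dots> = (\<integral>\<^sup>+x. ennreal (cmod (?g x) * cmod (?i x * T ?a x)) \<partial>M)"
      by (simp add: norm_mult mult_ac)
    also have "\<dots> \<le> ennreal (l2norm M ?g * l2norm M (\<lambda>x. ?i x * T ?a x))"
      by (rule l2_nn_Cauchy_Schwarz[OF g(1) L2_indicator_mult(1)[OF Ta E]])
    also have "\<dots> \<le> ennreal (1 * (\<delta> + \<eta>))"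
      using g(2) cut by (intro ennreal_leI mult_mono) auto
    finally show "kernel_form M (\<lambda>p. indicator E (fst p) * k p) f' g' \<le> ennreal (\<delta> + \<eta>)" by simp
  qed
qed

text \<open>
  Split \<open>f\<close> into its restriction to \<open>{|f| > c u}\<close>, which is a small set by Chebyshev's inequality, and a
  function in the order interval given by \<open>c u\<close>. The first part contributes at most \<open>C\<close>, the image of
  the second is totally bounded.
\<close>

lemma hausdorff_mnc_le_if_small_cols:
  assumes k: "nonneg_kernel M k T" and cols: "small_cols M u k C" and C: "0 \<le> C"
    and u: "u \<in> borel_measurable M" "\<And>x. x \<in> space M \<Longrightarrow> 0 < u x" "\<And>x. 0 \<le> u x" "(\<lambda>x. complex_of_real (u x)) \<in> L2 M"
  shows "hausdorff_mnc M T \<le> C"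
proof (rule field_le_epsilon)
  fix \<eta> :: real assume \<eta>: "0 < \<eta>"
  note kD = nonneg_kernelD[OF k] and TD = l2_bounded_opD[OF l2_bounded_op_nonneg_kernel[OF k]]
  note [measurable] = u(1) kD(1)
  obtain e where e: "0 < e" "\<And>E. E \<in> sets M \<Longrightarrow> (\<integral>\<^sup>+x. ennreal ((u x)\<^sup>2) * indicator E x \<partial>M) \<le> ennreal e \<Longrightarrow>
     kernel_bound M (\<lambda>p. indicator E (snd p) * k p) C"
    using cols unfolding small_cols_def by blast
  \<comment> \<open>With this level, \<open>\<integral> u\<^sup>2 \<le> c\<^sup>-\<^sup>2 \<integral> |f|\<^sup>2 \<le> e\<close> over the set \<open>{|f| > c u}\<close>.\<close>
  define c where "c = 1 / sqrt e"
  have c: "0 < c" "c\<^sup>2 * e = 1" using e(1) unfolding c_def by (auto simp: power_divide)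
  have cu: "\<And>x. 0 \<le> c * u x" "(\<lambda>x. complex_of_real (c * u x)) \<in> L2 M"
    using c u(3) L2_cmult(1)[OF u(4), of "complex_of_real c"] by auto
  obtain F where F: "finite F" "F \<subseteq> L2 M"
    "\<And>g. g \<in> L2 M \<Longrightarrow> (\<And>x. x \<in> space M \<Longrightarrow> cmod (g x) \<le> c * u x) \<Longrightarrow> \<exists>f\<in>F. l2norm M (\<lambda>x. T g x - f x) \<le> \<eta>"
    using nonneg_kernel_order_compact[OF cu k \<eta>] by blast
  have "mnc_admissible M T (C + \<eta>)"
    unfolding mnc_admissible_def
  proof (intro conjI exI[of _ F] F(1,2) ballI impI)
    show "0 < C + \<eta>" using C \<eta> by simp
    fix f assume f: "f \<in> L2 M" "l2norm M f \<le> 1"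
    note [measurable] = L2_measurable[OF f(1)]
    define E where "E = {x \<in> space M. c * u x < cmod (f x)}"
    have E[measurable]: "E \<in> sets M" unfolding E_def by measurable
    let ?g = "\<lambda>x. complex_of_real (indicator E x) * f x"
    let ?h = "\<lambda>x. complex_of_real (indicator (space M - E) x) * f x"
    have L: "?g \<in> L2 M" "?h \<in> L2 M" using L2_indicator_mult(1)[OF f(1)] E by auto
    have "(\<integral>\<^sup>+x. ennreal ((u x)\<^sup>2) * indicator E x \<partial>M) \<le> (\<integral>\<^sup>+x. ennreal e * ennreal ((cmod (f x))\<^sup>2) \<partial>M)"
    proof (rule nn_integral_mono)
      fix x assume "x \<in> space M"
      show "ennreal ((u x)\<^sup>2) * indicator E x \<le> ennreal e * ennreal ((cmod (f x))\<^sup>2)"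
      proof (cases "x \<in> E")
        case True
        then have "(c * u x)\<^sup>2 \<le> (cmod (f x))\<^sup>2" using cu(1) unfolding E_def by (intro power_mono) auto
        then have "e * (c\<^sup>2 * (u x)\<^sup>2) \<le> e * (cmod (f x))\<^sup>2" using e(1) by (simp add: power_mult_distrib)
        moreover have "e * (c\<^sup>2 * (u x)\<^sup>2) = (u x)\<^sup>2" using c(2) by (metis mult.assoc mult.commute mult_1)
        ultimately show ?thesis using True e(1) by (simp add: ennreal_mult[symmetric] ennreal_leI)
      qed simp
    qed
    also have "\<dots> = ennreal e * ennreal ((l2norm M f)\<^sup>2)" using l2norm_sq[OF f(1)] by (simp add: nn_integral_cmult)
    also have "\<dots> \<le> ennreal e * 1" using f(2) by (intro mult_left_mono) (auto simp: power_le_one)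
    finally have kb: "kernel_bound M (\<lambda>p. indicator E (snd p) * k p) C" using e(2)[OF E] by simp
    have Tg: "l2norm M (T ?g) \<le> C"
    proof -
      have "l2norm M (T (\<lambda>x. complex_of_real (indicator E x) * f x)) \<le> C * l2norm M f"
      proof (rule nonneg_kernelI(2)[OF kb _ _ C, where T = "\<lambda>f. T (\<lambda>x. complex_of_real (indicator E x) * f x)"])
        fix f' assume f': "f' \<in> L2 M"
        have i: "(\<lambda>x. complex_of_real (indicator E x) * f' x) \<in> L2 M" by (rule L2_indicator_mult(1)[OF f' E])
        show "T (\<lambda>x. complex_of_real (indicator E x) * f' x) \<in> borel_measurable M"
          by (rule L2_measurable[OF kD(3)[OF i]])
        show "AE x in M. T (\<lambda>x. complex_of_real (indicator E x) * f' x) x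
            = (\<integral>y. complex_of_real (indicator E (snd (x, y)) * k (x, y)) * f' y \<partial>M)"
          using kD(5)[OF i] by eventually_elim (simp add: mult_ac)
      qed (use kD(2) f in auto)
      also have "\<dots> \<le> C * 1" using f(2) C by (intro mult_left_mono)
      finally show ?thesis by simp
    qed
    have "cmod (?h x) \<le> c * u x" if "x \<in> space M" for x
      using that cu(1)[of x] unfolding E_def by (auto simp: indicator_def)
    then obtain \<phi> where \<phi>: "\<phi> \<in> F" "l2norm M (\<lambda>x. T ?h x - \<phi> x) \<le> \<eta>" using F(3)[OF L(2)] by blast
    have \<phi>L: "\<phi> \<in> L2 M" using \<phi> F(2) by blast
    have "AE x in M. T f x = T (\<lambda>x. ?g x + ?h x) x"
      by (rule TD(2)[OF f(1) L2_add(1)[OF L]]) (auto simp: indicator_def)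
    then have ae: "AE x in M. T f x - \<phi> x = T ?g x + (T ?h x - \<phi> x)"
      using TD(3)[OF L] by eventually_elim simp
    note Lg = kD(3)[OF L(1)] and Lh = L2_diff(1)[OF kD(3)[OF L(2)] \<phi>L]
    have "l2norm M (\<lambda>x. T f x - \<phi> x) = l2norm M (\<lambda>x. T ?g x + (T ?h x - \<phi> x))"
      using L2_measurable[OF L2_diff(1)[OF kD(3)[OF f(1)] \<phi>L]] L2_measurable[OF L2_add(1)[OF Lg Lh]] ae
      by (rule l2norm_cong_AE)
    also have "\<dots> \<le> l2norm M (T ?g) + l2norm M (\<lambda>x. T ?h x - \<phi> x)" by (rule L2_add(2)[OF Lg Lh])
    also have "\<dots> \<le> C + \<eta>" using Tg \<phi>(2) by (rule add_mono)
    finally show "\<exists>g\<in>F. l2norm M (\<lambda>x. T f x - g x) \<le> C + \<eta>" using \<phi>(1) by blast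
  qed
  then show "hausdorff_mnc M T \<le> C + \<eta>" by (rule hausdorff_mnc_le)
qed

lemma small_rows_if_mnc_less:
  assumes k: "nonneg_kernel M k T" and less: "hausdorff_mnc M T < C"
    and u: "u \<in> borel_measurable M" "\<And>x. x \<in> space M \<Longrightarrow> 0 < u x"
  shows "small_rows M u k C"
proof -
  obtain \<delta> where \<delta>: "mnc_admissible M T \<delta>" "\<delta> < C"
    using hausdorff_mnc_less[OF l2_bounded_op_nonneg_kernel[OF k] less] by blast
  show ?thesis using small_rows_if_admissible[OF k \<delta>(1), of "C - \<delta>" u] \<delta>(2) u by simp
qed

lemma small_cols_swap:
  assumes rows: "small_rows M u k C" and [measurable]: "k \<in> borel_measurable (M \<Otimes>\<^sub>M M)"
  shows "small_cols M u (kernel_transpose k) C"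
proof -
  obtain e where e: "0 < e" "\<And>E. E \<in> sets M \<Longrightarrow> (\<integral>\<^sup>+x. ennreal ((u x)\<^sup>2) * indicator E x \<partial>M) \<le> ennreal e \<Longrightarrow>
     kernel_bound M (\<lambda>p. indicator E (fst p) * k p) C"
    using rows unfolding small_rows_def by blast
  show ?thesis
    unfolding small_cols_def
  proof (intro exI[of _ e] conjI ballI impI e(1))
    fix E assume E[measurable]: "E \<in> sets M" and small: "(\<integral>\<^sup>+x. ennreal ((u x)\<^sup>2) * indicator E x \<partial>M) \<le> ennreal e"
    have "kernel_bound M (\<lambda>p. indicator E (fst (prod.swap p)) * k (prod.swap p)) C"
      by (rule kernel_bound_swap[OF e(2)[OF E small]]) measurable
    then show "kernel_bound M (\<lambda>p. indicator E (snd p) * kernel_transpose k p) C" by (simp add: kernel_transpose_def)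
  qed
qed

lemma kernel_transpose_twice [simp]: "kernel_transpose (kernel_transpose k) = k"
  by (simp add: kernel_transpose_def fun_eq_iff)

text \<open>
  The chain \<open>\<gamma>(K) < C \<Longrightarrow>\<close> row strips of \<open>K\<close> bounded by \<open>C\<close> \<open>\<Longrightarrow>\<close> column strips of \<open>K\<^sup>*\<close> bounded by \<open>C\<close>
  \<open>\<Longrightarrow> \<gamma>(K\<^sup>*) \<le> C\<close> gives \<open>\<gamma>(K\<^sup>*) = \<gamma>(K)\<close>, and then \<open>\<gamma>\<close> also controls the column strips of \<open>K\<close> itself.
\<close>

lemma dominated_seminorm_hausdorff_mnc: "dominated_seminorm M (hausdorff_mnc M)"
proof -
  obtain u :: "'a \<Rightarrow> real" where u: "u \<in> borel_measurable M" "\<And>x. x \<in> space M \<Longrightarrow> 0 < u x" "\<And>x. 0 \<le> u x"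
    "(\<lambda>x. complex_of_real (u x)) \<in> L2 M" using obtain_positive_L2 by blast
  have nn: "0 \<le> hausdorff_mnc M T" if "nonneg_kernel M k T" for k T
    by (rule hausdorff_mnc_nonneg[OF l2_bounded_op_nonneg_kernel[OF that]])
  have adj: "hausdorff_mnc M S \<le> hausdorff_mnc M T"
    if k: "nonneg_kernel M k T" and S: "nonneg_kernel M (kernel_transpose k) S" for k T S
  proof (rule field_le_epsilon)
    fix \<eta> :: real assume "0 < \<eta>"
    then have "small_rows M u k (hausdorff_mnc M T + \<eta>)" by (intro small_rows_if_mnc_less[OF k _ u(1,2)]) auto
    then have "small_cols M u (kernel_transpose k) (hausdorff_mnc M T + \<eta>)" by (rule small_cols_swap[OF _ nonneg_kernelD(1)[OF k]])
    then show "hausdorff_mnc M S \<le> hausdorff_mnc M T + \<eta>"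
      using nn[OF k] \<open>0 < \<eta>\<close> u by (intro hausdorff_mnc_le_if_small_cols[OF S]) auto
  qed
  have cols: "small_cols M u k C" if k: "nonneg_kernel M k T" and less: "hausdorff_mnc M T < C" for k T C
  proof -
    have S: "nonneg_kernel M (kernel_transpose k) (l2_adjoint M T)" by (rule nonneg_kernel_adjoint[OF k])
    have "small_rows M u (kernel_transpose k) C"
      using adj[OF k S] less by (intro small_rows_if_mnc_less[OF S _ u(1,2)]) auto
    then show ?thesis using small_cols_swap[OF _ nonneg_kernelD(1)[OF S]] by simp
  qed
  have dom: "hausdorff_mnc M T \<le> c * hausdorff_mnc M A + d * hausdorff_mnc M B"
    if t: "nonneg_kernel M t T" and a: "nonneg_kernel M a A" and b: "nonneg_kernel M b B"
      and cd: "0 \<le> c" "0 \<le> d" and le: "AE p in M \<Otimes>\<^sub>M M. t p \<le> c * a p + d * b p" for t a b T A B c d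
  proof (rule field_le_epsilon)
    fix \<eta> :: real assume \<eta>: "0 < \<eta>"
    define \<eta>' where "\<eta>' = \<eta> / (c + d + 1)"
    have \<eta>'_pos: "0 < \<eta>'" using \<eta> cd unfolding \<eta>'_def by simp
    have "c * \<eta>' + d * \<eta>' \<le> (c + d + 1) * \<eta>'" using \<eta>'_pos by (simp add: algebra_simps)
    also have "\<dots> = \<eta>" using cd unfolding \<eta>'_def by simp
    finally have \<eta>': "0 < \<eta>'" "c * \<eta>' + d * \<eta>' \<le> \<eta>" using \<eta>'_pos by auto
    let ?A = "hausdorff_mnc M A + \<eta>'" and ?B = "hausdorff_mnc M B + \<eta>'"
    obtain e1 where e1: "0 < e1" "\<And>E. E \<in> sets M \<Longrightarrow> (\<integral>\<^sup>+x. ennreal ((u x)\<^sup>2) * indicator E x \<partial>M) \<le> ennreal e1 \<Longrightarrow>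
        kernel_bound M (\<lambda>p. indicator E (snd p) * a p) ?A"
      using cols[OF a, of ?A] \<eta>'(1) unfolding small_cols_def by auto
    obtain e2 where e2: "0 < e2" "\<And>E. E \<in> sets M \<Longrightarrow> (\<integral>\<^sup>+x. ennreal ((u x)\<^sup>2) * indicator E x \<partial>M) \<le> ennreal e2 \<Longrightarrow>
        kernel_bound M (\<lambda>p. indicator E (snd p) * b p) ?B"
      using cols[OF b, of ?B] \<eta>'(1) unfolding small_cols_def by auto
    have mins: "ennreal (min e1 e2) \<le> ennreal e1" "ennreal (min e1 e2) \<le> ennreal e2" by (auto intro: ennreal_leI)
    note [measurable] = nonneg_kernelD(1)[OF t] nonneg_kernelD(1)[OF a] nonneg_kernelD(1)[OF b]
    have "small_cols M u t (c * ?A + d * ?B)"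
      unfolding small_cols_def
    proof (intro exI[of _ "min e1 e2"] conjI ballI impI)
      fix E assume E[measurable]: "E \<in> sets M"
        and small: "(\<integral>\<^sup>+x. ennreal ((u x)\<^sup>2) * indicator E x \<partial>M) \<le> ennreal (min e1 e2)"
      show "kernel_bound M (\<lambda>p. indicator E (snd p) * t p) (c * ?A + d * ?B)"
      proof (rule kernel_bound_dominated[OF e1(2)[OF E order_trans[OF small mins(1)]] e2(2)[OF E order_trans[OF small mins(2)]]])
        show "AE p in M \<Otimes>\<^sub>M M. indicator E (snd p) * t p
            \<le> c * (indicator E (snd p) * a p) + d * (indicator E (snd p) * b p)"
          using le by eventually_elim (simp add: indicator_def)
      qed (use nonneg_kernelD(2)[OF a] nonneg_kernelD(2)[OF b] cd nn[OF a] nn[OF b] \<eta>' in auto)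
    qed (use e1 e2 in auto)
    then have "hausdorff_mnc M T \<le> c * ?A + d * ?B"
      using cd nn[OF a] nn[OF b] \<eta>' u by (intro hausdorff_mnc_le_if_small_cols[OF t]) auto
    also have "\<dots> = c * hausdorff_mnc M A + d * hausdorff_mnc M B + (c * \<eta>' + d * \<eta>')" by (simp add: algebra_simps)
    finally show "hausdorff_mnc M T \<le> c * hausdorff_mnc M A + d * hausdorff_mnc M B + \<eta>" using \<eta>'(2) by simp
  qed
  show ?thesis
    unfolding dominated_seminorm_def
    by (intro conjI allI impI; (rule nn | rule adj | rule dom); assumption)
qed

lemma opnorm_submult:
  assumes k: "nonneg_kernel M k S" and h: "nonneg_kernel M h T"
  shows "l2_opnorm M (S \<circ> T) \<le> l2_opnorm M S * l2_opnorm M T"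
proof (rule l2_opnorm_le)
  fix f assume f: "f \<in> L2 M" "l2norm M f \<le> 1"
  have "l2norm M (S (T f)) \<le> l2_opnorm M S * l2norm M (T f)"
    by (rule l2norm_le_opnorm[OF l2_bounded_op_nonneg_kernel[OF k] nonneg_kernelD(3)[OF h f(1)]])
  also have "\<dots> \<le> l2_opnorm M S * l2_opnorm M T"
    using l2norm_le_opnorm_unit[OF l2_bounded_op_nonneg_kernel[OF h] f] opnorm_nonneg[OF k] by (rule mult_left_mono)
  finally show "l2norm M ((S \<circ> T) f) \<le> l2_opnorm M S * l2_opnorm M T" by simp
qed

text \<open>
  If \<open>T f\<close> is within \<open>\<delta>\<^sub>2\<close> of \<open>g\<close>, then \<open>S (T f)\<close> is \<open>S g\<close> plus \<open>\<delta>\<^sub>2\<close> times the image under \<open>S\<close> of an element of the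
  unit ball.
\<close>

lemma mnc_admissible_comp:
  assumes S: "l2_bounded_op M S" and T: "l2_bounded_op M T"
    and \<delta>1: "mnc_admissible M S \<delta>1" and \<delta>2: "mnc_admissible M T \<delta>2"
  shows "mnc_admissible M (S \<circ> T) (\<delta>1 * \<delta>2)"
proof -
  note SD = l2_bounded_opD[OF S] and TD = l2_bounded_opD[OF T]
  obtain F where F: "finite F" "F \<subseteq> L2 M"
    "\<And>f. f \<in> L2 M \<Longrightarrow> l2norm M f \<le> 1 \<Longrightarrow> \<exists>g\<in>F. l2norm M (\<lambda>x. S f x - g x) \<le> \<delta>1"
    using \<delta>1 unfolding mnc_admissible_def by blast
  obtain G where G: "finite G" "G \<subseteq> L2 M"
    "\<And>f. f \<in> L2 M \<Longrightarrow> l2norm M f \<le> 1 \<Longrightarrow> \<exists>g\<in>G. l2norm M (\<lambda>x. T f x - g x) \<le> \<delta>2"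
    using \<delta>2 unfolding mnc_admissible_def by blast
  have pos: "0 < \<delta>1" "0 < \<delta>2" using \<delta>1 \<delta>2 by (auto simp: mnc_admissible_def)
  let ?c = "complex_of_real \<delta>2"
  let ?h = "\<lambda>(f, g) x. S g x + ?c * f x"
  show ?thesis
    unfolding mnc_admissible_def
  proof (intro conjI exI[of _ "?h ` (F \<times> G)"] ballI impI)
    show "?h ` (F \<times> G) \<subseteq> L2 M" using F(2) G(2) SD(1) by (auto intro!: L2_add L2_cmult)
    fix f assume f: "f \<in> L2 M" "l2norm M f \<le> 1"
    obtain g where g: "g \<in> G" "l2norm M (\<lambda>x. T f x - g x) \<le> \<delta>2" using G(3)[OF f] by blast
    have gL: "g \<in> L2 M" using g G(2) by blast
    note Tf = TD(1)[OF f(1)]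
    let ?\<phi> = "\<lambda>x. complex_of_real (1 / \<delta>2) * (T f x - g x)"
    have \<phi>: "?\<phi> \<in> L2 M" "l2norm M ?\<phi> \<le> 1"
      using L2_cmult[OF L2_diff(1)[OF Tf gL], of "complex_of_real (1 / \<delta>2)"] g(2) pos by (auto simp: norm_divide)
    obtain \<psi> where \<psi>: "\<psi> \<in> F" "l2norm M (\<lambda>x. S ?\<phi> x - \<psi> x) \<le> \<delta>1" using F(3)[OF \<phi>] by blast
    have \<psi>L: "\<psi> \<in> L2 M" using \<psi> F(2) by blast
    have "AE x in M. S (T f) x = S (\<lambda>x. g x + ?c * ?\<phi> x) x"
      by (rule SD(2)[OF Tf L2_add(1)[OF gL L2_cmult(1)[OF \<phi>(1)]]]) (use pos in auto)
    then have ae: "AE x in M. (S \<circ> T) f x - ?h (\<psi>, g) x = ?c * (S ?\<phi> x - \<psi> x)"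
      using SD(3)[OF gL L2_cmult(1)[OF \<phi>(1), of ?c]] SD(4)[OF \<phi>(1), of ?c]
      by eventually_elim (simp add: algebra_simps)
    have "(\<lambda>x. (S \<circ> T) f x - ?h (\<psi>, g) x) \<in> borel_measurable M" "(\<lambda>x. ?c * (S ?\<phi> x - \<psi> x)) \<in> borel_measurable M"
      using L2_measurable[OF SD(1)[OF Tf]] L2_measurable[OF SD(1)[OF gL]] L2_measurable[OF \<psi>L]
        L2_measurable[OF SD(1)[OF \<phi>(1)]] by simp_all
    then have "l2norm M (\<lambda>x. (S \<circ> T) f x - ?h (\<psi>, g) x) = l2norm M (\<lambda>x. ?c * (S ?\<phi> x - \<psi> x))"
      using ae by (rule l2norm_cong_AE)
    also have "\<dots> = \<delta>2 * l2norm M (\<lambda>x. S ?\<phi> x - \<psi> x)"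
      using L2_cmult(2)[OF L2_diff(1)[OF SD(1)[OF \<phi>(1)] \<psi>L], of ?c] pos by simp
    also have "\<dots> \<le> \<delta>2 * \<delta>1" using \<psi>(2) pos by (intro mult_left_mono) auto
    also have "\<delta>2 * \<delta>1 = \<delta>1 * \<delta>2" by (rule mult.commute)
    finally have le: "l2norm M (\<lambda>x. (S \<circ> T) f x - ?h (\<psi>, g) x) \<le> \<delta>1 * \<delta>2" .
    have mem: "?h (\<psi>, g) \<in> ?h ` (F \<times> G)" using \<psi>(1) g(1) by (intro imageI) blast
    show "\<exists>g\<in>?h ` (F \<times> G). l2norm M (\<lambda>x. (S \<circ> T) f x - g x) \<le> \<delta>1 * \<delta>2"
      using le by (rule bexI[where P = "\<lambda>g. l2norm M (\<lambda>x. (S \<circ> T) f x - g x) \<le> \<delta>1 * \<delta>2", OF _ mem])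
  qed (use F(1) G(1) pos in auto)
qed

lemma hausdorff_mnc_submult:
  assumes k: "nonneg_kernel M k S" and h: "nonneg_kernel M h T"
  shows "hausdorff_mnc M (S \<circ> T) \<le> hausdorff_mnc M S * hausdorff_mnc M T"
proof -
  note S = l2_bounded_op_nonneg_kernel[OF k] and T = l2_bounded_op_nonneg_kernel[OF h]
  let ?a = "hausdorff_mnc M S" and ?b = "hausdorff_mnc M T"
  have "hausdorff_mnc M (S \<circ> T) \<le> (?a + \<epsilon>) * (?b + \<epsilon>)" if \<epsilon>: "0 < \<epsilon>" for \<epsilon>
  proof -
    obtain \<delta>1 where 1: "mnc_admissible M S \<delta>1" "\<delta>1 < ?a + \<epsilon>" using hausdorff_mnc_less[OF S, of "?a + \<epsilon>"] \<epsilon> by auto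
    obtain \<delta>2 where 2: "mnc_admissible M T \<delta>2" "\<delta>2 < ?b + \<epsilon>" using hausdorff_mnc_less[OF T, of "?b + \<epsilon>"] \<epsilon> by auto
    have "hausdorff_mnc M (S \<circ> T) \<le> \<delta>1 * \<delta>2"
      by (rule hausdorff_mnc_le[OF mnc_admissible_comp[OF S T 1(1) 2(1)]])
    also have "\<dots> \<le> (?a + \<epsilon>) * (?b + \<epsilon>)"
      using 1 2 hausdorff_mnc_nonneg[OF S] \<epsilon> by (intro mult_mono) (auto simp: mnc_admissible_def)
    finally show ?thesis .
  qed
  then have "eventually (\<lambda>\<epsilon>. hausdorff_mnc M (S \<circ> T) \<le> (?a + \<epsilon>) * (?b + \<epsilon>)) (at_right 0)"
    by (auto simp: eventually_at_right_less eventually_at_filter)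
  moreover have "((\<lambda>\<epsilon>. (?a + \<epsilon>) * (?b + \<epsilon>)) \<longlongrightarrow> (?a + 0) * (?b + 0)) (at_right 0)"
    by (intro tendsto_intros)
  ultimately have "hausdorff_mnc M (S \<circ> T) \<le> (?a + 0) * (?b + 0)"
    by (intro tendsto_lowerbound[where F = "at_right (0::real)"]) auto
  then show ?thesis by simp
qed

end

section \<open>Radii as limits of roots, and Gelfand's formula\<close>

definition root_radius :: "('a l2op \<Rightarrow> real) \<Rightarrow> 'a l2op \<Rightarrow> real" where
  "root_radius \<rho> T = lim (\<lambda>n. root n (\<rho> (T ^^ n)))"

definition kernel_submultiplicative :: "'a measure \<Rightarrow> ('a l2op \<Rightarrow> real) \<Rightarrow> bool" where
  "kernel_submultiplicative M \<rho> \<longleftrightarrow> (\<forall>k h S T. nonneg_kernel M k S \<longrightarrow> nonneg_kernel M h T \<longrightarrow>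
     \<rho> (S \<circ> T) \<le> \<rho> S * \<rho> T)"

context l2_space
begin

lemma nonneg_kernel_funpow:
  assumes k: "nonneg_kernel M k T" and "0 < n"
  shows "\<exists>p. nonneg_kernel M p (T ^^ n)"
  using assms(2)
proof (induction n rule: nat_induct_non_zero)
  case 1
  then show ?case using k by auto
next
  case (Suc n)
  then show ?case using nonneg_kernel_comp[OF k] by (auto simp del: comp_apply)
qed

lemma nonneg_kernel_funpow_swap:
  assumes k: "nonneg_kernel M k T" and S: "nonneg_kernel M (kernel_transpose k) S" and "0 < n"
  shows "\<exists>p. nonneg_kernel M p (T ^^ n) \<and> nonneg_kernel M (kernel_transpose p) (S ^^ n)"
  using assms(3)
proof (induction n rule: nat_induct_non_zero)
  case 1
  then show ?case using k S by auto
next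
  case (Suc n)
  then obtain p where p: "nonneg_kernel M p (T ^^ n)" "nonneg_kernel M (kernel_transpose p) (S ^^ n)" by blast
  have "nonneg_kernel M (kernel_comp M k p) (T ^^ Suc n)"
    using nonneg_kernel_comp[OF k p(1)] by simp
  moreover have "nonneg_kernel M (kernel_transpose (kernel_comp M k p)) (S ^^ Suc n)"
    unfolding kernel_comp_swap[symmetric] funpow_Suc_right by (rule nonneg_kernel_comp[OF p(2) S])
  ultimately show ?case by blast
qed

lemma nonneg_kernel_funpow_kernel_mean:
  assumes t: "nonneg_kernel M t T" and a: "nonneg_kernel M a A" and b: "nonneg_kernel M b B"
    and \<alpha>: "0 \<le> \<alpha>" "\<alpha> \<le> 1" and le: "AE p in M \<Otimes>\<^sub>M M. t p \<le> kernel_mean \<alpha> a b p" and "0 < n"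
  shows "\<exists>t' a' b'. nonneg_kernel M t' (T ^^ n) \<and> nonneg_kernel M a' (A ^^ n) \<and> nonneg_kernel M b' (B ^^ n) \<and>
    (AE p in M \<Otimes>\<^sub>M M. t' p \<le> kernel_mean \<alpha> a' b' p)"
  using assms(7)
proof (induction n rule: nat_induct_non_zero)
  case 1
  then show ?case using t a b le by auto
next
  case (Suc n)
  then obtain t' a' b' where ih: "nonneg_kernel M t' (T ^^ n)" "nonneg_kernel M a' (A ^^ n)"
    "nonneg_kernel M b' (B ^^ n)" "AE p in M \<Otimes>\<^sub>M M. t' p \<le> kernel_mean \<alpha> a' b' p" by blast
  have "nonneg_kernel M (kernel_comp M t t') (T ^^ Suc n)" "nonneg_kernel M (kernel_comp M a a') (A ^^ Suc n)"
    "nonneg_kernel M (kernel_comp M b b') (B ^^ Suc n)"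
    using nonneg_kernel_comp[OF t ih(1)] nonneg_kernel_comp[OF a ih(2)] nonneg_kernel_comp[OF b ih(3)] by simp_all
  then show ?case using kernel_comp_mean_le[OF t ih(1) a ih(2) b ih(3) \<alpha> le ih(4)] by blast
qed

context
  fixes \<rho> :: "'a l2op \<Rightarrow> real"
  assumes \<rho>: "hadamard_log_convex M \<rho>" and submult: "kernel_submultiplicative M \<rho>"
begin

lemma root_radius_limit:
  assumes k: "nonneg_kernel M k T"
  shows "(\<lambda>n. root n (\<rho> (T ^^ n))) \<longlonglongrightarrow> root_radius \<rho> T" "0 \<le> root_radius \<rho> T"
    "0 < n \<Longrightarrow> root_radius \<rho> T ^ n \<le> \<rho> (T ^^ n)"
proof -
  define a where "a n = (if n = 0 then 1 else \<rho> (T ^^ n))" for n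
  obtain L where L: "(\<lambda>n. root n (a n)) \<longlonglongrightarrow> L" "0 \<le> L" "\<And>n. 0 < n \<Longrightarrow> L ^ n \<le> a n"
  proof (rule fekete_root[of a])
    show "0 \<le> a n" for n
      using nonneg_kernel_funpow[OF k, of n] hadamard_log_convexD(1)[OF \<rho>] by (auto simp: a_def)
    fix m n :: nat assume mn: "0 < m" "0 < n"
    obtain p q where "nonneg_kernel M p (T ^^ m)" "nonneg_kernel M q (T ^^ n)"
      using nonneg_kernel_funpow[OF k] mn by blast
    then have "\<rho> (T ^^ m \<circ> T ^^ n) \<le> \<rho> (T ^^ m) * \<rho> (T ^^ n)"
      using submult unfolding kernel_submultiplicative_def by blast
    then show "a (m + n) \<le> a m * a n" using mn by (simp add: a_def funpow_add)
  qed blast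
  have "root n (a n) = root n (\<rho> (T ^^ n))" for n by (cases n) (auto simp: a_def)
  then have lim: "(\<lambda>n. root n (\<rho> (T ^^ n))) \<longlonglongrightarrow> L" using L(1) by simp
  then have eq: "root_radius \<rho> T = L" unfolding root_radius_def by (rule limI)
  show "(\<lambda>n. root n (\<rho> (T ^^ n))) \<longlonglongrightarrow> root_radius \<rho> T" "0 \<le> root_radius \<rho> T"
    using lim L(2) by (simp_all add: eq)
  show "root_radius \<rho> T ^ n \<le> \<rho> (T ^^ n)" if "0 < n"
    using L(3)[OF that] that by (simp add: eq a_def)
qed

text \<open>
  The inequalities hold for all positive powers and survive taking roots and limits.
\<close>

lemma hadamard_log_convex_root_radius: "hadamard_log_convex M (root_radius \<rho>)"
proof -
  have adj: "root_radius \<rho> S \<le> root_radius \<rho> T" if k: "nonneg_kernel M k T" and S: "nonneg_kernel M (kernel_transpose k) S" for k T S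
  proof (rule LIMSEQ_le[OF root_radius_limit(1)[OF S] root_radius_limit(1)[OF k]])
    have "root n (\<rho> (S ^^ n)) \<le> root n (\<rho> (T ^^ n))" if "0 < n" for n
      using nonneg_kernel_funpow_swap[OF k S that] hadamard_log_convexD(2)[OF \<rho>] that by auto
    then show "\<exists>N. \<forall>n\<ge>N. root n (\<rho> (S ^^ n)) \<le> root n (\<rho> (T ^^ n))" by (intro exI[of _ 1]) auto
  qed
  have mean: "root_radius \<rho> T \<le> rpow (root_radius \<rho> A) \<alpha> * rpow (root_radius \<rho> B) (1 - \<alpha>)"
    if \<alpha>: "0 \<le> \<alpha>" "\<alpha> \<le> 1" and t: "nonneg_kernel M t T" and a: "nonneg_kernel M a A" and b: "nonneg_kernel M b B"
      and le: "AE p in M \<Otimes>\<^sub>M M. t p \<le> kernel_mean \<alpha> a b p" for \<alpha> t a b T A B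
  proof -
    have nn: "0 \<le> root n (\<rho> (A ^^ n))" if a: "nonneg_kernel M a A" for a A n
      using nonneg_kernel_funpow[OF a, of n] hadamard_log_convexD(1)[OF \<rho>] by (cases "n = 0") auto
    have "(\<lambda>n. rpow (root n (\<rho> (A ^^ n))) \<alpha> * rpow (root n (\<rho> (B ^^ n))) (1 - \<alpha>))
        \<longlonglongrightarrow> rpow (root_radius \<rho> A) \<alpha> * rpow (root_radius \<rho> B) (1 - \<alpha>)"
      using \<alpha> nn[OF a] nn[OF b] by (intro tendsto_mult tendsto_rpow root_radius_limit(1)[OF a] root_radius_limit(1)[OF b]) auto
    then show ?thesis
    proof (rule LIMSEQ_le[OF root_radius_limit(1)[OF t]])
      have "root n (\<rho> (T ^^ n)) \<le> rpow (root n (\<rho> (A ^^ n))) \<alpha> * rpow (root n (\<rho> (B ^^ n))) (1 - \<alpha>)" if n: "0 < n" for n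
      proof -
        obtain t' a' b' where p: "nonneg_kernel M t' (T ^^ n)" "nonneg_kernel M a' (A ^^ n)"
          "nonneg_kernel M b' (B ^^ n)" "AE p in M \<Otimes>\<^sub>M M. t' p \<le> kernel_mean \<alpha> a' b' p"
          using nonneg_kernel_funpow_kernel_mean[OF t a b \<alpha> le n] by blast
        have "\<rho> (T ^^ n) \<le> rpow (\<rho> (A ^^ n)) \<alpha> * rpow (\<rho> (B ^^ n)) (1 - \<alpha>)"
          by (rule hadamard_log_convexD(3)[OF \<rho> \<alpha> p])
        then have "root n (\<rho> (T ^^ n)) \<le> root n (rpow (\<rho> (A ^^ n)) \<alpha> * rpow (\<rho> (B ^^ n)) (1 - \<alpha>))"
          using n by simp
        also have "\<dots> = rpow (root n (\<rho> (A ^^ n))) \<alpha> * rpow (root n (\<rho> (B ^^ n))) (1 - \<alpha>)"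
          using n hadamard_log_convexD(1)[OF \<rho>] p by (simp add: real_root_mult root_rpow)
        finally show ?thesis .
      qed
      then show "\<exists>N. \<forall>n\<ge>N. root n (\<rho> (T ^^ n)) \<le> rpow (root n (\<rho> (A ^^ n))) \<alpha> * rpow (root n (\<rho> (B ^^ n))) (1 - \<alpha>)"
        by (intro exI[of _ 1]) auto
    qed
  qed
  show ?thesis
    unfolding hadamard_log_convex_def
    by (intro conjI allI impI; (rule root_radius_limit(2) | rule adj | rule mean); assumption)
qed

text \<open>
  Submultiplicativity applied to \<open>(S T)\<^sup>n\<^sup>+\<^sup>1 = S (T S)\<^sup>n T\<close>; the two extra factors disappear in the limit of the roots.
\<close>

lemma root_radius_commute_le:
  assumes k: "nonneg_kernel M k S" and h: "nonneg_kernel M h T"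
  shows "root_radius \<rho> (S \<circ> T) \<le> root_radius \<rho> (T \<circ> S)"
proof -
  have ST: "nonneg_kernel M (kernel_comp M k h) (S \<circ> T)" and TS: "nonneg_kernel M (kernel_comp M h k) (T \<circ> S)"
    by (rule nonneg_kernel_comp[OF k h], rule nonneg_kernel_comp[OF h k])
  define L where "L = root_radius \<rho> (S \<circ> T)"
  define C where "C = \<rho> S * \<rho> T + 1"
  note nn = hadamard_log_convexD(1)[OF \<rho>]
  have C: "1 \<le> C" unfolding C_def using nn[OF k] nn[OF h] by simp
  note L0 = root_radius_limit(2)[OF ST, folded L_def]
  show ?thesis
  proof (cases "L = 0")
    case True
    then show ?thesis using root_radius_limit(2)[OF TS] unfolding L_def by simp
  next
    case False
    with L0 have Lpos: "0 < L" by simp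
    have step: "L * root n L \<le> root n C * root n (\<rho> ((T \<circ> S) ^^ n))" if n: "0 < n" for n
    proof -
      obtain p where p: "nonneg_kernel M p ((T \<circ> S) ^^ n)" using nonneg_kernel_funpow[OF TS n] by blast
      have "(S \<circ> T) ^^ Suc n = S \<circ> ((T \<circ> S) ^^ n \<circ> T)"
      proof (induction n)
        case (Suc n)
        have "(S \<circ> T) ^^ Suc (Suc n) = (S \<circ> T) \<circ> (S \<circ> T) ^^ Suc n" by (rule funpow.simps(2))
        also have "\<dots> = (S \<circ> T) \<circ> (S \<circ> ((T \<circ> S) ^^ n \<circ> T))" by (simp only: Suc)
        also have "\<dots> = S \<circ> ((T \<circ> S) ^^ Suc n \<circ> T)" by (simp only: funpow.simps(2) comp_assoc)
        finally show ?case .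
      qed auto
      then have "\<rho> ((S \<circ> T) ^^ Suc n) \<le> \<rho> S * \<rho> ((T \<circ> S) ^^ n \<circ> T)"
        using submult k nonneg_kernel_comp[OF p h] unfolding kernel_submultiplicative_def by metis
      also have "\<dots> \<le> \<rho> S * (\<rho> ((T \<circ> S) ^^ n) * \<rho> T)"
        using submult p h nn[OF k] unfolding kernel_submultiplicative_def by (intro mult_left_mono) blast+
      also have "\<dots> \<le> C * \<rho> ((T \<circ> S) ^^ n)"
        unfolding C_def using nn[OF p] by (simp add: algebra_simps)
      finally have "L ^ Suc n \<le> C * \<rho> ((T \<circ> S) ^^ n)"
        using root_radius_limit(3)[OF ST, of "Suc n"] unfolding L_def by simp
      then have "root n (L ^ n * L) \<le> root n (C * \<rho> ((T \<circ> S) ^^ n))" using n by (simp add: mult.commute)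
      then show ?thesis using n Lpos by (simp add: real_root_mult real_root_power_cancel)
    qed
    have "L * 1 \<le> 1 * root_radius \<rho> (T \<circ> S)"
    proof (rule LIMSEQ_le)
      show "(\<lambda>n. L * root n L) \<longlonglongrightarrow> L * 1" using Lpos by (intro tendsto_intros LIMSEQ_root_const)
      show "(\<lambda>n. root n C * root n (\<rho> ((T \<circ> S) ^^ n))) \<longlonglongrightarrow> 1 * root_radius \<rho> (T \<circ> S)"
        using C by (intro tendsto_mult LIMSEQ_root_const root_radius_limit(1)[OF TS]) auto
      show "\<exists>N. \<forall>n\<ge>N. L * root n L \<le> root n C * root n (\<rho> ((T \<circ> S) ^^ n))"
        using step by (intro exI[of _ 1]) auto
    qed
    then show ?thesis unfolding L_def by simp
  qed
qed

end

end

lemma l2_bounded_op_comp: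
  assumes S: "l2_bounded_op M S" and T: "l2_bounded_op M T"
  shows "l2_bounded_op M (S \<circ> T)"
  unfolding l2_bounded_op_def
proof (intro conjI ballI allI impI)
  note SD = l2_bounded_opD[OF S] and TD = l2_bounded_opD[OF T]
  fix f assume f: "f \<in> L2 M"
  show "(S \<circ> T) f \<in> L2 M" using SD(1)[OF TD(1)[OF f]] by simp
  show "AE x in M. (S \<circ> T) (\<lambda>x. c * f x) x = c * (S \<circ> T) f x" for c
    using SD(2)[OF TD(1)[OF L2_cmult(1)[OF f]] L2_cmult(1)[OF TD(1)[OF f]] TD(4)[OF f, of c]] SD(4)[OF TD(1)[OF f], of c]
    by eventually_elim simp
  fix g assume g: "g \<in> L2 M"
  show "AE x in M. (S \<circ> T) f x = (S \<circ> T) g x" if "AE x in M. f x = g x"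
    using SD(2)[OF TD(1)[OF f] TD(1)[OF g] TD(2)[OF f g that]] by simp
  show "AE x in M. (S \<circ> T) (\<lambda>x. f x + g x) x = (S \<circ> T) f x + (S \<circ> T) g x"
    using SD(2)[OF TD(1)[OF L2_add(1)[OF f g]] L2_add(1)[OF TD(1)[OF f] TD(1)[OF g]] TD(3)[OF f g]]
      SD(3)[OF TD(1)[OF f] TD(1)[OF g]]
    by eventually_elim simp
next
  have "l2norm M ((S \<circ> T) f) \<le> (l2_opnorm M S * l2_opnorm M T) * l2norm M f" if f: "f \<in> L2 M" for f
  proof -
    have "l2norm M (S (T f)) \<le> l2_opnorm M S * l2norm M (T f)"
      by (rule l2norm_le_opnorm[OF S l2_bounded_opD(1)[OF T f]])
    also have "\<dots> \<le> l2_opnorm M S * (l2_opnorm M T * l2norm M f)"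
      by (rule mult_left_mono[OF l2norm_le_opnorm[OF T f] l2_opnorm_nonneg[OF S]])
    finally show ?thesis by (simp add: mult.assoc)
  qed
  then show "\<exists>C. \<forall>f\<in>L2 M. l2norm M ((S \<circ> T) f) \<le> C * l2norm M f" by blast
qed

lemma l2_bounded_op_funpow:
  assumes T: "l2_bounded_op M T"
  shows "l2_bounded_op M (T ^^ n)"
proof (induction n)
  case 0
  show ?case unfolding l2_bounded_op_def by (auto intro!: exI[of _ 1])
next
  case (Suc n)
  then show ?case unfolding funpow.simps by (rule l2_bounded_op_comp[OF T])
qed

lemma l2_bounded_op_lincomb_sum:
  assumes T: "l2_bounded_op M T" and f: "\<And>i. i < (n::nat) \<Longrightarrow> f i \<in> L2 M"
  shows "AE x in M. T (\<lambda>x. \<Sum>i<n. c i * f i x) x = (\<Sum>i<n. c i * T (f i) x)"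
  using f
proof (induction n)
  case 0
  show ?case using l2_bounded_opD(4)[OF T L2_zero(1), of 0] by simp
next
  case (Suc n)
  have s: "(\<lambda>x. \<Sum>i<n. c i * f i x) \<in> L2 M" using L2_sum[of "{..<n}" "\<lambda>i x. c i * f i x" M] L2_cmult(1)[OF Suc(2)] by simp
  have fn: "f n \<in> L2 M" using Suc by simp
  have "AE x in M. T (\<lambda>x. \<Sum>i<n. c i * f i x) x = (\<Sum>i<n. c i * T (f i) x)" using Suc by simp
  then show ?case
    using l2_bounded_opD(3)[OF T s L2_cmult(1)[OF fn, of "c n"]] l2_bounded_opD(4)[OF T fn, of "c n"]
    by eventually_elim simp
qed

context l2_space
begin

text \<open>
  The terms of the Neumann series of \<open>(c - T)\<^sup>-\<^sup>1 f\<close>.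
\<close>

definition resolvent_term :: "'a l2op \<Rightarrow> complex \<Rightarrow> ('a \<Rightarrow> complex) \<Rightarrow> nat \<Rightarrow> 'a \<Rightarrow> complex" where
  "resolvent_term T c f n x = (1 / c ^ Suc n) * (T ^^ n) f x"

lemma resolvent_term_L2:
  assumes T: "l2_bounded_op M T" and f: "f \<in> L2 M"
  shows "resolvent_term T c f n \<in> L2 M" "l2norm M (resolvent_term T c f n) = l2norm M ((T ^^ n) f) / cmod c ^ Suc n"
  using L2_cmult[OF l2_bounded_opD(1)[OF l2_bounded_op_funpow[OF T] f], of "1 / c ^ Suc n" n]
  unfolding resolvent_term_def[abs_def] by (simp_all add: norm_divide norm_power norm_mult)

lemma resolvent_partial_sum_right:
  assumes T: "l2_bounded_op M T" and f: "f \<in> L2 M" and c: "c \<noteq> 0"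
  shows "AE x in M. c * (\<Sum>n<N. resolvent_term T c f n x) - T (\<lambda>x. \<Sum>n<N. resolvent_term T c f n x) x
    = f x - (1 / c ^ N) * (T ^^ N) f x"
proof -
  have "AE x in M. T (\<lambda>x. \<Sum>n<N. (1 / c ^ Suc n) * (T ^^ n) f x) x = (\<Sum>n<N. (1 / c ^ Suc n) * T ((T ^^ n) f) x)"
    by (rule l2_bounded_op_lincomb_sum[OF T l2_bounded_opD(1)[OF l2_bounded_op_funpow[OF T] f]])
  then show ?thesis
  proof eventually_elim
    case (elim x)
    let ?w = "\<lambda>n. (1 / c ^ n) * (T ^^ n) f x"
    have "c * (\<Sum>n<N. resolvent_term T c f n x) - T (\<lambda>x. \<Sum>n<N. resolvent_term T c f n x) x
        = (\<Sum>n<N. c * ((1 / c ^ Suc n) * (T ^^ n) f x) - (1 / c ^ Suc n) * T ((T ^^ n) f) x)"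
      unfolding resolvent_term_def elim sum_distrib_left sum_subtractf ..
    also have "\<dots> = (\<Sum>n<N. ?w n - ?w (Suc n))" using c by (intro sum.cong) auto
    also have "\<dots> = ?w 0 - ?w N" by (rule sum_lessThan_telescope')
    finally show ?case by simp
  qed
qed

text \<open>
  The sum of the Neumann series is defined pointwise. It is a left inverse by telescoping at almost
  every point, and a right inverse by telescoping the partial sums in norm.
\<close>

lemma not_in_spectrum_if_neumann_summable:
  assumes T: "l2_bounded_op M T" and c: "c \<noteq> 0"
    and a: "\<And>n f. f \<in> L2 M \<Longrightarrow> l2norm M ((T ^^ n) f) \<le> a n * l2norm M f"
    and summ: "summable (\<lambda>n. a n / cmod c ^ Suc n)"
  shows "c \<notin> l2_spectrum M T"
proof -
  note TD = l2_bounded_opD[OF T]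
  note Tn = l2_bounded_opD[OF l2_bounded_op_funpow[OF T]]
  define R where "R f x = (\<Sum>n. resolvent_term T c f n x)" for f x
  let ?r = "resolvent_term T c"
  have norm_summ: "summable (\<lambda>n. l2norm M (?r f n))"
    and norm_le: "(\<Sum>n. l2norm M (?r f n)) \<le> (\<Sum>n. a n / cmod c ^ Suc n) * l2norm M f" if f: "f \<in> L2 M" for f
  proof -
    have le: "l2norm M (?r f n) \<le> a n / cmod c ^ Suc n * l2norm M f" for n
    proof -
      have "l2norm M ((T ^^ n) f) / cmod c ^ Suc n \<le> (a n * l2norm M f) / cmod c ^ Suc n"
        by (rule divide_right_mono[OF a[OF f]]) simp
      then show ?thesis unfolding resolvent_term_L2(2)[OF T f] by simp
    qed
    show s: "summable (\<lambda>n. l2norm M (?r f n))"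
      by (rule summable_comparison_test'[OF summable_mult2[OF summ], of 0 _ "l2norm M f"]) (use le in simp)
    show "(\<Sum>n. l2norm M (?r f n)) \<le> (\<Sum>n. a n / cmod c ^ Suc n) * l2norm M f"
      unfolding suminf_mult2[OF summ] by (rule suminf_le[OF le s summable_mult2[OF summ]])
  qed
  note rL = resolvent_term_L2(1)[OF T]
  have RL: "R f \<in> L2 M" if f: "f \<in> L2 M" for f
    unfolding R_def[abs_def] by (rule L2_series_bound(3)[OF rL[OF f] norm_summ[OF f]])
  have summ_AE: "AE x in M. summable (\<lambda>n. ?r f n x)" if f: "f \<in> L2 M" for f
    using L2_series_bound(1)[OF rL[OF f] norm_summ[OF f]] by eventually_elim (rule summable_norm_cancel)
  have R: "l2_bounded_op M R"
    unfolding l2_bounded_op_def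
  proof (intro conjI ballI allI impI)
    fix f assume f: "f \<in> L2 M"
    show "R f \<in> L2 M" by (rule RL[OF f])
    show "AE x in M. R (\<lambda>x. d * f x) x = d * R f x" for d
    proof -
      have "AE x in M. \<forall>n. (T ^^ n) (\<lambda>x. d * f x) x = d * (T ^^ n) f x"
        unfolding AE_all_countable using Tn(4)[OF f] by blast
      then show ?thesis
        using summ_AE[OF f]
      proof eventually_elim
        case (elim x)
        have "R (\<lambda>x. d * f x) x = (\<Sum>n. d * ?r f n x)"
          unfolding R_def resolvent_term_def using elim(1) by (simp add: mult_ac)
        then show ?case unfolding R_def using suminf_mult[OF elim(2)] by simp
      qed
    qed
    fix g assume g: "g \<in> L2 M"
    show "AE x in M. R f x = R g x" if "AE x in M. f x = g x"
    proof -
      have "AE x in M. \<forall>n. (T ^^ n) f x = (T ^^ n) g x"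
        unfolding AE_all_countable using Tn(2)[OF f g that] by blast
      then show ?thesis by eventually_elim (simp add: R_def resolvent_term_def)
    qed
    show "AE x in M. R (\<lambda>x. f x + g x) x = R f x + R g x"
    proof -
      have "AE x in M. \<forall>n. (T ^^ n) (\<lambda>x. f x + g x) x = (T ^^ n) f x + (T ^^ n) g x"
        unfolding AE_all_countable using Tn(3)[OF f g] by blast
      then show ?thesis
        using summ_AE[OF f] summ_AE[OF g]
      proof eventually_elim
        case (elim x)
        have "R (\<lambda>x. f x + g x) x = (\<Sum>n. ?r f n x + ?r g n x)"
          unfolding R_def resolvent_term_def using elim(1) by (simp add: distrib_left)
        then show ?case unfolding R_def using suminf_add[OF elim(2,3)] by simp
      qed
    qed
  next
    have "l2norm M (R f) \<le> (\<Sum>n. a n / cmod c ^ Suc n) * l2norm M f" if f: "f \<in> L2 M" for f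
      using L2_series_bound(4)[OF rL[OF f] norm_summ[OF f]] norm_le[OF f] unfolding R_def[abs_def] by simp
    then show "\<exists>C. \<forall>f\<in>L2 M. l2norm M (R f) \<le> C * l2norm M f" by blast
  qed
  have left: "AE x in M. R (\<lambda>y. c * f y - T f y) x = f x" if f: "f \<in> L2 M" for f
  proof -
    have "AE x in M. (T ^^ n) (\<lambda>y. c * f y - T f y) x = c * (T ^^ n) f x - (T ^^ Suc n) f x" for n
    proof -
      have "AE x in M. (T ^^ n) (\<lambda>y. c * f y + (-1) * T f y) x = c * (T ^^ n) f x + (-1) * (T ^^ n) (T f) x"
        using Tn(3)[OF L2_cmult(1)[OF f, of c] L2_cmult(1)[OF TD(1)[OF f], of "-1"], of n]
          Tn(4)[OF f, of n c] Tn(4)[OF TD(1)[OF f], of n "-1"]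
        by eventually_elim simp
      then show ?thesis by (simp add: funpow_swap1)
    qed
    then have "AE x in M. \<forall>n. (T ^^ n) (\<lambda>y. c * f y - T f y) x = c * (T ^^ n) f x - (T ^^ Suc n) f x"
      unfolding AE_all_countable by blast
    then show ?thesis
      using summ_AE[OF f]
    proof eventually_elim
      case (elim x)
      let ?w = "\<lambda>n. (1 / c ^ n) * (T ^^ n) f x"
      have "(\<lambda>n. c * ?r f n x) \<longlonglongrightarrow> c * 0" by (intro tendsto_intros summable_LIMSEQ_zero elim(2))
      moreover have "c * ?r f n x = ?w n" for n using c by (simp add: resolvent_term_def)
      ultimately have "?w \<longlonglongrightarrow> 0" by simp
      then have "(\<lambda>n. ?w n - ?w (Suc n)) sums (?w 0 - 0)" by (rule telescope_sums')
      moreover have "?r (\<lambda>y. c * f y - T f y) n x = ?w n - ?w (Suc n)" for n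
        unfolding resolvent_term_def elim(1)[rule_format] using c by (simp add: right_diff_distrib)
      ultimately show ?case unfolding R_def by (simp add: sums_iff)
    qed
  qed
  have right: "AE x in M. c * R f x - T (R f) x = f x" if f: "f \<in> L2 M" for f
  proof -
    note Rf = RL[OF f]
    define h where "h x = c * R f x - T (R f) x - f x" for x
    have cR: "(\<lambda>x. c * R f x - T (R f) x) \<in> L2 M" by (rule L2_diff(1)[OF L2_cmult(1)[OF Rf] TD(1)[OF Rf]])
    have h: "h \<in> L2 M" unfolding h_def by (rule L2_diff(1)[OF cR f])
    define S where "S N x = (\<Sum>n<N. ?r f n x)" for N x
    have S: "S N \<in> L2 M" for N unfolding S_def[abs_def] using L2_sum[of "{..<N}" "?r f"] rL[OF f] by blast
    define e where "e N = l2norm M (\<lambda>x. R f x - S N x)" for N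
    have e: "e \<longlonglongrightarrow> 0"
      unfolding e_def R_def S_def by (rule L2_series_tendsto[OF rL[OF f] norm_summ[OF f]])
    have h_le: "l2norm M h \<le> (cmod c + l2_opnorm M T) * e N + cmod c * l2norm M (?r f N)" for N
    proof -
      let ?d = "\<lambda>x. R f x - S N x"
      have d: "?d \<in> L2 M" by (rule L2_diff(1)[OF Rf S])
      have "AE x in M. T (\<lambda>x. R f x + (-1) * S N x) x = T (R f) x + (-1) * T (S N) x"
        using TD(3)[OF Rf L2_cmult(1)[OF S[of N], of "-1"]] TD(4)[OF S[of N], of "-1"] by eventually_elim simp
      then have ae: "AE x in M. h x = (c * ?d x - T ?d x) - c * ?r f N x"
        using resolvent_partial_sum_right[OF T f c, of N, folded S_def[abs_def]]
      proof eventually_elim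
        case (elim x)
        have "c * ?r f N x = (1 / c ^ N) * (T ^^ N) f x" using c by (simp add: resolvent_term_def)
        moreover have "T ?d x = T (R f) x - T (S N) x" using elim(1) by simp
        moreover have "c * S N x - T (S N) x = f x - (1 / c ^ N) * (T ^^ N) f x"
          using elim(2) by (simp add: S_def[abs_def])
        ultimately have "f x = c * S N x - T (S N) x + c * ?r f N x" "T (R f) x = T (S N) x + T ?d x"
          by simp_all
        then show ?case unfolding h_def by (simp add: algebra_simps)
      qed
      have L1: "(\<lambda>x. c * ?d x - T ?d x) \<in> L2 M" by (rule L2_diff(1)[OF L2_cmult(1)[OF d] TD(1)[OF d]])
      have L2: "(\<lambda>x. c * ?r f N x) \<in> L2 M" by (rule L2_cmult(1)[OF rL[OF f]])
      have "l2norm M h = l2norm M (\<lambda>x. (c * ?d x - T ?d x) - c * ?r f N x)"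
        by (rule l2norm_cong_AE[OF L2_measurable[OF h] L2_measurable[OF L2_diff(1)[OF L1 L2]] ae])
      also have "\<dots> \<le> l2norm M (\<lambda>x. c * ?d x - T ?d x) + l2norm M (\<lambda>x. c * ?r f N x)" by (rule L2_diff(2)[OF L1 L2])
      also have "\<dots> \<le> (l2norm M (\<lambda>x. c * ?d x) + l2norm M (T ?d)) + cmod c * l2norm M (?r f N)"
        using L2_diff(2)[OF L2_cmult(1)[OF d] TD(1)[OF d]] L2_cmult(2)[OF rL[OF f]] by simp
      also have "\<dots> \<le> (cmod c * e N + l2_opnorm M T * e N) + cmod c * l2norm M (?r f N)"
        using L2_cmult(2)[OF d] l2norm_le_opnorm[OF T d] unfolding e_def by simp
      finally show ?thesis by (simp add: distrib_right)
    qed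
    have "(\<lambda>N. (cmod c + l2_opnorm M T) * e N + cmod c * l2norm M (?r f N)) \<longlonglongrightarrow> (cmod c + l2_opnorm M T) * 0 + cmod c * 0"
      by (intro tendsto_intros e summable_LIMSEQ_zero norm_summ[OF f])
    then have "l2norm M h \<le> (cmod c + l2_opnorm M T) * 0 + cmod c * 0"
      by (rule LIMSEQ_le_const) (use h_le in blast)
    then have "l2norm M h = 0" using l2norm_nonneg[of M h] by simp
    then have "AE x in M. h x = 0" using l2norm_eq_0_AE[OF h] by simp
    then show ?thesis by eventually_elim (simp add: h_def)
  qed
  show ?thesis unfolding l2_spectrum_def using R left right by blast
qed

lemma kernel_submultiplicative_opnorm: "kernel_submultiplicative M (l2_opnorm M)"
  unfolding kernel_submultiplicative_def using opnorm_submult by blast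

lemma kernel_submultiplicative_hausdorff_mnc: "kernel_submultiplicative M (hausdorff_mnc M)"
  unfolding kernel_submultiplicative_def using hausdorff_mnc_submult by blast

lemmas opnorm_log_convex = dominated_seminorm_imp_log_convex[OF dominated_seminorm_opnorm]
lemmas hausdorff_mnc_log_convex = dominated_seminorm_imp_log_convex[OF dominated_seminorm_hausdorff_mnc]
lemmas opnorm_radius_limit = root_radius_limit[OF opnorm_log_convex kernel_submultiplicative_opnorm]

text \<open>
  By the root test the Neumann series converges outside the disc of radius \<open>lim \<parallel>T\<^sup>n\<parallel>\<^sup>1\<^sup>/\<^sup>n\<close>.
\<close>

lemma spectrum_bound:
  assumes k: "nonneg_kernel M k T" and c: "root_radius (l2_opnorm M) T < cmod c"
  shows "c \<notin> l2_spectrum M T"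
proof -
  note T = l2_bounded_op_nonneg_kernel[OF k]
  define a where "a n = (if n = 0 then 1 else l2_opnorm M (T ^^ n))" for n
  obtain b where b: "root_radius (l2_opnorm M) T < b" "b < cmod c" using c dense by blast
  have b0: "0 < b" using b(1) opnorm_radius_limit(2)[OF k] by linarith
  have ev: "eventually (\<lambda>n. root n (l2_opnorm M (T ^^ n)) < b) sequentially"
    using opnorm_radius_limit(1)[OF k] b(1) by (rule order_tendstoD(2))
  show ?thesis
  proof (rule not_in_spectrum_if_neumann_summable[OF T])
    show "c \<noteq> 0" using b b0 by auto
    show "l2norm M ((T ^^ n) f) \<le> a n * l2norm M f" if "f \<in> L2 M" for n f
      using l2norm_le_opnorm[OF l2_bounded_op_funpow[OF T] that, of n] by (auto simp: a_def)
    show "summable (\<lambda>n. a n / cmod c ^ Suc n)"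
    proof (rule summable_comparison_test_ev)
      show "eventually (\<lambda>n. norm (a n / cmod c ^ Suc n) \<le> (b / cmod c) ^ n * (1 / cmod c)) sequentially"
        using ev eventually_gt_at_top[of 0]
      proof eventually_elim
        case (elim n)
        have nn: "0 \<le> l2_opnorm M (T ^^ n)" by (rule l2_opnorm_nonneg[OF l2_bounded_op_funpow[OF T]])
        have "l2_opnorm M (T ^^ n) = root n (l2_opnorm M (T ^^ n)) ^ n" using elim(2) nn by simp
        also have "\<dots> \<le> b ^ n" using elim nn by (intro power_mono) auto
        finally have "a n \<le> b ^ n" using elim(2) by (simp add: a_def)
        moreover have "0 \<le> a n" using nn by (simp add: a_def)
        ultimately have "norm (a n / cmod c ^ Suc n) \<le> b ^ n / cmod c ^ Suc n"
          by (simp add: divide_right_mono)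
        then show ?case by (simp add: power_divide mult.commute)
      qed
      show "summable (\<lambda>n. (b / cmod c) ^ n * (1 / cmod c))"
        using b b0 by (intro summable_mult2 summable_geometric) (auto simp: divide_less_eq)
    qed
  qed
qed

text \<open>
  A resolvent identity for partial sums: if \<open>R\<close> is a left inverse of \<open>L - T\<close> and \<open>S\<close> is the \<open>N\<close>-th partial sum at
  \<open>l\<close>, then \<open>S f = R (f - T\<^sup>N f / l\<^sup>N - (l - L) S f)\<close>. For \<open>l\<close> close to \<open>L\<close> the last term can be absorbed, and the bound does not
  depend on \<open>l\<close>.
\<close>

lemma resolvent_partial_sums_bounded:
  assumes T: "l2_bounded_op M T" and R: "l2_bounded_op M R" and "0 < L"
    and left: "\<And>f. f \<in> L2 M \<Longrightarrow> AE x in M. R (\<lambda>y. complex_of_real L * f y - T f y) x = f x"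
    and l: "L < l" "(l - L) * l2_opnorm M R \<le> 1 / 2" and N: "l2_opnorm M (T ^^ N) \<le> l ^ N" and f: "f \<in> L2 M"
  shows "l2norm M (\<lambda>x. \<Sum>n<N. resolvent_term T (complex_of_real l) f n x) \<le> 4 * l2_opnorm M R * l2norm M f"
proof -
  let ?l = "complex_of_real l"
  define S where "S x = (\<Sum>n<N. resolvent_term T ?l f n x)" for x
  note TD = l2_bounded_opD[OF T] and RD = l2_bounded_opD[OF R]
  have S: "S \<in> L2 M"
    unfolding S_def[abs_def] using L2_sum[of "{..<N}" "resolvent_term T ?l f"] resolvent_term_L2(1)[OF T f] by blast
  have l0: "0 < l" using assms(3) l by simp
  let ?w = "\<lambda>x. (1 / ?l ^ N) * (T ^^ N) f x"
  let ?v = "\<lambda>x. complex_of_real (l - L) * S x"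
  note TN = l2_bounded_opD(1)[OF l2_bounded_op_funpow[OF T] f, of N]
  have w: "?w \<in> L2 M" "l2norm M ?w \<le> l2norm M f"
  proof -
    have "l2norm M ?w = l2norm M ((T ^^ N) f) / l ^ N"
      using L2_cmult(2)[OF TN, of "1 / ?l ^ N"] l0 by (simp add: norm_divide norm_power)
    also have "\<dots> \<le> (l ^ N * l2norm M f) / l ^ N"
      using l2norm_le_opnorm[OF l2_bounded_op_funpow[OF T] f, of N] mult_right_mono[OF N l2norm_nonneg[of M f]] l0
      by (intro divide_right_mono) auto
    finally show "l2norm M ?w \<le> l2norm M f" using l0 by simp
  qed (rule L2_cmult(1)[OF TN])
  have v: "?v \<in> L2 M" "l2norm M ?v = (l - L) * l2norm M S" using L2_cmult[OF S, of "complex_of_real (l - L)"] l unfolding norm_of_real by simp_all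
  have fw: "(\<lambda>x. f x - ?w x) \<in> L2 M" "l2norm M (\<lambda>x. f x - ?w x) \<le> 2 * l2norm M f"
    using L2_diff[OF f w(1)] w(2) by auto
  let ?g = "\<lambda>x. (f x - ?w x) - ?v x"
  have g: "?g \<in> L2 M" "l2norm M ?g \<le> 2 * l2norm M f + (l - L) * l2norm M S"
    using L2_diff[OF fw(1) v(1)] fw(2) v(2) by auto
  have LS: "(\<lambda>y. complex_of_real L * S y - T S y) \<in> L2 M" by (rule L2_diff(1)[OF L2_cmult(1)[OF S] TD(1)[OF S]])
  have "AE x in M. complex_of_real L * S x - T S x = ?g x"
    using resolvent_partial_sum_right[OF T f, of ?l N, folded S_def[abs_def]] l0
    by (auto simp: S_def algebra_simps elim!: eventually_mono)
  then have "AE x in M. S x = R ?g x"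
    using RD(2)[OF LS g(1)] left[OF S] by (auto elim: eventually_elim2)
  then have "l2norm M S = l2norm M (R ?g)"
    by (rule l2norm_cong_AE[OF L2_measurable[OF S] L2_measurable[OF RD(1)[OF g(1)]]])
  also have "\<dots> \<le> l2_opnorm M R * l2norm M ?g" by (rule l2norm_le_opnorm[OF R g(1)])
  also have "\<dots> \<le> l2_opnorm M R * (2 * l2norm M f + (l - L) * l2norm M S)"
    by (rule mult_left_mono[OF g(2) l2_opnorm_nonneg[OF R]])
  also have "\<dots> = 2 * l2_opnorm M R * l2norm M f + ((l - L) * l2_opnorm M R) * l2norm M S" by (simp add: algebra_simps)
  also have "\<dots> \<le> 2 * l2_opnorm M R * l2norm M f + (1 / 2) * l2norm M S"
    by (intro add_left_mono mult_right_mono l) simp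
  finally show ?thesis unfolding S_def[abs_def] by simp
qed

text \<open>
  On nonnegative functions all terms of the square of the partial sum are nonnegative, and \<open>T\<^sup>n / l\<^sup>n\<^sup>+\<^sup>2\<close> occurs
  \<open>n + 1\<close> times among them.
\<close>

lemma funpow_norm_le_resolvent_square:
  assumes k: "nonneg_kernel M k T" and l: "0 < l" and n: "n < N" and f: "f \<in> L2 M" and "0 \<le> C"
    and bound: "\<And>f. f \<in> L2 M \<Longrightarrow> l2norm M (\<lambda>x. \<Sum>n<N. resolvent_term T (complex_of_real l) f n x) \<le> C * l2norm M f"
  shows "real (Suc n) * l2norm M ((T ^^ n) f) \<le> C\<^sup>2 * l ^ (n + 2) * l2norm M f"
proof -
  note T = l2_bounded_op_nonneg_kernel[OF k]
  note Tn = l2_bounded_opD[OF l2_bounded_op_funpow[OF T]]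
  let ?l = "complex_of_real l"
  define F where "F x = complex_of_real (cmod (f x))" for x
  have F: "F \<in> L2 M" "l2norm M F = l2norm M f" unfolding F_def using L2_of_real_cmod[OF f] by auto
  define S where "S g x = (\<Sum>n<N. resolvent_term T ?l g n x)" for g x
  have S: "S g \<in> L2 M" "l2norm M (S g) \<le> C * l2norm M g" if "g \<in> L2 M" for g
    using bound[OF that] L2_sum[of "{..<N}" "resolvent_term T ?l g"] resolvent_term_L2(1)[OF T that]
    unfolding S_def[abs_def] by blast+
  define r where "r m x = cmod ((T ^^ m) F x) / l ^ (m + 2)" for m x
  have real_AE: "AE x in M. (T ^^ m) F x = complex_of_real (cmod ((T ^^ m) F x))" for m
  proof (cases "m = 0")
    case False
    then obtain p where "nonneg_kernel M p (T ^^ m)" using nonneg_kernel_funpow[OF k] by blast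
    then show ?thesis unfolding F_def by (rule nonneg_kernel_abs(2)[OF _ f])
  qed (simp add: F_def)
  have SS: "AE x in M. S (S F) x = complex_of_real (\<Sum>i<N. \<Sum>j<N. r (i + j) x)"
  proof -
    have "AE x in M. (T ^^ i) (\<lambda>x. \<Sum>j<N. (1 / ?l ^ Suc j) * (T ^^ j) F x) x
        = (\<Sum>j<N. (1 / ?l ^ Suc j) * (T ^^ i) ((T ^^ j) F) x)" for i
      by (rule l2_bounded_op_lincomb_sum[OF l2_bounded_op_funpow[OF T] Tn(1)[OF F(1)]])
    then have "AE x in M. \<forall>i. (T ^^ i) (S F) x = (\<Sum>j<N. (1 / ?l ^ Suc j) * (T ^^ (i + j)) F x)"
      unfolding AE_all_countable by (simp add: S_def[abs_def] resolvent_term_def funpow_add)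
    moreover have "AE x in M. \<forall>m. (T ^^ m) F x = complex_of_real (cmod ((T ^^ m) F x))"
      unfolding AE_all_countable using real_AE by blast
    ultimately show ?thesis
    proof eventually_elim
      case (elim x)
      have "S (S F) x = (\<Sum>i<N. (1 / ?l ^ Suc i) * (\<Sum>j<N. (1 / ?l ^ Suc j) * (T ^^ (i + j)) F x))"
        unfolding S_def[of "S F"] resolvent_term_def using elim(1) by simp
      also have "\<dots> = (\<Sum>i<N. \<Sum>j<N. complex_of_real (r (i + j) x))"
        unfolding sum_distrib_left
      proof (intro sum.cong refl)
        fix i j
        have "(1 / ?l ^ Suc i) * ((1 / ?l ^ Suc j) * (T ^^ (i + j)) F x) = (T ^^ (i + j)) F x / ?l ^ (i + j + 2)"
          by (simp add: power_add field_simps)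
        also have "\<dots> = complex_of_real (r (i + j) x)"
          unfolding r_def using elim(2)[rule_format, of "i + j"] by simp
        finally show "(1 / ?l ^ Suc i) * ((1 / ?l ^ Suc j) * (T ^^ (i + j)) F x) = complex_of_real (r (i + j) x)" .
      qed
      finally show ?case by simp
    qed
  qed
  have r_nonneg: "0 \<le> r m x" for m x unfolding r_def using l by simp
  have ge: "real (Suc n) * r n x \<le> (\<Sum>i<N. \<Sum>j<N. r (i + j) x)" for x
  proof -
    have "real (Suc n) * r n x = (\<Sum>i\<le>n. r n x)" by simp
    also have "\<dots> \<le> (\<Sum>i\<le>n. \<Sum>j<N. r (i + j) x)"
    proof (rule sum_mono)
      fix i assume i: "i \<in> {..n}"
      then have "r (i + (n - i)) x \<le> (\<Sum>j<N. r (i + j) x)"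
        using n r_nonneg by (intro member_le_sum) auto
      then show "r n x \<le> (\<Sum>j<N. r (i + j) x)" using i by simp
    qed
    also have "\<dots> \<le> (\<Sum>i<N. \<Sum>j<N. r (i + j) x)"
      using n r_nonneg by (intro sum_mono2) (auto intro!: sum_nonneg)
    finally show ?thesis .
  qed
  let ?q = "complex_of_real (real (Suc n) / l ^ (n + 2))"
  have "l2norm M (\<lambda>x. ?q * (T ^^ n) F x) \<le> l2norm M (S (S F))"
  proof (rule L2_dominated(2)[OF S(1)[OF S(1)[OF F(1)]]])
    show "(\<lambda>x. ?q * (T ^^ n) F x) \<in> borel_measurable M" by (rule L2_measurable[OF L2_cmult(1)[OF Tn(1)[OF F(1)]]])
    show "AE x in M. cmod (?q * (T ^^ n) F x) \<le> cmod (S (S F) x)"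
      using SS
    proof eventually_elim
      case (elim x)
      have "cmod (?q * (T ^^ n) F x) = real (Suc n) * r n x"
        using l unfolding norm_mult norm_of_real by (simp add: r_def)
      also note ge
      also have "(\<Sum>i<N. \<Sum>j<N. r (i + j) x) \<le> cmod (S (S F) x)" unfolding elim norm_of_real by simp
      finally show ?case .
    qed
  qed
  also have "\<dots> \<le> C * (C * l2norm M f)"
    using S(2)[OF S(1)[OF F(1)]] mult_left_mono[OF S(2)[OF F(1)] assms(5)] F(2) by simp
  finally have "real (Suc n) / l ^ (n + 2) * l2norm M ((T ^^ n) F) \<le> C\<^sup>2 * l2norm M f"
    unfolding L2_cmult(2)[OF Tn(1)[OF F(1)]] norm_of_real using l by (simp add: power2_eq_square mult.assoc)
  then have F_bound: "real (Suc n) * l2norm M ((T ^^ n) F) \<le> C\<^sup>2 * l ^ (n + 2) * l2norm M f"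
    using l by (simp add: field_simps)
  have "l2norm M ((T ^^ n) f) \<le> l2norm M ((T ^^ n) F)"
  proof (cases "n = 0")
    case False
    then obtain p where p: "nonneg_kernel M p (T ^^ n)" using nonneg_kernel_funpow[OF k] by blast
    show ?thesis
      unfolding F_def
      by (rule L2_dominated(2)[OF Tn(1)[OF F(1), unfolded F_def] L2_measurable[OF Tn(1)[OF f]] nonneg_kernel_mono_AE[OF p f f]]) simp
  qed (simp add: F)
  then have "real (Suc n) * l2norm M ((T ^^ n) f) \<le> real (Suc n) * l2norm M ((T ^^ n) F)" by (rule mult_left_mono) simp
  then show ?thesis using F_bound by linarith
qed

text \<open>
  Otherwise \<open>(n + 1) L\<^sup>n \<le> (n + 1) \<parallel>T\<^sup>n\<parallel> \<le> C\<^sup>2 L\<^sup>n\<^sup>+\<^sup>2\<close> for all \<open>n > 0\<close>, as the bounds for \<open>l > L\<close> hold uniformly as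
  \<open>l\<close> decreases to \<open>L\<close>.
\<close>

lemma radius_in_spectrum:
  assumes k: "nonneg_kernel M k T" and pos: "0 < root_radius (l2_opnorm M) T"
  shows "complex_of_real (root_radius (l2_opnorm M) T) \<in> l2_spectrum M T"
proof (rule ccontr)
  define L where "L = root_radius (l2_opnorm M) T"
  note T = l2_bounded_op_nonneg_kernel[OF k]
  have L: "0 < L" using pos by (simp add: L_def)
  assume "\<not> ?thesis"
  then obtain R where R: "l2_bounded_op M R"
    and left: "\<And>f. f \<in> L2 M \<Longrightarrow> AE x in M. R (\<lambda>y. complex_of_real L * f y - T f y) x = f x"
    unfolding l2_spectrum_def L_def by blast
  define C where "C = 4 * l2_opnorm M R"
  have C: "0 \<le> C" unfolding C_def using l2_opnorm_nonneg[OF R] by simp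
  \<comment> \<open>For \<open>l - L < d\<close> the perturbation \<open>(l - L) R\<close> has norm at most \<open>1/2\<close>.\<close>
  define d where "d = 1 / (2 * (l2_opnorm M R + 1))"
  have d: "0 < d" unfolding d_def using l2_opnorm_nonneg[OF R] by (simp add: add_nonneg_pos)
  have main: "real (Suc n) * L ^ n \<le> C\<^sup>2 * l ^ (n + 2)" if n: "0 < n" and l: "L < l" "l < L + d" for n l
  proof -
    have l0: "0 < l" using L l by simp
    have lR: "(l - L) * l2_opnorm M R \<le> 1 / 2"
    proof -
      have "(l - L) * l2_opnorm M R \<le> d * (l2_opnorm M R + 1)"
        using l l2_opnorm_nonneg[OF R] d by (intro mult_mono) auto
      also have "\<dots> = 1 / 2" unfolding d_def using l2_opnorm_nonneg[OF R] by (simp add: field_simps)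
      finally show ?thesis .
    qed
    have "eventually (\<lambda>N. root N (l2_opnorm M (T ^^ N)) < l) sequentially"
      using opnorm_radius_limit(1)[OF k] l(1) unfolding L_def by (rule order_tendstoD(2))
    then have "eventually (\<lambda>N. root N (l2_opnorm M (T ^^ N)) < l \<and> n < N) sequentially"
      using eventually_gt_at_top[of n] by (rule eventually_conj)
    then obtain N where N: "root N (l2_opnorm M (T ^^ N)) < l" "n < N" by (auto simp: eventually_sequentially)
    have nn: "0 \<le> l2_opnorm M (T ^^ N)" by (rule l2_opnorm_nonneg[OF l2_bounded_op_funpow[OF T]])
    have "l2_opnorm M (T ^^ N) = root N (l2_opnorm M (T ^^ N)) ^ N" using N(2) nn by simp
    also have "\<dots> \<le> l ^ N" using N nn by (intro power_mono) auto
    finally have N': "l2_opnorm M (T ^^ N) \<le> l ^ N" .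
    have "l2_opnorm M (T ^^ n) \<le> C\<^sup>2 * l ^ (n + 2) / real (Suc n)"
    proof (rule l2_opnorm_le)
      fix f assume f: "f \<in> L2 M" "l2norm M f \<le> 1"
      have "real (Suc n) * l2norm M ((T ^^ n) f) \<le> C\<^sup>2 * l ^ (n + 2) * l2norm M f"
        by (rule funpow_norm_le_resolvent_square[OF k l0 N(2) f(1) C])
           (unfold C_def, rule resolvent_partial_sums_bounded[OF T R L left l(1) lR N'])
      also have "\<dots> \<le> C\<^sup>2 * l ^ (n + 2) * 1" using f(2) l0 by (intro mult_left_mono) auto
      finally show "l2norm M ((T ^^ n) f) \<le> C\<^sup>2 * l ^ (n + 2) / real (Suc n)" by (simp add: field_simps)
    qed
    then have "L ^ n \<le> C\<^sup>2 * l ^ (n + 2) / real (Suc n)"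
      using opnorm_radius_limit(3)[OF k n] unfolding L_def by simp
    then show ?thesis by (simp add: field_simps)
  qed
  have lim: "real (Suc n) * L ^ n \<le> C\<^sup>2 * L ^ (n + 2)" if n: "0 < n" for n
  proof (rule tendsto_lowerbound)
    show "((\<lambda>l. C\<^sup>2 * l ^ (n + 2)) \<longlongrightarrow> C\<^sup>2 * L ^ (n + 2)) (at_right L)" by (intro tendsto_intros)
    show "eventually (\<lambda>l. real (Suc n) * L ^ n \<le> C\<^sup>2 * l ^ (n + 2)) (at_right L)"
      unfolding eventually_at_right[of L "L + d", simplified, OF d] using main[OF n] d by (intro exI[of _ "L + d"]) auto
  qed simp
  have "real (Suc n) \<le> C\<^sup>2 * L\<^sup>2" if "0 < n" for n
    using lim[OF that] L by (simp add: power_add power2_eq_square)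
  then have "real (Suc (Suc n)) \<le> C\<^sup>2 * L\<^sup>2" for n by blast
  moreover obtain m :: nat where "C\<^sup>2 * L\<^sup>2 < real m" using reals_Archimedean2 by blast
  ultimately show False by (smt (verit) of_nat_Suc)
qed

text \<open>
  Gelfand's formula; \<open>spectrum_bound\<close> and \<open>radius_in_spectrum\<close> are its two halves.
\<close>

theorem spectral_radius_eq_root_radius:
  assumes k: "nonneg_kernel M k T"
  shows "spectral_radius M T = root_radius (l2_opnorm M) T"
proof -
  let ?L = "root_radius (l2_opnorm M) T"
  have L: "0 \<le> ?L" by (rule opnorm_radius_limit(2)[OF k])
  have le: "r \<le> ?L" if "r \<in> insert 0 (cmod ` l2_spectrum M T)" for r
    using that L spectrum_bound[OF k] by (auto simp: not_less[symmetric])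
  have bdd: "bdd_above (insert 0 (cmod ` l2_spectrum M T))" using le by (rule bdd_aboveI)
  show ?thesis
    unfolding spectral_radius_def
  proof (rule antisym)
    show "Sup (insert 0 (cmod ` l2_spectrum M T)) \<le> ?L" using le by (intro cSup_least) auto
    show "?L \<le> Sup (insert 0 (cmod ` l2_spectrum M T))"
    proof (rule cSup_upper[OF _ bdd], cases "?L = 0")
      case False
      then have "complex_of_real ?L \<in> l2_spectrum M T" using L radius_in_spectrum[OF k] by simp
      then have "cmod (complex_of_real ?L) \<in> cmod ` l2_spectrum M T" by blast
      then show "?L \<in> insert 0 (cmod ` l2_spectrum M T)" using L by simp
    qed simp
  qed
qed

end

section \<open>Products and sums of symmetrized operators\<close>

context l2_space
begin

lemma hadamard_log_convex_cong:
  assumes "hadamard_log_convex M \<rho>" and "\<And>k T. nonneg_kernel M k T \<Longrightarrow> \<rho>' T = \<rho> T"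
  shows "hadamard_log_convex M \<rho>'"
  using assms(1) unfolding hadamard_log_convex_def by (simp add: assms(2))

lemma ess_spectral_radius_eq_root_radius: "ess_spectral_radius M T = root_radius (hausdorff_mnc M) T"
  by (simp add: ess_spectral_radius_def root_radius_def)

lemma radii_log_convex:
  assumes "\<rho> \<in> {spectral_radius M, ess_spectral_radius M, hausdorff_mnc M, l2_opnorm M, numerical_radius M}"
  shows "hadamard_log_convex M \<rho>"
proof -
  have "hadamard_log_convex M (spectral_radius M)"
    by (rule hadamard_log_convex_cong[OF hadamard_log_convex_root_radius[OF opnorm_log_convex kernel_submultiplicative_opnorm]
          spectral_radius_eq_root_radius])
  moreover have "hadamard_log_convex M (ess_spectral_radius M)"
    by (rule hadamard_log_convex_cong[OF
          hadamard_log_convex_root_radius[OF hausdorff_mnc_log_convex kernel_submultiplicative_hausdorff_mnc]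
          ess_spectral_radius_eq_root_radius])
  ultimately show ?thesis
    using assms opnorm_log_convex hausdorff_mnc_log_convex
      dominated_seminorm_imp_log_convex[OF dominated_seminorm_numerical_radius] by blast
qed

lemma radii_commute:
  assumes "\<rho> \<in> {spectral_radius M, ess_spectral_radius M}"
    and k: "nonneg_kernel M k S" and h: "nonneg_kernel M h T"
  shows "\<rho> (T \<circ> S) \<le> \<rho> (S \<circ> T)"
proof -
  have "spectral_radius M (T \<circ> S) \<le> spectral_radius M (S \<circ> T)"
    unfolding spectral_radius_eq_root_radius[OF nonneg_kernel_comp[OF h k]]
      spectral_radius_eq_root_radius[OF nonneg_kernel_comp[OF k h]]
    by (rule root_radius_commute_le[OF opnorm_log_convex kernel_submultiplicative_opnorm h k])
  moreover have "ess_spectral_radius M (T \<circ> S) \<le> ess_spectral_radius M (S \<circ> T)"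
    unfolding ess_spectral_radius_eq_root_radius
    by (rule root_radius_commute_le[OF hausdorff_mnc_log_convex kernel_submultiplicative_hausdorff_mnc h k])
  ultimately show ?thesis using assms(1) by blast
qed

lemma op_prod_simps: "op_prod [] = id" "op_prod (K # Ks) = K \<circ> op_prod Ks"
  by (simp_all add: op_prod_def)

lemma op_prod_snoc: "op_prod (Ks @ [K]) = op_prod Ks \<circ> K"
  by (induction Ks) (auto simp: op_prod_simps comp_assoc)

lemma op_sum_Cons: "op_sum (K # Ks) = (\<lambda>f x. K f x + op_sum Ks f x)"
  by (simp add: op_sum_def fun_eq_iff)

context
  fixes \<alpha> :: real
  assumes \<alpha>: "0 \<le> \<alpha>" "\<alpha> \<le> 1"
begin

lemma nonneg_kernel_S_op:
  assumes "nonneg_kernel M k T"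
  shows "nonneg_kernel M (kernel_mean \<alpha> k (kernel_transpose k)) (S_op M \<alpha> T)"
  unfolding S_op_def by (rule nonneg_kernel_hadamard_mean[OF assms nonneg_kernel_adjoint[OF assms] \<alpha>])

text \<open>
  The adjoint of the reversed product has the transposed kernel, and transposition reverses products
  again; so the second kernel in the mean multiplies in the same order as the first.
\<close>

lemma op_prod_S_op_kernels:
  assumes "Ks \<noteq> []" "\<forall>T\<in>set Ks. positive_kernel_op M T"
  shows "\<exists>p q s. nonneg_kernel M p (op_prod Ks) \<and> nonneg_kernel M q (op_prod (rev Ks)) \<and>
    nonneg_kernel M s (op_prod (map (S_op M \<alpha>) Ks)) \<and> (AE x in M \<Otimes>\<^sub>M M. s x \<le> kernel_mean \<alpha> p (kernel_transpose q) x)"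
  using assms
proof (induction Ks rule: list_nonempty_induct)
  case (single K)
  obtain k where k: "nonneg_kernel M k K" using single obtain_nonneg_kernel[of K] by auto
  show ?case
    using k nonneg_kernel_S_op[OF k]
    by (intro exI[of _ k] exI[of _ "kernel_mean \<alpha> k (kernel_transpose k)"]) (simp add: op_prod_simps)
next
  case (cons K Ks)
  obtain k where k: "nonneg_kernel M k K" using cons.prems obtain_nonneg_kernel[of K] by auto
  obtain p q s where ih: "nonneg_kernel M p (op_prod Ks)" "nonneg_kernel M q (op_prod (rev Ks))"
    "nonneg_kernel M s (op_prod (map (S_op M \<alpha>) Ks))" "AE x in M \<Otimes>\<^sub>M M. s x \<le> kernel_mean \<alpha> p (kernel_transpose q) x"
    using cons by auto
  note Sk = nonneg_kernel_S_op[OF k]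
  have "AE x in M \<Otimes>\<^sub>M M. kernel_comp M (kernel_mean \<alpha> k (kernel_transpose k)) s x
      \<le> kernel_mean \<alpha> (kernel_comp M k p) (kernel_comp M (kernel_transpose k) (kernel_transpose q)) x"
    by (rule kernel_comp_mean_le[OF Sk ih(3) k ih(1) nonneg_kernel_adjoint[OF k] nonneg_kernel_adjoint[OF ih(2)] \<alpha> _ ih(4)])
       simp
  then have "AE x in M \<Otimes>\<^sub>M M. kernel_comp M (kernel_mean \<alpha> k (kernel_transpose k)) s x \<le> kernel_mean \<alpha> (kernel_comp M k p) (kernel_transpose (kernel_comp M q k)) x"
    unfolding kernel_comp_swap .
  moreover have "nonneg_kernel M (kernel_comp M k p) (op_prod (K # Ks))"
    unfolding op_prod_simps by (rule nonneg_kernel_comp[OF k ih(1)])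
  moreover have "nonneg_kernel M (kernel_comp M q k) (op_prod (rev (K # Ks)))"
    unfolding rev.simps op_prod_snoc by (rule nonneg_kernel_comp[OF ih(2) k])
  moreover have "nonneg_kernel M (kernel_comp M (kernel_mean \<alpha> k (kernel_transpose k)) s) (op_prod (map (S_op M \<alpha>) (K # Ks)))"
    unfolding list.map op_prod_simps by (rule nonneg_kernel_comp[OF Sk ih(3)])
  ultimately show ?case by blast
qed

lemma op_sum_S_op_kernels:
  assumes "\<forall>T\<in>set Ks. positive_kernel_op M T"
  shows "\<exists>p s. nonneg_kernel M p (op_sum Ks) \<and> nonneg_kernel M s (op_sum (map (S_op M \<alpha>) Ks)) \<and>
    (\<forall>x. s x \<le> kernel_mean \<alpha> p (kernel_transpose p) x)"
  using assms
proof (induction Ks)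
  case Nil
  have "(op_sum [] :: 'a l2op) = (\<lambda>f x. 0)" by (simp add: op_sum_def fun_eq_iff)
  then show ?case
    using nonneg_kernel_zero by (intro exI[of _ "\<lambda>p. 0"]) (simp add: kernel_mean_nonneg)
next
  case (Cons K Ks)
  obtain k where k: "nonneg_kernel M k K" using Cons.prems obtain_nonneg_kernel[of K] by auto
  obtain p s where ih: "nonneg_kernel M p (op_sum Ks)" "nonneg_kernel M s (op_sum (map (S_op M \<alpha>) Ks))"
    "\<And>x. s x \<le> kernel_mean \<alpha> p (kernel_transpose p) x"
    using Cons by auto
  note Sk = nonneg_kernel_S_op[OF k]
  have nn: "0 \<le> k x" "0 \<le> kernel_transpose k x" "0 \<le> p x" "0 \<le> kernel_transpose p x" for x
    using nonneg_kernelD(2)[OF k] nonneg_kernelD(2)[OF ih(1)] by (auto simp: kernel_transpose_def)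
  have "kernel_mean \<alpha> k (kernel_transpose k) x + s x \<le> kernel_mean \<alpha> (\<lambda>x. k x + p x) (kernel_transpose (\<lambda>x. k x + p x)) x" for x
  proof -
    have "kernel_mean \<alpha> k (kernel_transpose k) x + s x \<le> kernel_mean \<alpha> k (kernel_transpose k) x + kernel_mean \<alpha> p (kernel_transpose p) x" using ih(3) by simp
    also have "\<dots> \<le> kernel_mean \<alpha> (\<lambda>x. k x + p x) (\<lambda>x. kernel_transpose k x + kernel_transpose p x) x" using nn \<alpha> by (intro kernel_mean_add_le)
    finally show ?thesis by (simp add: kernel_mean_def kernel_transpose_def)
  qed
  moreover have "nonneg_kernel M (\<lambda>x. k x + p x) (op_sum (K # Ks))"
    unfolding op_sum_Cons by (rule nonneg_kernel_add[OF k ih(1)])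
  moreover have "nonneg_kernel M (\<lambda>x. kernel_mean \<alpha> k (kernel_transpose k) x + s x) (op_sum (map (S_op M \<alpha>) (K # Ks)))"
    unfolding list.map op_sum_Cons by (rule nonneg_kernel_add[OF Sk ih(2)])
  ultimately show ?case
    by (intro exI[of _ "\<lambda>x. k x + p x"] exI[of _ "\<lambda>x. kernel_mean \<alpha> k (kernel_transpose k) x + s x"]) simp
qed

lemma log_convex_op_prod:
  assumes \<rho>: "hadamard_log_convex M \<rho>" and Ks: "Ks \<noteq> []" "\<forall>T\<in>set Ks. positive_kernel_op M T"
  shows "\<rho> (op_prod (map (S_op M \<alpha>) Ks)) \<le> \<rho> (hadamard_mean M \<alpha> (op_prod Ks) (l2_adjoint M (op_prod (rev Ks))))"
    and "\<rho> (hadamard_mean M \<alpha> (op_prod Ks) (l2_adjoint M (op_prod (rev Ks))))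
      \<le> rpow (\<rho> (op_prod Ks)) \<alpha> * rpow (\<rho> (op_prod (rev Ks))) (1 - \<alpha>)"
proof -
  obtain p q s where k: "nonneg_kernel M p (op_prod Ks)" "nonneg_kernel M q (op_prod (rev Ks))"
    "nonneg_kernel M s (op_prod (map (S_op M \<alpha>) Ks))" "AE x in M \<Otimes>\<^sub>M M. s x \<le> kernel_mean \<alpha> p (kernel_transpose q) x"
    using op_prod_S_op_kernels[OF Ks] by blast
  note adj = nonneg_kernel_adjoint[OF k(2)]
  note mean = nonneg_kernel_hadamard_mean[OF k(1) adj \<alpha>]
  show "\<rho> (op_prod (map (S_op M \<alpha>) Ks)) \<le> \<rho> (hadamard_mean M \<alpha> (op_prod Ks) (l2_adjoint M (op_prod (rev Ks))))"
    by (rule hadamard_log_convex_mono[OF \<rho> k(3) mean k(4)])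
  have "\<rho> (hadamard_mean M \<alpha> (op_prod Ks) (l2_adjoint M (op_prod (rev Ks))))
      \<le> rpow (\<rho> (op_prod Ks)) \<alpha> * rpow (\<rho> (l2_adjoint M (op_prod (rev Ks)))) (1 - \<alpha>)"
    by (rule hadamard_log_convexD(3)[OF \<rho> \<alpha> mean k(1) adj]) simp
  also have "\<dots> \<le> rpow (\<rho> (op_prod Ks)) \<alpha> * rpow (\<rho> (op_prod (rev Ks))) (1 - \<alpha>)"
    using hadamard_log_convexD(1)[OF \<rho> adj] hadamard_log_convexD(2)[OF \<rho> k(2) adj] \<alpha>
    by (intro mult_left_mono rpow_mono) auto
  finally show "\<rho> (hadamard_mean M \<alpha> (op_prod Ks) (l2_adjoint M (op_prod (rev Ks))))
      \<le> rpow (\<rho> (op_prod Ks)) \<alpha> * rpow (\<rho> (op_prod (rev Ks))) (1 - \<alpha>)" .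
qed

text \<open>
  \<open>S\<^sub>\<alpha>(T)\<close> is a mean of \<open>T\<close> and its adjoint, on which \<open>\<rho>\<close> takes the same value.
\<close>

lemma log_convex_S_op:
  assumes \<rho>: "hadamard_log_convex M \<rho>" and k: "nonneg_kernel M k T"
  shows "\<rho> (S_op M \<alpha> T) \<le> \<rho> T"
proof -
  note adj = nonneg_kernel_adjoint[OF k]
  have "\<rho> (S_op M \<alpha> T) \<le> rpow (\<rho> T) \<alpha> * rpow (\<rho> (l2_adjoint M T)) (1 - \<alpha>)"
    by (rule hadamard_log_convexD(3)[OF \<rho> \<alpha> nonneg_kernel_S_op[OF k] k adj]) simp
  also have "\<dots> \<le> rpow (\<rho> T) \<alpha> * rpow (\<rho> T) (1 - \<alpha>)"
    using hadamard_log_convexD(1)[OF \<rho> adj] hadamard_log_convexD(2)[OF \<rho> k adj] \<alpha>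
    by (intro mult_left_mono rpow_mono) auto
  also have "\<dots> = \<rho> T" by (rule rpow_self_mean[OF hadamard_log_convexD(1)[OF \<rho> k]])
  finally show ?thesis .
qed

lemma log_convex_op_sum:
  assumes \<rho>: "hadamard_log_convex M \<rho>" and Ks: "\<forall>T\<in>set Ks. positive_kernel_op M T"
  shows "\<rho> (op_sum (map (S_op M \<alpha>) Ks)) \<le> \<rho> (S_op M \<alpha> (op_sum Ks))"
    and "\<rho> (S_op M \<alpha> (op_sum Ks)) \<le> \<rho> (op_sum Ks)"
proof -
  obtain p s where k: "nonneg_kernel M p (op_sum Ks)" "nonneg_kernel M s (op_sum (map (S_op M \<alpha>) Ks))"
    "\<And>x. s x \<le> kernel_mean \<alpha> p (kernel_transpose p) x"
    using op_sum_S_op_kernels[OF Ks] by blast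
  show "\<rho> (op_sum (map (S_op M \<alpha>) Ks)) \<le> \<rho> (S_op M \<alpha> (op_sum Ks))"
    by (rule hadamard_log_convex_mono[OF \<rho> k(2) nonneg_kernel_S_op[OF k(1)]]) (simp add: k(3))
  show "\<rho> (S_op M \<alpha> (op_sum Ks)) \<le> \<rho> (op_sum Ks)" by (rule log_convex_S_op[OF \<rho> k(1)])
qed

lemma radii_two_factors:
  assumes \<rho>: "\<rho> \<in> {spectral_radius M, ess_spectral_radius M}"
    and K: "positive_kernel_op M K1" "positive_kernel_op M K2"
  shows "\<rho> (S_op M \<alpha> K1 \<circ> S_op M \<alpha> K2) \<le> \<rho> (hadamard_mean M \<alpha> (K1 \<circ> K2) (l2_adjoint M (K2 \<circ> K1)))"
    and "\<rho> (hadamard_mean M \<alpha> (K1 \<circ> K2) (l2_adjoint M (K2 \<circ> K1))) \<le> \<rho> (K1 \<circ> K2)"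
proof -
  obtain k1 k2 where k: "nonneg_kernel M k1 K1" "nonneg_kernel M k2 K2"
    using obtain_nonneg_kernel[OF K(1)] obtain_nonneg_kernel[OF K(2)] by metis
  have conv: "hadamard_log_convex M \<rho>" by (rule radii_log_convex) (use \<rho> in blast)
  have prod: "op_prod [K1, K2] = K1 \<circ> K2" "op_prod (rev [K1, K2]) = K2 \<circ> K1"
    "op_prod (map (S_op M \<alpha>) [K1, K2]) = S_op M \<alpha> K1 \<circ> S_op M \<alpha> K2"
    by (simp_all add: op_prod_simps)
  have pos: "[K1, K2] \<noteq> []" "\<forall>T\<in>set [K1, K2]. positive_kernel_op M T" using K by auto
  note bounds = log_convex_op_prod[OF conv pos, unfolded prod]
  show "\<rho> (S_op M \<alpha> K1 \<circ> S_op M \<alpha> K2) \<le> \<rho> (hadamard_mean M \<alpha> (K1 \<circ> K2) (l2_adjoint M (K2 \<circ> K1)))"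
    by (rule bounds(1))
  note nn = hadamard_log_convexD(1)[OF conv nonneg_kernel_comp[OF k(1,2)]]
    hadamard_log_convexD(1)[OF conv nonneg_kernel_comp[OF k(2,1)]]
  have "\<rho> (hadamard_mean M \<alpha> (K1 \<circ> K2) (l2_adjoint M (K2 \<circ> K1)))
      \<le> rpow (\<rho> (K1 \<circ> K2)) \<alpha> * rpow (\<rho> (K2 \<circ> K1)) (1 - \<alpha>)" by (rule bounds(2))
  also have "\<dots> \<le> rpow (\<rho> (K1 \<circ> K2)) \<alpha> * rpow (\<rho> (K1 \<circ> K2)) (1 - \<alpha>)"
    using radii_commute[OF \<rho> k] nn \<alpha> by (intro mult_left_mono rpow_mono) auto
  also have "\<dots> = \<rho> (K1 \<circ> K2)" by (rule rpow_self_mean[OF nn(1)])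
  finally show "\<rho> (hadamard_mean M \<alpha> (K1 \<circ> K2) (l2_adjoint M (K2 \<circ> K1))) \<le> \<rho> (K1 \<circ> K2)" .
qed

end

end

theorem proposition2p2:
  fixes M :: "'a measure" and K :: "'a l2op" and Ks :: "'a l2op list" and \<alpha> :: real
  assumes "sigma_finite_measure M" and "space M \<noteq> {}"
    and "positive_kernel_op M K"
    and "Ks \<noteq> []" and "\<forall>T\<in>set Ks. positive_kernel_op M T"
    and "0 \<le> \<alpha>" and "\<alpha> \<le> 1"
  shows
    "(\<forall>\<rho>\<in>{spectral_radius M, ess_spectral_radius M, hausdorff_mnc M, l2_opnorm M,
           numerical_radius M}.
        \<rho> (op_prod (map (S_op M \<alpha>) Ks))
          \<le> \<rho> (hadamard_mean M \<alpha> (op_prod Ks) (l2_adjoint M (op_prod (rev Ks)))) \<and>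
        \<rho> (hadamard_mean M \<alpha> (op_prod Ks) (l2_adjoint M (op_prod (rev Ks))))
          \<le> rpow (\<rho> (op_prod Ks)) \<alpha> * rpow (\<rho> (op_prod (rev Ks))) (1 - \<alpha>) \<and>
        \<rho> (op_sum (map (S_op M \<alpha>) Ks)) \<le> \<rho> (S_op M \<alpha> (op_sum Ks)) \<and>
        \<rho> (S_op M \<alpha> (op_sum Ks)) \<le> \<rho> (op_sum Ks) \<and>
        \<rho> (S_op M \<alpha> K) \<le> \<rho> K) \<and>
     (\<forall>\<rho>\<in>{spectral_radius M, ess_spectral_radius M}. \<forall>K1 K2.
        positive_kernel_op M K1 \<longrightarrow> positive_kernel_op M K2 \<longrightarrow>
        \<rho> (S_op M \<alpha> K1 \<circ> S_op M \<alpha> K2)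
          \<le> \<rho> (hadamard_mean M \<alpha> (K1 \<circ> K2) (l2_adjoint M (K2 \<circ> K1))) \<and>
        \<rho> (hadamard_mean M \<alpha> (K1 \<circ> K2) (l2_adjoint M (K2 \<circ> K1))) \<le> \<rho> (K1 \<circ> K2))"
proof -
  interpret l2_space M by (rule l2_space.intro) fact
  show ?thesis
  proof (intro conjI ballI allI impI)
    fix \<rho> assume "\<rho> \<in> {spectral_radius M, ess_spectral_radius M, hausdorff_mnc M, l2_opnorm M, numerical_radius M}"
    then have \<rho>: "hadamard_log_convex M \<rho>" by (rule radii_log_convex)
    show "\<rho> (op_prod (map (S_op M \<alpha>) Ks))
        \<le> \<rho> (hadamard_mean M \<alpha> (op_prod Ks) (l2_adjoint M (op_prod (rev Ks))))"
      "\<rho> (hadamard_mean M \<alpha> (op_prod Ks) (l2_adjoint M (op_prod (rev Ks))))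
        \<le> rpow (\<rho> (op_prod Ks)) \<alpha> * rpow (\<rho> (op_prod (rev Ks))) (1 - \<alpha>)"
      by (rule log_convex_op_prod[OF assms(6,7) \<rho> assms(4,5)])+
    show "\<rho> (op_sum (map (S_op M \<alpha>) Ks)) \<le> \<rho> (S_op M \<alpha> (op_sum Ks))"
      "\<rho> (S_op M \<alpha> (op_sum Ks)) \<le> \<rho> (op_sum Ks)"
      by (rule log_convex_op_sum[OF assms(6,7) \<rho> assms(5)])+
    obtain k where "nonneg_kernel M k K" using obtain_nonneg_kernel[OF assms(3)] .
    then show "\<rho> (S_op M \<alpha> K) \<le> \<rho> K" by (rule log_convex_S_op[OF assms(6,7) \<rho>])
  next
    fix \<rho> K1 K2
    assume "\<rho> \<in> {spectral_radius M, ess_spectral_radius M}" "positive_kernel_op M K1" "positive_kernel_op M K2"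
    from radii_two_factors[OF assms(6,7) this]
    show "\<rho> (S_op M \<alpha> K1 \<circ> S_op M \<alpha> K2) \<le> \<rho> (hadamard_mean M \<alpha> (K1 \<circ> K2) (l2_adjoint M (K2 \<circ> K1)))"
      "\<rho> (hadamard_mean M \<alpha> (K1 \<circ> K2) (l2_adjoint M (K2 \<circ> K1))) \<le> \<rho> (K1 \<circ> K2)" .
  qed
qed

end
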